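(* For each integer $k>0$ the following hold. (a) There is a cubic graph $G$ admitting two polyhedral embeddings $P$ and $P'$ such that the genera of $P$ and $P'$ differ by at least $k$ and $G$ has no polyhedral embedding in any genus strictly between the genus of $P$ and the genus of $P'$. (b) There is a cubic graph $G$ admitting polyhedral embeddings in at least $k$ different genera. (c) There are a cubic graph $G$ and a genus $g$ such that $n_g(G)\ge k$. In fact, for each genus $g\ge 0$ there is a cubic graph $G$ with $n_g(G)\ge 8^g$. Both statements remain true if one requires the embeddings to be pairwise non-isomorphic (that is, there are a cubic graph $G$ and a genus $g$ such that $G$ has at least $k$ pairwise non-isomorphic polyhedral embeddings of genus $g$; and for each $g$ there is a cubic graph with at least $8^g$ pairwise non-isomorphic polyhedral embeddings of genus $g$). (d) There is a cubic graph $G$ that has a polyhedral embedding and for which the smallest genus of a polyhedral embedding of $G$ differs from $\mathrm{mingen}(G)$ by at least $k$.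
   Context: Graphs are finite and simple. Embeddings are combinatorial embeddings of connected graphs in closed oriented surfaces: an embedding of $G$ is a rotation system, i.e. an assignment to each vertex of a cyclic order of the directed edges starting there. Each undirected edge is regarded as two inverse directed edges $e,e^{-1}$; $\mathrm{nx}(e)$ is the successor of $e$ in the cyclic order at its start vertex; a face is a cyclic sequence $e_0,\dots,e_{k-1}$ of directed edges with $\mathrm{nx}(e_i^{-1})=e_{(i+1)\bmod k}$ for all $i$. The genus $g$ of an embedding is given by $|V|-|E|+|F|=2-2g$. The mirror image of an embedding reverses the cyclic order at every vertex. An isomorphism between embedded graphs is a graph isomorphism that respects the cyclic order at every vertex or reverses it at every vertex. An embedding is polyhedral if each facial walk is a simple cycle and the intersection of any two distinct faces is empty, a single vertex, or a single edge. For a cubic graph $G$ and a genus $g$, $n_g(G)$ is the number of different polyhedral embeddings (rotation systems) of $G$ of genus $g$, with mirror images identified. $\mathrm{mingen}(G)$ is the smallest genus of an orientable surface in which $G$ can be embedded. *)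

theory Defs
  imports "Graph_Theory.Graph_Theory" "HOL-Combinatorics.Orbits"
begin

text \<open>
  Finite simple graphs are the loopfree symmetric \<open>pair_graph\<close>s: every undirected edge \<open>{u, v}\<close>
  is the pair of inverse arcs \<open>(u, v)\<close> and \<open>(v, u)\<close>, so that \<open>prod.swap\<close> inverts an arc.
\<close>

definition cubic_graph :: "'a pair_pre_digraph \<Rightarrow> bool" where
  "cubic_graph G \<longleftrightarrow> pair_graph G \<and> (\<forall>v \<in> pverts G. out_degree (with_proj G) v = 3)"

definition undirected :: "('a \<times> 'a) set \<Rightarrow> 'a set set" where
  "undirected A = (\<lambda>(u, v). {u, v}) ` A"

text \<open>
  A rotation system is given by its successor function \<open>nx\<close> on the arcs. Since \<open>permutes\<close> makes
  \<open>nx\<close> the identity off the arcs, distinct functions are distinct rotation systems, and \<open>inv nx\<close>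
  reverses the cyclic order at every vertex.
\<close>

definition embedding :: "'a pair_pre_digraph \<Rightarrow> ('a \<times> 'a \<Rightarrow> 'a \<times> 'a) \<Rightarrow> bool" where
  "embedding G nx \<longleftrightarrow> pair_graph G \<and> Digraph_Component.connected (with_proj G) \<and>
     nx permutes parcs G \<and>
     (\<forall>v \<in> pverts G. out_arcs (with_proj G) v \<noteq> {} \<longrightarrow> cyclic_on nx (out_arcs (with_proj G) v))"

definition mirror :: "('a \<times> 'a \<Rightarrow> 'a \<times> 'a) \<Rightarrow> 'a \<times> 'a \<Rightarrow> 'a \<times> 'a" where
  "mirror nx = inv nx"

text \<open>
  The arcs of a face follow each other by \<open>e \<mapsto> nx (e\<inverse>)\<close>; this is a permutation of the arcs,
  so a face, being a cyclic sequence, is determined by the set of its arcs.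
\<close>

definition face_succ :: "('a \<times> 'a \<Rightarrow> 'a \<times> 'a) \<Rightarrow> 'a \<times> 'a \<Rightarrow> 'a \<times> 'a" where
  "face_succ nx e = nx (prod.swap e)"

definition faces :: "'a pair_pre_digraph \<Rightarrow> ('a \<times> 'a \<Rightarrow> 'a \<times> 'a) \<Rightarrow> ('a \<times> 'a) set set" where
  "faces G nx = orbit (face_succ nx) ` parcs G"

definition has_genus :: "'a pair_pre_digraph \<Rightarrow> ('a \<times> 'a \<Rightarrow> 'a \<times> 'a) \<Rightarrow> nat \<Rightarrow> bool" where
  "has_genus G nx g \<longleftrightarrow>
     int (card (pverts G)) - int (card (undirected (parcs G))) + int (card (faces G nx)) = 2 - 2 * int g"

text \<open>
  The vertices of a face are the tails of its arcs, one occurrence for each arc. Hence a facial walk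
  is a simple cycle iff the tails are distinct; the length bound rules out going back and forth
  along an edge.
\<close>

definition simple_face :: "('a \<times> 'a) set \<Rightarrow> bool" where
  "simple_face F \<longleftrightarrow> inj_on fst F \<and> 3 \<le> card F"

definition face_intersection_ok :: "('a \<times> 'a) set \<Rightarrow> ('a \<times> 'a) set \<Rightarrow> bool" where
  "face_intersection_ok F F' \<longleftrightarrow>
     (let V = fst ` F \<inter> fst ` F'; E = undirected F \<inter> undirected F' in
       (V = {} \<and> E = {}) \<or>
       (\<exists>v. V = {v} \<and> E = {}) \<or>
       (\<exists>u v. u \<noteq> v \<and> V = {u, v} \<and> E = {{u, v}}))"

definition polyhedral :: "'a pair_pre_digraph \<Rightarrow> ('a \<times> 'a \<Rightarrow> 'a \<times> 'a) \<Rightarrow> bool" where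
  "polyhedral G nx \<longleftrightarrow> embedding G nx \<and>
     (\<forall>F \<in> faces G nx. simple_face F) \<and>
     (\<forall>F \<in> faces G nx. \<forall>F' \<in> faces G nx. F \<noteq> F' \<longrightarrow> face_intersection_ok F F')"

definition polyhedral_embeddings ::
    "'a pair_pre_digraph \<Rightarrow> nat \<Rightarrow> ('a \<times> 'a \<Rightarrow> 'a \<times> 'a) set" where
  "polyhedral_embeddings G g = {nx. polyhedral G nx \<and> has_genus G nx g}"

definition polyhedral_genera :: "'a pair_pre_digraph \<Rightarrow> nat set" where
  "polyhedral_genera G = {g. polyhedral_embeddings G g \<noteq> {}}"

definition num_polyhedral :: "'a pair_pre_digraph \<Rightarrow> nat \<Rightarrow> nat" where
  "num_polyhedral G g = card ((\<lambda>nx. {nx, mirror nx}) ` polyhedral_embeddings G g)"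

definition mingen :: "'a pair_pre_digraph \<Rightarrow> nat" where
  "mingen G = (LEAST g. \<exists>nx. embedding G nx \<and> has_genus G nx g)"

definition min_polyhedral_genus :: "'a pair_pre_digraph \<Rightarrow> nat" where
  "min_polyhedral_genus G = (LEAST g. g \<in> polyhedral_genera G)"

definition graph_isomorphism ::
    "('a \<Rightarrow> 'b) \<Rightarrow> 'a pair_pre_digraph \<Rightarrow> 'b pair_pre_digraph \<Rightarrow> bool" where
  "graph_isomorphism f G H \<longleftrightarrow>
     bij_betw f (pverts G) (pverts H) \<and> map_prod f f ` parcs G = parcs H"

definition embedding_isomorphic ::
    "'a pair_pre_digraph \<Rightarrow> ('a \<times> 'a \<Rightarrow> 'a \<times> 'a) \<Rightarrow>
     'b pair_pre_digraph \<Rightarrow> ('b \<times> 'b \<Rightarrow> 'b \<times> 'b) \<Rightarrow> bool" where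
  "embedding_isomorphic G nx H nx' \<longleftrightarrow> (\<exists>f. graph_isomorphism f G H \<and>
     ((\<forall>e \<in> parcs G. map_prod f f (nx e) = nx' (map_prod f f e)) \<or>
      (\<forall>e \<in> parcs G. map_prod f f (nx e) = mirror nx' (map_prod f f e))))"

definition pairwise_non_isomorphic ::
    "'a pair_pre_digraph \<Rightarrow> ('a \<times> 'a \<Rightarrow> 'a \<times> 'a) set \<Rightarrow> bool" where
  "pairwise_non_isomorphic G S \<longleftrightarrow> pairwise (\<lambda>nx nx'. \<not> embedding_isomorphic G nx G nx') S"

end

theory Submission
  imports Defs
begin

text \<open>
  Blow up a combinatorial map \<open>M\<close> into a cubic graph by replacing each vertex by a ring of pentagons,
  one for each dart. In a polyhedral embedding of a cubic graph every induced pentagon is a face: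
  around an odd cycle two consecutive turns agree, so some face follows three consecutive edges of the
  pentagon, and it would meet another face at two non-adjacent vertices if it left the pentagon.
  Hence all pentagons are faces, every ring can only be reflected as a whole,
  and the polyhedral embeddings of the graph are given by the flips of the rotation of \<open>M\<close> at some of
  its vertices for which the dual of the flipped map is simple. The genus is that of the flipped map.

  Copies of small maps are spliced at marked corners. Splicing at one vertex adds up genera and keeps
  the other flips of the copies independent. Splicing at both vertices of two-vertex maps forces the
  same flip on all copies, so that the differences of genera between flips are multiplied: this gives the gap
  in (a), and in (d), where the flip of smaller genus is made non-polyhedral by one different copy. Copies
  with two genera that are spliced at one vertex give (b). For (c), copies of a map with eight flips
  of genus 1 are spliced with a marker that leaves the graph without non-trivial automorphisms.
\<close>

section \<open>Rotation systems on cubic graphs\<close>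

text \<open>For (a) and (d) every polyhedral embedding of a graph has to be known, not only the ones
  that are written down. This dictates pentagons: odd length excludes alternating turns, and three
  consecutive edges of a pentagon miss just one vertex, whose two pentagon edges lie on a common
  face. Neighbouring pentagons of a ring share an edge, which passes the orientation on, so a ring
  keeps a single bit. A two-vertex map with both vertices spliced leaves four candidates, however
  many copies are used, and finite tables settle these.

  Splicing merges faces as well as vertices, and a merged face might border itself or border another
  face twice. With one mark the simple dual of each copy prevents this. With two marks every marked
  corner is put inside a loop, where its face is a single dart.

  For (c), loops of the map become the only triangles of the graph and serve as landmarks that
  exclude automorphisms; mirror images are excluded since the marked vertex is never
  flipped.\<close>

lemma bij_orbit_self:
  assumes "finite A" "bij_betw f A A" "a \<in> A"
  shows "a \<in> orbit f a"
proof -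
  \<comment> \<open>\<open>f\<close> is arbitrary off \<open>A\<close>. With the identity there it
    becomes a permutation, under which every point returns to itself, and an orbit that starts in
    \<open>A\<close> never sees the change.\<close>
  define g where "g x = (if x \<in> A then f x else x)" for x
  have "bij_betw g A A"
    using assms(2) by (rule bij_betw_cong[THEN iffD1, rotated]) (auto simp: g_def)
  then have "g permutes A" by (rule bij_imp_permutes) (auto simp: g_def)
  then have *: "a \<in> orbit g a" using assms(1)
    by (intro permutation_self_in_orbit) (auto simp: permutation_permutes)
  have sub: "orbit g a \<subseteq> A" using \<open>g permutes A\<close> assms(3) by (rule permutes_orbit_subset)
  have "x \<in> orbit f a" if "x \<in> orbit g a" for x
    using that
  proof induction
    case base then show ?case using assms(3) by (auto simp: g_def intro: orbit.intros)
  next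
    case (step y) then show ?case using sub by (auto simp: g_def intro: orbit.intros)
  qed
  then show ?thesis using * by blast
qed

lemma bij_orbit_subset:
  assumes "bij_betw f A A" "a \<in> A"
  shows "orbit f a \<subseteq> A"
proof
  fix y assume "y \<in> orbit f a"
  then show "y \<in> A" by induct (use assms in \<open>auto simp: bij_betw_def\<close>)
qed

lemma bij_orbit_eq:
  assumes "finite A" "bij_betw f A A" "a \<in> A" "b \<in> orbit f a"
  shows "orbit f b = orbit f a"
proof -
  have "a \<in> orbit f a" using assms(1-3) by (rule bij_orbit_self)
  then have "a \<in> orbit f b" using assms(4) by (rule orbit_swap)
  then show ?thesis using assms(4) by (auto intro: orbit_trans[of _ f])
qed

lemma bij_orbit_step:
  assumes "finite A" "bij_betw f A A" "a \<in> A"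
  shows "orbit f (f a) = orbit f a"
  using bij_orbit_eq[OF assms orbit.base] .

lemma cyclic_on_triple:
  assumes "f a = b" "f b = c" "f c = a"
  shows "cyclic_on f {a, b, c}"
proof -
  have "orbit f a = {a, b, c}"
  proof
    show "orbit f a \<subseteq> {a, b, c}"
    proof
      fix x assume "x \<in> orbit f a" then show "x \<in> {a, b, c}" by induct (use assms in auto)
    qed
    have "b \<in> orbit f a" using assms orbit.base by metis
    moreover have "c \<in> orbit f a" using assms orbit.step calculation by metis
    moreover have "a \<in> orbit f a" using assms orbit.step calculation by metis
    ultimately show "{a, b, c} \<subseteq> orbit f a" by auto
  qed
  then show ?thesis by (auto simp: cyclic_on_def)
qed

lemma undirected_eq: "undirected A = (\<lambda>e. {fst e, snd e}) ` A"
  by (auto simp: undirected_def case_prod_unfold)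

lemma intersection_edge:
  assumes "face_intersection_ok F F'" "a \<in> fst ` F \<inter> fst ` F'" "d \<in> fst ` F \<inter> fst ` F'" "a \<noteq> d"
  shows "{a, d} \<in> undirected F"
proof -
  define V where "V = fst ` F \<inter> fst ` F'"
  have "V = {} \<or> (\<exists>v. V = {v}) \<or> (\<exists>u v. V = {u, v} \<and> {u, v} \<in> undirected F)"
    using assms(1) unfolding face_intersection_ok_def Let_def V_def[symmetric] by blast
  moreover have "a \<in> V" "d \<in> V" using assms(2,3) by (simp_all add: V_def)
  ultimately obtain u v where "{u, v} \<in> undirected F" "{a, d} \<subseteq> {u, v}" using assms(4) by auto
  moreover from this(2) have "{a, d} = {u, v}" using assms(4) by auto
  ultimately show ?thesis by simp
qed

lemma card_undirected:
  assumes "finite A" "\<And>e. e \<in> A \<Longrightarrow> prod.swap e \<in> A" "\<And>e. e \<in> A \<Longrightarrow> fst e \<noteq> snd e"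
  shows "card A = 2 * card (undirected A)"
proof -
  note U = undirected_eq[of A]
  have fib: "card {e \<in> A. {fst e, snd e} = w} = 2" if w: "w \<in> undirected A" for w
  proof -
    obtain e where e: "e \<in> A" "w = {fst e, snd e}" using w U by auto
    have "{e' \<in> A. {fst e', snd e'} = w} = {e, prod.swap e}"
      using e assms(2)[OF e(1)] by (cases e) (auto simp: doubleton_eq_iff)
    moreover have "e \<noteq> prod.swap e" using assms(3)[OF e(1)] by (auto simp: prod_eq_iff)
    ultimately show ?thesis by simp
  qed
  have "card A = (\<Sum>w\<in>undirected A. card {e \<in> A. {fst e, snd e} = w})"
    using sum.image_gen[OF assms(1), of "\<lambda>_. 1 :: nat" "\<lambda>e. {fst e, snd e}"] U by simp
  then show ?thesis using fib by simp
qed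

section \<open>Rotations and faces of a cubic graph\<close>

context
  fixes G :: "'a pair_pre_digraph" and nx
  assumes cubic: "cubic_graph G" and emb: "embedding G nx"
begin

lemma cubic_arcs:
  shows "finite (parcs G)" "e \<in> parcs G \<Longrightarrow> prod.swap e \<in> parcs G"
    "e \<in> parcs G \<Longrightarrow> fst e \<noteq> snd e" "e \<in> parcs G \<Longrightarrow> fst e \<in> pverts G"
    "e \<in> parcs G \<Longrightarrow> snd e \<in> pverts G"
proof -
  interpret pair_graph G using cubic by (simp add: cubic_graph_def)
  show "finite (parcs G)" by (rule pair_finite_arcs)
  show "e \<in> parcs G \<Longrightarrow> prod.swap e \<in> parcs G" using arcs_symmetric by (cases e) auto
  show "e \<in> parcs G \<Longrightarrow> fst e \<noteq> snd e" by (rule pair_no_loops)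
  show "e \<in> parcs G \<Longrightarrow> fst e \<in> pverts G" by (rule arc_fst_in_verts)
  show "e \<in> parcs G \<Longrightarrow> snd e \<in> pverts G" by (rule arc_snd_in_verts)
qed

lemma rotation_cubic:
  assumes e: "e \<in> parcs G"
  shows "nx e \<in> parcs G" "fst (nx e) = fst e" "nx e \<noteq> e" "nx (nx e) \<noteq> e" "nx (nx (nx e)) = e"
    "{e' \<in> parcs G. fst e' = fst e} = {e, nx e, nx (nx e)}"
proof -
  let ?C = "out_arcs (with_proj G) (fst e)"
  have C: "?C = {e' \<in> parcs G. fst e' = fst e}" by (auto simp: out_arcs_def)
  have perm: "nx permutes parcs G" using emb by (simp add: embedding_def)
  have v: "fst e \<in> pverts G" using cubic_arcs e by blast
  have "e \<in> ?C" using e C by auto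
  then have cyc: "cyclic_on nx ?C" using emb v unfolding embedding_def by blast
  have "card ?C = 3" using cubic v by (auto simp: cubic_graph_def out_degree_def)
  have orb: "orbit nx x = ?C" if "x \<in> ?C" for x using orbit_cyclic_eq3[OF cyc that] .
  have st: "nx x \<in> ?C" if "x \<in> ?C" for x using orb[OF that] orbit.base by metis
  have ne1: "nx x \<noteq> x" if "x \<in> ?C" for x
    using orb[OF that] \<open>card ?C = 3\<close> by (auto simp: orbit_eq_singleton_iff[symmetric])
  have ne2: "nx (nx x) \<noteq> x" if "x \<in> ?C" for x
  proof
    assume a: "nx (nx x) = x"
    have "orbit nx x \<subseteq> {x, nx x}"
    proof
      fix y assume "y \<in> orbit nx x" then show "y \<in> {x, nx x}" by induct (use a in auto)
    qed
    then have "card ?C \<le> card {x, nx x}" using orb[OF that] by (intro card_mono) auto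
    also have "\<dots> \<le> 2" by (simp add: card_insert_le_m1)
    finally show False using \<open>card ?C = 3\<close> by simp
  qed
  note e' = \<open>e \<in> ?C\<close> st[OF \<open>e \<in> ?C\<close>] st[OF st[OF \<open>e \<in> ?C\<close>]]
  have eq: "{e, nx e, nx (nx e)} = ?C"
  proof (rule card_subset_eq)
    show "finite ?C" using \<open>card ?C = 3\<close> card_ge_0_finite by force
    show "card {e, nx e, nx (nx e)} = card ?C"
      using ne1[OF e'(1)] ne1[OF e'(2)] ne2[OF e'(1)] \<open>card ?C = 3\<close> by auto
  qed (use e' in auto)
  have "nx (nx (nx e)) \<in> {e, nx e, nx (nx e)}" unfolding eq by (rule st[OF e'(3)])
  then show "nx (nx (nx e)) = e" using ne1[OF e'(3)] ne2[OF e'(2)] by blast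
  show "nx e \<in> parcs G" "fst (nx e) = fst e" using e'(2) unfolding C by blast+
  show "nx e \<noteq> e" "nx (nx e) \<noteq> e" by (rule ne1[OF e'(1)]) (rule ne2[OF e'(1)])
  show "{e' \<in> parcs G. fst e' = fst e} = {e, nx e, nx (nx e)}"
    unfolding eq C ..
qed

lemma face_succ_bij: "bij_betw (face_succ nx) (parcs G) (parcs G)"
proof -
  have "bij_betw prod.swap (parcs G) (parcs G)"
    by (rule bij_betwI[where g = prod.swap]) (use cubic_arcs(2) in \<open>blast, blast, simp, simp\<close>)
  moreover have "bij_betw nx (parcs G) (parcs G)"
    using emb by (auto simp: embedding_def intro: permutes_imp_bij)
  ultimately have "bij_betw (nx \<circ> prod.swap) (parcs G) (parcs G)" by (rule bij_betw_trans)
  moreover have "face_succ nx = nx \<circ> prod.swap" by (rule ext) (simp add: face_succ_def)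
  ultimately show ?thesis by simp
qed

lemmas face_self = bij_orbit_self[OF cubic_arcs(1) face_succ_bij]
  and face_sub = bij_orbit_subset[OF face_succ_bij]
  and face_eq = bij_orbit_eq[OF cubic_arcs(1) face_succ_bij]
  and face_step = bij_orbit_step[OF cubic_arcs(1) face_succ_bij]

text \<open>The walk along \<open>prod.swap e\<close> continues with \<open>nx e\<close>. So the
  face across an edge is the face of the next arc at the same tail, and questions about the sides of
  edges become questions about consecutive arcs at a vertex.\<close>

lemma face_swap:
  assumes "e \<in> parcs G"
  shows "orbit (face_succ nx) (prod.swap e) = orbit (face_succ nx) (nx e)"
  using face_step[of "prod.swap e"] cubic_arcs(2)[OF assms] by (simp add: face_succ_def)

lemma facesD:
  assumes "F \<in> faces G nx"
  shows "F \<subseteq> parcs G" "e \<in> F \<Longrightarrow> orbit (face_succ nx) e = F" "e \<in> F \<Longrightarrow> nx (prod.swap e) \<in> F"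
proof -
  obtain a where a: "a \<in> parcs G" "F = orbit (face_succ nx) a" using assms by (auto simp: faces_def)
  show "F \<subseteq> parcs G" using face_sub a by auto
  show "e \<in> F \<Longrightarrow> orbit (face_succ nx) e = F" using face_eq a by auto
  show "e \<in> F \<Longrightarrow> nx (prod.swap e) \<in> F" using a orbit.step[of e "face_succ nx" a]
    by (auto simp: face_succ_def)
qed

text \<open>At a cubic vertex any two faces share an edge, so faces that meet in at most one edge
  (a simple dual) already meet properly.\<close>

lemma polyhedral_if_dual_simple:
  assumes sides: "\<And>e. e \<in> parcs G \<Longrightarrow> orbit (face_succ nx) e \<noteq> orbit (face_succ nx) (prod.swap e)"
    and simple: "\<And>e e'. \<lbrakk>e \<in> parcs G; e' \<in> parcs G; orbit (face_succ nx) e = orbit (face_succ nx) e';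
        orbit (face_succ nx) (prod.swap e) = orbit (face_succ nx) (prod.swap e')\<rbrakk> \<Longrightarrow> e = e'"
    and three: "\<And>e. e \<in> parcs G \<Longrightarrow> 3 \<le> card (orbit (face_succ nx) e)"
  shows "polyhedral G nx"
proof -
  let ?o = "orbit (face_succ nx)"
  have next_ne: "?o (nx e) \<noteq> ?o e" if "e \<in> parcs G" for e
    using sides[OF that] face_swap[OF that] by simp
  have tails: "e' = nx e \<or> e = nx e'"
    if "e \<in> parcs G" "e' \<in> parcs G" "fst e = fst e'" "e \<noteq> e'" for e e'
  proof -
    have "e' \<in> {e, nx e, nx (nx e)}" using rotation_cubic(6)[OF that(1)] that(2,3) by auto
    then show ?thesis using rotation_cubic(5)[OF that(1)] that(4) by auto
  qed
  have inj: "inj_on fst F" if F: "F \<in> faces G nx" for F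
  proof (rule inj_onI, rule ccontr)
    fix e e' assume *: "e \<in> F" "e' \<in> F" "fst e = fst e'" "e \<noteq> e'"
    then have "e \<in> parcs G" "e' \<in> parcs G" "?o e = ?o e'" using facesD[OF F] by auto
    then show False using tails[of e e'] next_ne * by metis
  qed
  have card3: "3 \<le> card F" if F: "F \<in> faces G nx" for F
    using F three by (auto simp: faces_def)
  have ok: "face_intersection_ok F F'"
    if F: "F \<in> faces G nx" and F': "F' \<in> faces G nx" and "F \<noteq> F'" for F F'
  proof -
    note D = facesD[OF F] and D' = facesD[OF F']
    \<comment> \<open>Two arcs with tail \<open>x\<close> are consecutive in one of the two orders,
      and their faces share the edge of the earlier one.\<close>
    have shared: "\<exists>e\<in>F. prod.swap e \<in> F' \<and> x \<in> {fst e, snd e}" if x: "x \<in> fst ` F" "x \<in> fst ` F'" for x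
    proof -
      obtain e e' where e: "e \<in> F" "e' \<in> F'" "x = fst e" "x = fst e'" using x by auto
      have A: "e \<in> parcs G" "e' \<in> parcs G" using e D D' by auto
      have "e \<noteq> e'" using e D(2) D'(2) \<open>F \<noteq> F'\<close> by metis
      then consider "e' = nx e" | "e = nx e'" using tails[of e e'] A e by auto
      then show ?thesis
      proof cases
        case 1
        then have "?o (prod.swap e) = F'" using face_swap[OF A(1)] D'(2)[OF e(2)] by simp
        then have "prod.swap e \<in> F'" using face_self[of "prod.swap e"] cubic_arcs(2)[OF A(1)] by auto
        then show ?thesis using e by auto
      next
        case 2
        then have "?o (prod.swap e') = F" using face_swap[OF A(2)] D(2)[OF e(1)] by simp
        then have "prod.swap e' \<in> F" using face_self[of "prod.swap e'"] cubic_arcs(2)[OF A(2)] by auto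
        then show ?thesis using e by (intro bexI[of _ "prod.swap e'"]) auto
      qed
    qed
    have unique: "e = e'" if "e \<in> F" "prod.swap e \<in> F'" "e' \<in> F" "prod.swap e' \<in> F'" for e e'
      using simple[of e e'] that D D' by auto
    show ?thesis
    proof (cases "\<exists>e\<in>F. prod.swap e \<in> F'")
      case False
      then have "fst ` F \<inter> fst ` F' = {}" using shared by blast
      moreover have "undirected F \<inter> undirected F' = {}"
      proof -
        have "w \<notin> undirected F'" if wF: "w \<in> undirected F" for w
        proof
          assume "w \<in> undirected F'"
          then obtain b where b: "b \<in> F'" "w = {fst b, snd b}" unfolding undirected_eq by blast
          obtain a where a: "a \<in> F" "w = {fst a, snd a}" using wF unfolding undirected_eq by blast
          note ab = a(1) b(1) a(2) b(2)
          then have "fst a = fst b \<or> b = prod.swap a" by (auto simp: doubleton_eq_iff prod_eq_iff)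
          then show False using ab(1,2) calculation False by blast
        qed
        then show ?thesis by blast
      qed
      ultimately show ?thesis by (simp add: face_intersection_ok_def Let_def)
    next
      case True
      then obtain e where e: "e \<in> F" "prod.swap e \<in> F'" by blast
      have eA: "e \<in> parcs G" using e D by auto
      have ne: "fst e \<noteq> snd e" using cubic_arcs(3)[OF eA] .
      have sub: "fst ` F \<inter> fst ` F' \<subseteq> {fst e, snd e}" using shared unique e by blast
      have "fst (nx (prod.swap e)) = snd e"
        using rotation_cubic(2)[of "prod.swap e"] cubic_arcs(2)[OF eA] by simp
      then have "snd e \<in> fst ` F" using imageI[OF D(3)[OF e(1)], of fst] by simp
      moreover have "fst (nx e) = fst e" using rotation_cubic(2)[OF eA] .
      then have "fst e \<in> fst ` F'" using imageI[OF D'(3)[OF e(2)], of fst] by simp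
      moreover have "fst e \<in> fst ` F" using e by auto
      moreover have "snd e \<in> fst ` F'" using e(2) by force
      ultimately have V: "fst ` F \<inter> fst ` F' = {fst e, snd e}" using sub by auto
      have E: "undirected F \<inter> undirected F' = {{fst e, snd e}}"
      proof
        show "{{fst e, snd e}} \<subseteq> undirected F \<inter> undirected F'"
          using imageI[OF e(1), of "\<lambda>e. {fst e, snd e}"] imageI[OF e(2), of "\<lambda>e. {fst e, snd e}"]
          by (simp add: undirected_eq insert_commute)
        show "undirected F \<inter> undirected F' \<subseteq> {{fst e, snd e}}"
        proof
          fix w assume w: "w \<in> undirected F \<inter> undirected F'"
          obtain a where a: "a \<in> F" "w = {fst a, snd a}" using w unfolding undirected_eq by blast
          obtain b where b: "b \<in> F'" "w = {fst b, snd b}" using w unfolding undirected_eq by blast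
          note ab = a(1) b(1) a(2) b(2)
          have "a \<noteq> b" using D(2)[OF ab(1)] D'(2)[OF ab(2)] \<open>F \<noteq> F'\<close> by auto
          moreover have "{fst a, snd a} = {fst b, snd b}" using ab(3,4) by simp
          ultimately have "b = prod.swap a" by (cases a; cases b) (auto simp: doubleton_eq_iff)
          then have "prod.swap a \<in> F'" using ab(2) by simp
          then have "a = e" by (rule unique[OF ab(1) _ e])
          then show "w \<in> {{fst e, snd e}}" using ab(3) by simp
        qed
      qed
      show ?thesis unfolding face_intersection_ok_def Let_def V E using ne by (intro disjI2 exI[of _ "fst e"] exI[of _ "snd e"]) simp
    qed
  qed
  show ?thesis unfolding polyhedral_def simple_face_def 
    by (intro conjI ballI impI emb inj card3 ok)
qed

section \<open>Turns along a pentagon\<close>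

text \<open>A facial walk that enters \<open>b\<close> from \<open>a\<close> leaves it towards
  \<open>c\<close>. Thus \<open>turn a b c\<close> and \<open>turn c b a\<close> are the two ways in
  which the path \<open>a\<close>, \<open>b\<close>, \<open>c\<close> can be facial.\<close>

definition turn :: "'a \<Rightarrow> 'a \<Rightarrow> 'a \<Rightarrow> bool" where
  "turn a b c \<longleftrightarrow> nx (b, a) = (b, c)"

lemma turn_cases:
  assumes "(b, a) \<in> parcs G" "(b, c) \<in> parcs G" "a \<noteq> c"
  shows "turn a b c \<or> turn c b a"
proof -
  have "(b, c) \<in> {(b, a), nx (b, a), nx (nx (b, a))}"
    unfolding rotation_cubic(6)[OF assms(1), symmetric] using assms(2) by simp
  then consider "(b, c) = nx (b, a)" | "(b, c) = nx (nx (b, a))" using assms(3) by blast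
  then show ?thesis
  proof cases
    case 1 then show ?thesis by (simp add: turn_def)
  next
    case 2
    then have "nx (b, c) = (b, a)" using rotation_cubic(5)[OF assms(1)] by (simp only:)
    then show ?thesis by (simp add: turn_def)
  qed
qed

text \<open>The two turns give a face \<open>F\<close> through \<open>a\<close>, \<open>b\<close>,
  \<open>c\<close>, \<open>d\<close>. The path over \<open>e\<close> is facial in one direction, and
  its face contains the non-adjacent vertices \<open>a\<close> and \<open>d\<close>, hence is
  \<open>F\<close>. As \<open>F\<close> visits each vertex once, the walk either closes up to the
  pentagon or, in the other direction, gives \<open>b = e\<close> and with it the forbidden edge
  between \<open>b\<close> and \<open>d\<close>.\<close>

lemma pentagon_step:
  assumes poly: "polyhedral G nx"
    and arcs: "(a, b) \<in> parcs G" "(b, c) \<in> parcs G" "(c, d) \<in> parcs G" "(d, e) \<in> parcs G" "(e, a) \<in> parcs G"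
    and non: "(b, d) \<notin> parcs G" "(d, a) \<notin> parcs G" "a \<noteq> d"
    and turns: "turn a b c" "turn b c d"
  shows "turn c d e \<and> turn d e a \<and> turn e a b"
proof -
  let ?o = "orbit (face_succ nx)"
  note sw = cubic_arcs(2)
  define F where "F = ?o (a, b)"
  have F: "F \<in> faces G nx" using arcs(1) by (auto simp: F_def faces_def)
  have 1: "(a, b) \<in> F" using face_self[OF arcs(1)] by (simp add: F_def)
  have 2: "(b, c) \<in> F" using facesD(3)[OF F 1] turns by (simp add: turn_def)
  have 3: "(c, d) \<in> F" using facesD(3)[OF F 2] turns by (simp add: turn_def)
  have 4: "nx (d, c) \<in> F" using facesD(3)[OF F 3] by simp
  have fst4: "fst (nx (d, c)) = d" using rotation_cubic(2)[of "(d, c)"] sw[OF arcs(3)] by simp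
  have inj: "inj_on fst F" using poly F by (auto simp: polyhedral_def simple_face_def)
  have same: "F' = F" if F': "F' \<in> faces G nx" and "a \<in> fst ` F'" "d \<in> fst ` F'" for F'
  proof (rule ccontr)
    assume "F' \<noteq> F"
    then have "face_intersection_ok F F'" using poly F F' by (auto simp: polyhedral_def)
    moreover have "a \<in> fst ` F \<inter> fst ` F'" using imageI[OF 1, of fst] that by simp
    moreover have "d \<in> fst ` F \<inter> fst ` F'" using imageI[OF 4, of fst] fst4 that by simp
    ultimately have "{a, d} \<in> undirected F" using non(3) by (rule intersection_edge)
    then obtain x where "x \<in> F" "{a, d} = {fst x, snd x}" unfolding undirected_eq by blast
    then have "(a, d) \<in> F \<or> (d, a) \<in> F" by (cases x) (auto simp: doubleton_eq_iff)
    then show False using facesD(1)[OF F] sw[of "(a, d)"] non(2) by auto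
  qed
  have inj': "x = y" if "x \<in> F" "y \<in> F" "fst x = fst y" for x y
    using inj_onD[OF inj that(3,1,2)] .
  have "turn d e a \<or> turn a e d"
    using turn_cases[of e d a] sw[OF arcs(4)] arcs(5) non(3) by auto
  then show ?thesis
  proof
    assume t: "turn d e a"
    define F' where "F' = ?o (d, e)"
    have F': "F' \<in> faces G nx" using arcs(4) by (auto simp: F'_def faces_def)
    have g1: "(d, e) \<in> F'" using face_self[OF arcs(4)] by (simp add: F'_def)
    have g2: "(e, a) \<in> F'" using facesD(3)[OF F' g1] t by (simp add: turn_def)
    have g3: "nx (a, e) \<in> F'" using facesD(3)[OF F' g2] by simp
    have fstg: "fst (nx (a, e)) = a" using rotation_cubic(2)[of "(a, e)"] sw[OF arcs(5)] by simp
    have "F' = F" using imageI[OF g1, of fst] imageI[OF g3, of fst] fstg by (intro same F') auto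
    then show ?thesis using inj'[OF 4, of "(d, e)"] inj'[OF 1, of "nx (a, e)"] g1 g3 fst4 fstg t
      by (simp add: turn_def)
  next
    assume t: "turn a e d"
    define F' where "F' = ?o (a, e)"
    have ae: "(a, e) \<in> parcs G" using sw[OF arcs(5)] by simp
    have F': "F' \<in> faces G nx" using ae by (auto simp: F'_def faces_def)
    have g1: "(a, e) \<in> F'" using face_self[OF ae] by (simp add: F'_def)
    have g2: "(e, d) \<in> F'" using facesD(3)[OF F' g1] t by (simp add: turn_def)
    have g3: "nx (d, e) \<in> F'" using facesD(3)[OF F' g2] by simp
    have fstg: "fst (nx (d, e)) = d" using rotation_cubic(2)[OF arcs(4)] by simp
    have "F' = F" using imageI[OF g1, of fst] imageI[OF g3, of fst] fstg by (intro same F') auto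
    then have "b = e" using inj'[OF 1, of "(a, e)"] g1 by simp
    then show ?thesis using sw[OF arcs(4)] non(1) by simp
  qed
qed

text \<open>Around an odd cycle two consecutive turns agree, so one face follows three consecutive edges
  of a pentagon; the face at the remaining vertex meets it in two non-adjacent vertices.\<close>

lemma pentagon_facial:
  assumes poly: "polyhedral G nx"
    and arcs: "(a, b) \<in> parcs G" "(b, c) \<in> parcs G" "(c, d) \<in> parcs G" "(d, e) \<in> parcs G" "(e, a) \<in> parcs G"
    and non: "(a, c) \<notin> parcs G" "(b, d) \<notin> parcs G" "(c, e) \<notin> parcs G" "(d, a) \<notin> parcs G" "(e, b) \<notin> parcs G"
  shows "(turn a b c \<and> turn b c d \<and> turn c d e \<and> turn d e a \<and> turn e a b) \<or>
         (turn c b a \<and> turn d c b \<and> turn e d c \<and> turn a e d \<and> turn b a e)"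
proof -
  note sw = cubic_arcs(2)
  have arcs': "(b, a) \<in> parcs G" "(c, b) \<in> parcs G" "(d, c) \<in> parcs G" "(e, d) \<in> parcs G" "(a, e) \<in> parcs G"
    using arcs[THEN sw] by simp_all
  have non': "(c, a) \<notin> parcs G" "(d, b) \<notin> parcs G" "(e, c) \<notin> parcs G" "(a, d) \<notin> parcs G" "(b, e) \<notin> parcs G"
    using non sw by fastforce+
  have ne: "a \<noteq> c" "b \<noteq> d" "c \<noteq> e" "d \<noteq> a" "e \<noteq> b" using arcs arcs' non non' by blast+
  note st = pentagon_step[OF poly]
  have "turn a b c \<or> turn c b a" "turn b c d \<or> turn d c b" "turn c d e \<or> turn e d c"
    "turn d e a \<or> turn a e d" "turn e a b \<or> turn b a e"
    using turn_cases arcs arcs' ne by blast+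
  moreover have "turn a b c \<and> turn b c d \<longrightarrow> turn c d e \<and> turn d e a \<and> turn e a b"
    using st[of a b c d e] arcs non ne by blast
  moreover have "turn b c d \<and> turn c d e \<longrightarrow> turn d e a \<and> turn e a b \<and> turn a b c"
    using st[of b c d e a] arcs non ne by blast
  moreover have "turn c d e \<and> turn d e a \<longrightarrow> turn e a b \<and> turn a b c \<and> turn b c d"
    using st[of c d e a b] arcs non ne by blast
  moreover have "turn d e a \<and> turn e a b \<longrightarrow> turn a b c \<and> turn b c d \<and> turn c d e"
    using st[of d e a b c] arcs non ne by blast
  moreover have "turn e a b \<and> turn a b c \<longrightarrow> turn b c d \<and> turn c d e \<and> turn d e a"
    using st[of e a b c d] arcs non ne by blast
  moreover have "turn d c b \<and> turn c b a \<longrightarrow> turn b a e \<and> turn a e d \<and> turn e d c"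
    using st[of d c b a e] arcs' non' ne by blast
  moreover have "turn c b a \<and> turn b a e \<longrightarrow> turn a e d \<and> turn e d c \<and> turn d c b"
    using st[of c b a e d] arcs' non' ne by blast
  moreover have "turn b a e \<and> turn a e d \<longrightarrow> turn e d c \<and> turn d c b \<and> turn c b a"
    using st[of b a e d c] arcs' non' ne by blast
  moreover have "turn a e d \<and> turn e d c \<longrightarrow> turn d c b \<and> turn c b a \<and> turn b a e"
    using st[of a e d c b] arcs' non' ne by blast
  moreover have "turn e d c \<and> turn d c b \<longrightarrow> turn c b a \<and> turn b a e \<and> turn a e d"
    using st[of e d c b a] arcs' non' ne by blast
  ultimately show ?thesis by argo
qed

end

section \<open>The blow-up of a combinatorial map\<close>

text \<open>The criterion has the shape of the axiom \<open>conn\<close> of \<open>comb_map\<close>,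
  so connectivity is carried over by closed sets and no walk has to be constructed.\<close>

lemma connected_if_closed:
  assumes G: "pair_graph G" and ne: "pverts G \<noteq> {}"
    and closed: "\<And>S. \<lbrakk>S \<subseteq> pverts G; S \<noteq> {}; \<And>u v. (u, v) \<in> parcs G \<Longrightarrow> u \<in> S \<Longrightarrow> v \<in> S\<rbrakk> \<Longrightarrow> S = pverts G"
  shows "Digraph_Component.connected (with_proj G)"
proof -
  interpret G: pair_graph G by (rule G)
  interpret H: pair_wf_digraph "mk_symmetric (with_proj G)" by (rule G.wellformed_mk_symmetric)
  let ?H = "with_proj (mk_symmetric (with_proj G))"
  have "u \<rightarrow>\<^sup>*\<^bsub>?H\<^esub> v" if "u \<in> pverts G" "v \<in> pverts G" for u v
  proof -
    define S where "S = {v \<in> pverts G. u \<rightarrow>\<^sup>*\<^bsub>?H\<^esub> v}"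
    have "S = pverts G"
    proof (rule closed)
      show "S \<subseteq> pverts G" by (auto simp: S_def)
      show "S \<noteq> {}" using that(1) H.reachable_refl[of u] by (auto simp: S_def)
      show "y \<in> S" if "(x, y) \<in> parcs G" "x \<in> S" for x y
      proof -
        have "(x, y) \<in> parcs (mk_symmetric (with_proj G))"
          using that(1) by (force simp: parcs_mk_symmetric)
        then have "u \<rightarrow>\<^sup>*\<^bsub>?H\<^esub> y" using that(2) H.reachable_adj_trans[of u x y] by (simp add: S_def)
        then show ?thesis using G.in_arcsD2[OF that(1)] by (simp add: S_def)
      qed
    qed
    then show ?thesis using that(2) by (auto simp: S_def)
  qed
  then show ?thesis using ne by (auto simp: Digraph_Component.connected_def strongly_connected_def)
qed

section \<open>Combinatorial maps\<close>

text \<open>\<open>sg\<close> is the rotation and \<open>al\<close> reverses a dart; loops and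
  multiple edges are allowed. The conditions \<open>sg_neq\<close> and \<open>sg_sg_neq\<close> say
  that all degrees are at least three, so that the ring of a vertex consists of at least three
  pentagons.\<close>

locale comb_map =
  fixes D :: "'d set" and sg al :: "'d \<Rightarrow> 'd"
  assumes fin: "finite D" and nonempty: "D \<noteq> {}"
    and sg: "sg permutes D"
    and al_in: "d \<in> D \<Longrightarrow> al d \<in> D" and al_al: "d \<in> D \<Longrightarrow> al (al d) = d" and al_neq: "d \<in> D \<Longrightarrow> al d \<noteq> d"
    and sg_neq: "d \<in> D \<Longrightarrow> sg d \<noteq> d" and sg_sg_neq: "d \<in> D \<Longrightarrow> sg (sg d) \<noteq> d"
    and conn: "\<And>S. \<lbrakk>S \<subseteq> D; S \<noteq> {}; \<And>d. d \<in> S \<Longrightarrow> sg d \<in> S; \<And>d. d \<in> S \<Longrightarrow> al d \<in> S\<rbrakk> \<Longrightarrow> S = D"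
begin

abbreviation "isg \<equiv> inv sg"

lemma sg_simps [simp]: "sg d \<in> D \<longleftrightarrow> d \<in> D" "isg d \<in> D \<longleftrightarrow> d \<in> D" "sg (isg d) = d" "isg (sg d) = d"
  "sg d = sg e \<longleftrightarrow> d = e" "isg d = isg e \<longleftrightarrow> d = e"
  using sg permutes_in_image[OF sg] permutes_in_image[OF permutes_inv[OF sg]]
    permutes_inverses[OF sg] by (auto dest: permutes_inj[THEN injD] permutes_inv[THEN permutes_inj, THEN injD])

lemma isg_neq: "d \<in> D \<Longrightarrow> isg d \<noteq> d" "d \<in> D \<Longrightarrow> isg (isg d) \<noteq> d" "d \<in> D \<Longrightarrow> isg d \<noteq> sg d"
  using sg_neq sg_sg_neq sg_simps by metis+

lemma al_simps [simp]: "d \<in> D \<Longrightarrow> al (al d) = d" "d \<in> D \<Longrightarrow> al d \<in> D"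
  using al_in al_al by auto

definition phi :: "'d \<Rightarrow> 'd" where
  "phi d = sg (al d)"

lemma phi_bij: "bij_betw phi D D"
  by (rule bij_betwI[where g = "\<lambda>d. al (isg d)"]) (auto simp: phi_def)

lemma sg_bij: "bij_betw sg D D"
  using sg by (rule permutes_imp_bij)

lemmas sg_orbit_self = bij_orbit_self[OF fin sg_bij]
  and phi_orbit_self = bij_orbit_self[OF fin phi_bij]
  and sg_orbit_sub = bij_orbit_subset[OF sg_bij]
  and phi_orbit_sub = bij_orbit_subset[OF phi_bij]
  and phi_orbit_eq = bij_orbit_eq[OF fin phi_bij]
  and sg_orbit_step = bij_orbit_step[OF fin sg_bij]
  and phi_orbit_step = bij_orbit_step[OF fin phi_bij]

lemma isg_orbit: "orbit isg d = orbit sg d"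
  using sg fin by (intro orbit_inv_eq) (auto simp: permutation_permutes)

text \<open>Simplicity of the dual map: no edge has the same face on both sides, and no two edges
  separate the same two faces.\<close>

definition good :: bool where
  "good \<longleftrightarrow> (\<forall>d\<in>D. orbit phi d \<noteq> orbit phi (al d)) \<and>
    (\<forall>d\<in>D. \<forall>e\<in>D. orbit phi d = orbit phi e \<longrightarrow> orbit phi (al d) = orbit phi (al e) \<longrightarrow> d = e)"

text \<open>The genus, computed with \<open>card D div 2\<close> edges.\<close>

definition genus :: "int \<Rightarrow> bool" where
  "genus h \<longleftrightarrow> 2 * int (card (orbit sg ` D)) + 2 * int (card (orbit phi ` D)) = int (card D) + 4 - 4 * h"

end

section \<open>Arc codes and the cubic graph\<close>

text \<open>The capital letter is the kind of the tail. The small letter is the direction: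
  \<open>r\<close> leads to the dart \<open>sg d\<close>, \<open>l\<close> to \<open>isg d\<close>,
  and \<open>u\<close>, \<open>w\<close>, \<open>z\<close> to a vertex of that kind, for
  \<open>Zz\<close> at the other end of the edge of \<open>d\<close>. Unlike a pair of vertices, a
  code displays its dart, so functions on arcs are given by recursion.\<close>

datatype 'd arc = Uw (base: 'd) | Ur (base: 'd) | Ul (base: 'd) | Wz (base: 'd) | Wu (base: 'd)
  | Wl (base: 'd) | Zz (base: 'd) | Zr (base: 'd) | Zw (base: 'd)

text \<open>The three kinds of faces of the unflipped blow-up: a pentagon for each dart, the inside
  of each ring, and the enlarged faces of the map.\<close>

datatype 'd face = Pentagon 'd | Center "'d set" | Big "'d set"

primrec turn_code :: "'d arc \<Rightarrow> 'd arc" where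
  "turn_code (Uw d) = Ur d" | "turn_code (Ur d) = Ul d" | "turn_code (Ul d) = Uw d"
| "turn_code (Wz d) = Wu d" | "turn_code (Wu d) = Wl d" | "turn_code (Wl d) = Wz d"
| "turn_code (Zz d) = Zr d" | "turn_code (Zr d) = Zw d" | "turn_code (Zw d) = Zz d"

text \<open>In the cubic graph below, every dart \<open>d\<close> contributes the pentagon with the vertices \<open>U d\<close>,
  \<open>U (sg d)\<close>, \<open>W (sg d)\<close>, \<open>Z d\<close>, \<open>W d\<close>; the pentagons at a vertex of the map form a ring, and the
  edge of \<open>d\<close> becomes the edge between \<open>Z d\<close> and \<open>Z (al d)\<close>.\<close>

locale blowup = comb_map D sg al
  for D :: "'d set" and sg al +
  fixes U W Z :: "'d \<Rightarrow> 'v"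
  assumes inj: "inj_on U D" "inj_on W D" "inj_on Z D"
    and disj: "d \<in> D \<Longrightarrow> e \<in> D \<Longrightarrow> U d \<noteq> W e" "d \<in> D \<Longrightarrow> e \<in> D \<Longrightarrow> U d \<noteq> Z e" "d \<in> D \<Longrightarrow> e \<in> D \<Longrightarrow> W d \<noteq> Z e"
begin

lemma vert_simps [simp]:
  "d \<in> D \<Longrightarrow> e \<in> D \<Longrightarrow> U d = U e \<longleftrightarrow> d = e" "d \<in> D \<Longrightarrow> e \<in> D \<Longrightarrow> W d = W e \<longleftrightarrow> d = e"
  "d \<in> D \<Longrightarrow> e \<in> D \<Longrightarrow> Z d = Z e \<longleftrightarrow> d = e"
  "d \<in> D \<Longrightarrow> e \<in> D \<Longrightarrow> U d \<noteq> W e" "d \<in> D \<Longrightarrow> e \<in> D \<Longrightarrow> U d \<noteq> Z e" "d \<in> D \<Longrightarrow> e \<in> D \<Longrightarrow> W d \<noteq> Z e"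
  "d \<in> D \<Longrightarrow> e \<in> D \<Longrightarrow> W d \<noteq> U e" "d \<in> D \<Longrightarrow> e \<in> D \<Longrightarrow> Z d \<noteq> U e" "d \<in> D \<Longrightarrow> e \<in> D \<Longrightarrow> Z d \<noteq> W e"
  by (simp_all add: inj_on_eq_iff[OF inj(1)] inj_on_eq_iff[OF inj(2)] inj_on_eq_iff[OF inj(3)]
      disj not_sym[OF disj(1)] not_sym[OF disj(2)] not_sym[OF disj(3)])

primrec arc_of :: "'d arc \<Rightarrow> 'v \<times> 'v" where
  "arc_of (Uw d) = (U d, W d)" | "arc_of (Ur d) = (U d, U (sg d))" | "arc_of (Ul d) = (U d, U (isg d))"
| "arc_of (Wz d) = (W d, Z d)" | "arc_of (Wu d) = (W d, U d)" | "arc_of (Wl d) = (W d, Z (isg d))"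
| "arc_of (Zz d) = (Z d, Z (al d))" | "arc_of (Zr d) = (Z d, W (sg d))" | "arc_of (Zw d) = (Z d, W d)"

primrec rev_code :: "'d arc \<Rightarrow> 'd arc" where
  "rev_code (Uw d) = Wu d" | "rev_code (Ur d) = Ul (sg d)" | "rev_code (Ul d) = Ur (isg d)"
| "rev_code (Wz d) = Zw d" | "rev_code (Wu d) = Uw d" | "rev_code (Wl d) = Zr (isg d)"
| "rev_code (Zz d) = Zz (al d)" | "rev_code (Zr d) = Wl (sg d)" | "rev_code (Zw d) = Wz d"

definition codes :: "'d arc set" where
  "codes = {c. base c \<in> D}"

definition blow :: "'v pair_pre_digraph" where
  "blow = \<lparr>pverts = U ` D \<union> W ` D \<union> Z ` D, parcs = arc_of ` codes\<rparr>"

definition rot :: "'v \<times> 'v \<Rightarrow> 'v \<times> 'v" where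
  "rot a = (if a \<in> arc_of ` codes then arc_of (turn_code (inv_into codes arc_of a)) else a)"

lemma parcs_blow: "parcs blow = arc_of ` codes"
  by (simp add: blow_def)

lemma codes_simps [simp]: "turn_code c \<in> codes \<longleftrightarrow> c \<in> codes" "c \<in> codes \<Longrightarrow> rev_code c \<in> codes"
  by (cases c; simp add: codes_def)+

text \<open>Degree at least three separates \<open>sg d\<close> from \<open>isg d\<close>, hence
  \<open>Ur d\<close> from \<open>Ul d\<close>; the other codes differ by the kinds of their ends or
  by their darts.\<close>

lemma arc_of_inj: "inj_on arc_of codes"
proof (rule inj_onI)
  fix c c' assume "c \<in> codes" "c' \<in> codes" "arc_of c = arc_of c'"
  then show "c = c'"
    by (cases c; cases c') (auto simp: codes_def isg_neq sg_neq not_sym[OF isg_neq(1)] not_sym[OF isg_neq(3)] not_sym[OF sg_neq])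
qed

lemma arc_of_rev: "c \<in> codes \<Longrightarrow> prod.swap (arc_of c) = arc_of (rev_code c)"
  by (cases c) (auto simp: codes_def)

lemma rot_arc_of: "c \<in> codes \<Longrightarrow> rot (arc_of c) = arc_of (turn_code c)"
  by (simp add: rot_def inv_into_f_f[OF arc_of_inj])

lemma turn_code_3: "turn_code (turn_code (turn_code c)) = c"
  by (cases c) auto

lemma rot_permutes: "rot permutes parcs blow"
proof (rule bij_imp_permutes)
  show "bij_betw rot (parcs blow) (parcs blow)" unfolding parcs_blow
  proof (rule bij_betwI[where g = "rot \<circ> rot"])
  qed (auto simp: rot_arc_of turn_code_3)
qed (auto simp: rot_def parcs_blow)

lemma finite_codes: "finite codes" "card codes = 9 * card D"
proof -
  have eq: "codes = Uw ` D \<union> Ur ` D \<union> Ul ` D \<union> Wz ` D \<union> Wu ` D \<union> Wl ` D \<union> Zz ` D \<union> Zr ` D \<union> Zw ` D"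
    (is "_ = ?R")
  proof
    show "codes \<subseteq> ?R"
    proof
      fix c assume "c \<in> codes" then show "c \<in> ?R" by (cases c) (auto simp: codes_def)
    qed
  qed (auto simp: codes_def)
  show "finite codes" unfolding eq using fin by auto
  show "card codes = 9 * card D" unfolding eq using fin
    by (subst card_Un_disjoint, simp_all add: card_image inj_on_def, blast?)+
qed

lemma pair_graph_blow: "pair_graph blow"
proof
  show "finite (pverts blow)" "finite (parcs blow)" using fin finite_codes by (auto simp: blow_def)
  show "fst e \<in> pverts blow" "snd e \<in> pverts blow" if "e \<in> parcs blow" for e
  proof -
    obtain c where "c \<in> codes" "e = arc_of c" using \<open>e \<in> parcs blow\<close> by (auto simp: parcs_blow)
    then show "fst e \<in> pverts blow" "snd e \<in> pverts blow" by (cases c; simp add: blow_def codes_def)+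
  qed
  show "fst e \<noteq> snd e" if "e \<in> parcs blow" for e
  proof -
    obtain c where "c \<in> codes" "e = arc_of c" using \<open>e \<in> parcs blow\<close> by (auto simp: parcs_blow)
    then show "fst e \<noteq> snd e" by (cases c) (auto simp: codes_def sg_neq isg_neq al_neq dest: sym)
  qed
  have "prod.swap e \<in> parcs blow" if "e \<in> parcs blow" for e
    using that arc_of_rev by (auto simp: parcs_blow)
  then show "symmetric (with_proj blow)" by (force simp: symmetric_def sym_def)
qed

lemma out_arcs_blow:
  assumes "d \<in> D"
  shows "out_arcs (with_proj blow) (U d) = {arc_of (Uw d), arc_of (Ur d), arc_of (Ul d)}"
    "out_arcs (with_proj blow) (W d) = {arc_of (Wz d), arc_of (Wu d), arc_of (Wl d)}"
    "out_arcs (with_proj blow) (Z d) = {arc_of (Zz d), arc_of (Zr d), arc_of (Zw d)}"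
proof -
  have *: "out_arcs (with_proj blow) v = arc_of ` {c \<in> codes. fst (arc_of c) = v}" for v
    by (auto simp: out_arcs_def parcs_blow)
  have "{c \<in> codes. fst (arc_of c) = U d} = {Uw d, Ur d, Ul d}" (is "?L = ?R")
  proof
    show "?L \<subseteq> ?R"
    proof
      fix c assume "c \<in> ?L" then show "c \<in> ?R" using assms by (cases c) (auto simp: codes_def)
    qed
  qed (use assms in \<open>auto simp: codes_def\<close>)
  then show "out_arcs (with_proj blow) (U d) = {arc_of (Uw d), arc_of (Ur d), arc_of (Ul d)}"
    unfolding * by simp
  have "{c \<in> codes. fst (arc_of c) = W d} = {Wz d, Wu d, Wl d}" (is "?L = ?R")
  proof
    show "?L \<subseteq> ?R"
    proof
      fix c assume "c \<in> ?L" then show "c \<in> ?R" using assms by (cases c) (auto simp: codes_def)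
    qed
  qed (use assms in \<open>auto simp: codes_def\<close>)
  then show "out_arcs (with_proj blow) (W d) = {arc_of (Wz d), arc_of (Wu d), arc_of (Wl d)}"
    unfolding * by simp
  have "{c \<in> codes. fst (arc_of c) = Z d} = {Zz d, Zr d, Zw d}" (is "?L = ?R")
  proof
    show "?L \<subseteq> ?R"
    proof
      fix c assume "c \<in> ?L" then show "c \<in> ?R" using assms by (cases c) (auto simp: codes_def)
    qed
  qed (use assms in \<open>auto simp: codes_def\<close>)
  then show "out_arcs (with_proj blow) (Z d) = {arc_of (Zz d), arc_of (Zr d), arc_of (Zw d)}"
    unfolding * by simp
qed

lemma cubic: "cubic_graph blow"
proof -
  have 3: "card {arc_of c, arc_of (turn_code c), arc_of (turn_code (turn_code c))} = 3" if "c \<in> codes" for c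
  proof -
    have "c \<noteq> turn_code c" "turn_code c \<noteq> turn_code (turn_code c)" "c \<noteq> turn_code (turn_code c)"
      by (cases c; simp)+
    then show ?thesis using that arc_of_inj by (simp add: inj_on_eq_iff)
  qed
  show ?thesis unfolding cubic_graph_def
  proof (intro conjI ballI pair_graph_blow)
    fix v assume "v \<in> pverts blow"
    then obtain d where d: "d \<in> D" "v = U d \<or> v = W d \<or> v = Z d" by (auto simp: blow_def)
    have "Uw d \<in> codes" "Wz d \<in> codes" "Zz d \<in> codes" using d by (auto simp: codes_def)
    then show "out_degree (with_proj blow) v = 3"
      using d(2) out_arcs_blow[OF d(1)] 3[of "Uw d"] 3[of "Wz d"] 3[of "Zz d"]
      by (auto simp: out_degree_def)
  qed
qed

lemma embedding: "embedding blow rot"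
  unfolding embedding_def
proof (intro conjI ballI impI pair_graph_blow rot_permutes)
  fix v assume "v \<in> pverts blow"
  then obtain d where d: "d \<in> D" "v = U d \<or> v = W d \<or> v = Z d" by (auto simp: blow_def)
  have c: "Uw d \<in> codes" "Wz d \<in> codes" "Zz d \<in> codes" using d by (auto simp: codes_def)
  have *: "cyclic_on rot {arc_of c, arc_of (turn_code c), arc_of (turn_code (turn_code c))}" if "c \<in> codes" for c
    using that by (intro cyclic_on_triple) (simp_all add: rot_arc_of turn_code_3)
  show "cyclic_on rot (out_arcs (with_proj blow) v)"
    using d(2) *[OF c(1)] *[OF c(2)] *[OF c(3)] out_arcs_blow[OF d(1)] by auto
next
  show "Digraph_Component.connected (with_proj blow)"
  proof (rule connected_if_closed[OF pair_graph_blow])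
    show "pverts blow \<noteq> {}" using nonempty by (auto simp: blow_def)
    fix S assume S: "S \<subseteq> pverts blow" "S \<noteq> {}"
      and cl: "\<And>u v. (u, v) \<in> parcs blow \<Longrightarrow> u \<in> S \<Longrightarrow> v \<in> S"
    have step: "fst (arc_of c) \<in> S \<Longrightarrow> snd (arc_of c) \<in> S" if "c \<in> codes" for c
      using cl[of "fst (arc_of c)" "snd (arc_of c)"] that by (simp add: parcs_blow)
    define T where "T = {d \<in> D. Z d \<in> S}"
    \<comment> \<open>The three vertices of a dart are joined by a path, so a closed vertex set is
      given by a set of darts, and this set is closed under \<open>sg\<close> and
      \<open>al\<close>.\<close>
    have UWZ: "U d \<in> S \<longleftrightarrow> W d \<in> S" "W d \<in> S \<longleftrightarrow> Z d \<in> S" if "d \<in> D" for d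
    proof -
      have "Uw d \<in> codes" "Wu d \<in> codes" "Wz d \<in> codes" "Zw d \<in> codes"
        using that by (simp_all add: codes_def)
      note this[THEN step, unfolded arc_of.simps fst_conv snd_conv]
      then show "U d \<in> S \<longleftrightarrow> W d \<in> S" "W d \<in> S \<longleftrightarrow> Z d \<in> S" by blast+
    qed
    have "T = D"
    proof (rule conn)
      show "T \<subseteq> D" by (auto simp: T_def)
      obtain v where v: "v \<in> S" using S(2) by blast
      then obtain d where "d \<in> D" "v = U d \<or> v = W d \<or> v = Z d" using S(1) by (auto simp: blow_def)
      then have "d \<in> T" using v UWZ[of d] by (auto simp: T_def)
      then show "T \<noteq> {}" by blast
      fix d assume d: "d \<in> T"
      then have dD: "d \<in> D" "Z d \<in> S" by (auto simp: T_def)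
      then have "U (sg d) \<in> S" using step[of "Ur d"] UWZ[of d] by (simp add: codes_def)
      then show "sg d \<in> T" using dD UWZ[of "sg d"] by (simp add: T_def)
      show "al d \<in> T" using dD step[of "Zz d"] by (auto simp: T_def codes_def)
    qed
    then have "U d \<in> S \<and> W d \<in> S \<and> Z d \<in> S" if "d \<in> D" for d
    proof -
      have "d \<in> T" using that \<open>T = D\<close> by (simp only:)
      then show ?thesis using UWZ[OF that] by (simp add: T_def)
    qed
    then have "pverts blow \<subseteq> S" by (auto simp: blow_def)
    then show "S = pverts blow" using S(1) by blast
  qed
qed

end

section \<open>Faces of the blow-up\<close>

text \<open>Applied with face walks on one side and their labels on the other, this counts the faces
  without describing them as sets.\<close>

lemma card_image_same_kernel:
  assumes "\<And>x y. x \<in> A \<Longrightarrow> y \<in> A \<Longrightarrow> f x = f y \<longleftrightarrow> g x = g y"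
  shows "card (f ` A) = card (g ` A)"
proof -
  define r where "r z = g (inv_into A f z)" for z
  have r: "r (f x) = g x" if "x \<in> A" for x
    using assms[of "inv_into A f (f x)" x] that f_inv_into_f[of "f x" f A] inv_into_into[of "f x" f A]
    by (simp add: r_def)
  have "inj_on r (f ` A)"
    using r assms by (intro inj_onI) auto
  moreover have "r ` f ` A = g ` A" using r by (auto simp: image_iff)
  ultimately show ?thesis using card_image by fastforce
qed

context blowup
begin

definition face_code :: "'d arc \<Rightarrow> 'd arc" where
  "face_code c = turn_code (rev_code c)"

lemma face_code_simps [simp]:
  "face_code (Uw d) = Wl d" "face_code (Ur d) = Uw (sg d)" "face_code (Ul d) = Ul (isg d)"
  "face_code (Wz d) = Zz d" "face_code (Wu d) = Ur d" "face_code (Wl d) = Zw (isg d)"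
  "face_code (Zz d) = Zr (al d)" "face_code (Zr d) = Wz (sg d)" "face_code (Zw d) = Wu d"
  by (simp_all add: face_code_def)

text \<open>A complete invariant of face walks: it is constant along a walk
  (\<open>label_face_code\<close>), and walks with equal labels coincide (\<open>orbit_rep\<close>).
  All questions about faces of the blow-up become equations between labels.\<close>

primrec label :: "'d arc \<Rightarrow> 'd face" where
  "label (Uw d) = Pentagon (isg d)" | "label (Ur d) = Pentagon d" | "label (Ul d) = Center (orbit sg d)"
| "label (Wz d) = Big (orbit phi d)" | "label (Wu d) = Pentagon d" | "label (Wl d) = Pentagon (isg d)"
| "label (Zz d) = Big (orbit phi d)" | "label (Zr d) = Big (orbit phi (al d))" | "label (Zw d) = Pentagon d"

lemma face_succ_arc: "c \<in> codes \<Longrightarrow> face_succ rot (arc_of c) = arc_of (face_code c)"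
  by (simp add: face_succ_def face_code_def arc_of_rev rot_arc_of)

lemma rev_rev_code: "c \<in> codes \<Longrightarrow> rev_code (rev_code c) = c"
  by (cases c) (auto simp: codes_def)

lemma face_code_bij: "bij_betw face_code codes codes"
proof (rule bij_betwI[where g = "\<lambda>c. rev_code (turn_code (turn_code c))"])
qed (auto simp: face_code_def rev_rev_code turn_code_3)

lemmas code_orbit_self = bij_orbit_self[OF finite_codes(1) face_code_bij]
  and code_orbit_sub = bij_orbit_subset[OF face_code_bij]
  and code_orbit_step = bij_orbit_step[OF finite_codes(1) face_code_bij]

lemma orbit_arc_of:
  assumes "c \<in> codes"
  shows "orbit (face_succ rot) (arc_of c) = arc_of ` orbit face_code c"
  using orbit_inverse[OF code_orbit_self[OF assms], of "face_succ rot" arc_of]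
    code_orbit_sub[OF assms] face_succ_arc by blast

lemma label_face_code: "c \<in> codes \<Longrightarrow> label (face_code c) = label c"
  using sg_orbit_step[of "isg (base c)"] phi_orbit_step[of "al (base c)"]
  by (cases c) (simp_all add: codes_def phi_def)

lemma label_orbit:
  assumes "c \<in> codes" "c' \<in> orbit face_code c"
  shows "label c' = label c"
  using assms(2)
proof induction
  case base then show ?case using assms(1) by (rule label_face_code)
next
  case (step y)
  then have "y \<in> codes" using code_orbit_sub[OF assms(1)] by blast
  then show ?case using step label_face_code by simp
qed

lemma orbit_Ul:
  assumes "d \<in> D" "e \<in> orbit sg d"
  shows "orbit face_code (Ul e) = orbit face_code (Ul d)"
proof -
  \<comment> \<open>The inner face of a ring is traversed against the rotation, so the induction has
    to run along \<open>isg\<close>.\<close>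
  have "e \<in> orbit isg d" using assms by (simp add: isg_orbit)
  then show ?thesis
  proof induction
    case base
    then show ?case using code_orbit_step[of "Ul d"] assms(1) by (simp add: codes_def)
  next
    case (step y)
    then have "y \<in> D" using sg_orbit_sub[OF assms(1)] by (auto simp: isg_orbit)
    then show ?case using code_orbit_step[of "Ul y"] step by (simp add: codes_def)
  qed
qed

text \<open>The walk reads \<open>Wz d\<close>, \<open>Zz d\<close>, \<open>Zr (al d)\<close>,
  \<open>Wz (phi d)\<close>: three arcs for each dart of a face of the map.\<close>

lemma orbit_big:
  assumes "d \<in> D"
  shows "orbit face_code (Zr (al d)) = orbit face_code (Zz d)"
    "orbit face_code (Wz d) = orbit face_code (Zz d)"
    "orbit face_code (Zr d) = orbit face_code (Zz (al d))"
    "orbit face_code (Zz (phi d)) = orbit face_code (Zz d)"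
proof -
  have 1: "orbit face_code (Zr (al d)) = orbit face_code (Zz d)" if "d \<in> D" for d
    using code_orbit_step[of "Zz d"] that by (simp add: codes_def)
  have 2: "orbit face_code (Wz d) = orbit face_code (Zz d)" if "d \<in> D" for d
    using code_orbit_step[of "Wz d"] that by (simp add: codes_def)
  show "orbit face_code (Zr (al d)) = orbit face_code (Zz d)" "orbit face_code (Wz d) = orbit face_code (Zz d)"
    using 1 2 assms by simp_all
  show "orbit face_code (Zr d) = orbit face_code (Zz (al d))" using 1[of "al d"] assms by simp
  have "orbit face_code (Wz (phi d)) = orbit face_code (Zr (al d))"
    using code_orbit_step[of "Zr (al d)"] assms by (simp add: codes_def phi_def)
  then show "orbit face_code (Zz (phi d)) = orbit face_code (Zz d)"
    using 1[OF assms] 2[of "phi d"] assms by (simp add: phi_def)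
qed

lemma orbit_Zz:
  assumes "d \<in> D" "e \<in> orbit phi d"
  shows "orbit face_code (Zz e) = orbit face_code (Zz d)"
  using assms(2)
proof induction
  case base then show ?case using orbit_big(4)[OF assms(1)] .
next
  case (step y)
  then have "y \<in> D" using phi_orbit_sub[OF assms(1)] by blast
  then show ?case using orbit_big(4) step by simp
qed

text \<open>The pentagon of \<open>d\<close> reads \<open>Ur d\<close>, \<open>Uw (sg d)\<close>,
  \<open>Wl (sg d)\<close>, \<open>Zw d\<close>, \<open>Wu d\<close>, and \<open>Ur\<close> serves
  as its representative.\<close>

lemma orbit_pentagon:
  assumes "d \<in> D"
  shows "orbit face_code (Uw d) = orbit face_code (Ur (isg d))" "orbit face_code (Wl d) = orbit face_code (Ur (isg d))"
    "orbit face_code (Zw d) = orbit face_code (Ur d)" "orbit face_code (Wu d) = orbit face_code (Ur d)"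
proof -
  have 4: "orbit face_code (Wu d) = orbit face_code (Ur d)" if "d \<in> D" for d
    using code_orbit_step[of "Wu d"] that by (simp add: codes_def)
  have 3: "orbit face_code (Zw d) = orbit face_code (Ur d)" if "d \<in> D" for d
    using code_orbit_step[of "Zw d"] that 4 by (simp add: codes_def)
  show 2: "orbit face_code (Wl d) = orbit face_code (Ur (isg d))"
    using code_orbit_step[of "Wl d"] assms 3[of "isg d"] by (simp add: codes_def)
  show "orbit face_code (Uw d) = orbit face_code (Ur (isg d))"
    using code_orbit_step[of "Uw d"] assms 2 by (simp add: codes_def)
  show "orbit face_code (Zw d) = orbit face_code (Ur d)" "orbit face_code (Wu d) = orbit face_code (Ur d)"
    using 3 4 assms by simp_all
qed

text \<open>A left inverse to labelling: the walk is recovered from its label through a chosen dart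
  of the vertex or face. Any choice gives the same walk by \<open>orbit_Ul\<close> and
  \<open>orbit_Zz\<close>.\<close>

primrec rep :: "'d face \<Rightarrow> 'd arc set" where
  "rep (Pentagon d) = orbit face_code (Ur d)"
| "rep (Center Q) = orbit face_code (Ul (SOME d. d \<in> D \<and> Q = orbit sg d))"
| "rep (Big Q) = orbit face_code (Zz (SOME d. d \<in> D \<and> Q = orbit phi d))"

lemma orbit_rep:
  assumes "c \<in> codes"
  shows "orbit face_code c = rep (label c)"
proof -
  have C: "orbit face_code (Ul d) = rep (Center (orbit sg d))" if "d \<in> D" for d
  proof -
    define e where "e = (SOME e. e \<in> D \<and> orbit sg d = orbit sg e)"
    have "e \<in> D \<and> orbit sg d = orbit sg e" unfolding e_def by (rule someI[of _ d]) (simp add: that)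
    then have "e \<in> D" "d \<in> orbit sg e" using sg_orbit_self[OF that] by auto
    then show ?thesis using orbit_Ul[of e d] by (simp add: e_def)
  qed
  have B: "orbit face_code (Zz d) = rep (Big (orbit phi d))" if "d \<in> D" for d
  proof -
    define e where "e = (SOME e. e \<in> D \<and> orbit phi d = orbit phi e)"
    have "e \<in> D \<and> orbit phi d = orbit phi e" unfolding e_def by (rule someI[of _ d]) (simp add: that)
    then have "e \<in> D" "d \<in> orbit phi e" using phi_orbit_self[OF that] by auto
    then show ?thesis using orbit_Zz[of e d] by (simp add: e_def)
  qed
  show ?thesis using assms
    by (cases c) (auto simp: codes_def orbit_pentagon orbit_big C B simp del: rep.simps(2,3))
qed

lemma orbit_eq_iff:
  assumes "c \<in> codes" "c' \<in> codes"
  shows "orbit (face_succ rot) (arc_of c) = orbit (face_succ rot) (arc_of c') \<longleftrightarrow> label c = label c'"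
proof
  assume "label c = label c'"
  then show "orbit (face_succ rot) (arc_of c) = orbit (face_succ rot) (arc_of c')"
    using assms by (simp add: orbit_arc_of orbit_rep)
next
  assume "orbit (face_succ rot) (arc_of c) = orbit (face_succ rot) (arc_of c')"
  then have "arc_of c \<in> arc_of ` orbit face_code c'"
    using imageI[OF code_orbit_self[OF assms(1)], of arc_of] assms by (simp only: orbit_arc_of)
  then obtain c0 where c0: "c0 \<in> orbit face_code c'" "arc_of c = arc_of c0" by blast
  then have "c = c0" using code_orbit_sub[OF assms(2)] assms(1) by (intro inj_onD[OF arc_of_inj]) auto
  then have "c \<in> orbit face_code c'" using c0 by simp
  then show "label c = label c'" by (rule label_orbit[OF assms(2)])
qed

lemma card_faces: "card (faces blow rot) = card D + card (orbit sg ` D) + card (orbit phi ` D)"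
proof -
  have "faces blow rot = (\<lambda>c. orbit (face_succ rot) (arc_of c)) ` codes"
    by (simp add: faces_def parcs_blow image_image)
  then have "card (faces blow rot) = card (label ` codes)"
    using card_image_same_kernel[of codes "\<lambda>c. orbit (face_succ rot) (arc_of c)" label] orbit_eq_iff by simp
  also have "label ` codes = Pentagon ` D \<union> Center ` orbit sg ` D \<union> Big ` orbit phi ` D" (is "?L = ?R")
  proof
    show "?L \<subseteq> ?R"
    proof
      fix l assume "l \<in> ?L"
      then obtain c where "c \<in> codes" "l = label c" by blast
      then show "l \<in> ?R" by (cases c) (auto simp: codes_def)
    qed
    show "?R \<subseteq> ?L"
    proof
      fix l assume "l \<in> ?R"
      then obtain d where d: "d \<in> D" "l = Pentagon d \<or> l = Center (orbit sg d) \<or> l = Big (orbit phi d)" by blast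
      then have "l = label (Ur d) \<or> l = label (Ul d) \<or> l = label (Zz d)" by simp
      moreover have "Ur d \<in> codes" "Ul d \<in> codes" "Zz d \<in> codes" using d by (simp_all add: codes_def)
      ultimately show "l \<in> ?L" by blast
    qed
  qed
  also have "card \<dots> = card D + card (orbit sg ` D) + card (orbit phi ` D)"
  proof -
    have "card (Pentagon ` D \<union> Center ` orbit sg ` D \<union> Big ` orbit phi ` D) =
      card (Pentagon ` D) + card (Center ` orbit sg ` D) + card (Big ` orbit phi ` D)"
      using fin by (subst card_Un_disjoint, simp, simp, blast)+ simp
    then show ?thesis by (simp add: card_image inj_on_def)
  qed
  finally show ?thesis .
qed

text \<open>With \<open>n\<close> darts the blow-up has \<open>3n\<close> vertices,
  \<open>9n/2\<close> edges and \<open>n\<close> faces beyond one for each vertex and each face of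
  the map. Since \<open>3n - 9n/2 + n = - n/2\<close> is minus the number of edges of the map, the
  Euler characteristics agree.\<close>

lemma has_genus_iff: "has_genus blow rot g \<longleftrightarrow> genus (int g)"
proof -
  have "card (pverts blow) = 3 * card D"
  proof -
    have "card (U ` D \<union> W ` D \<union> Z ` D) = card (U ` D) + card (W ` D) + card (Z ` D)"
      using fin disj by (subst card_Un_disjoint; force?)+
    then show ?thesis using inj by (simp add: blow_def card_image)
  qed
  moreover have "2 * card (undirected (parcs blow)) = 9 * card D"
    using card_undirected[of "parcs blow"] cubic_arcs[OF cubic embedding] finite_codes card_image[OF arc_of_inj]
    by (simp add: parcs_blow)
  ultimately show ?thesis by (auto simp: has_genus_def genus_def card_faces)
qed

text \<open>Edges \<open>Zz\<close> separate two big faces and are handled by \<open>good\<close>.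
  The edges of \<open>Wz d\<close> and \<open>Zr d\<close> both lie between the pentagon of
  \<open>d\<close> and a big face, and these big faces differ because \<open>good\<close> excludes
  an edge with equal sides. Two pentagons share at most one edge because degrees are at least
  three.\<close>

lemma polyhedral_if_good:
  assumes good
  shows "polyhedral blow rot"
proof (rule polyhedral_if_dual_simple[OF cubic embedding])
  have g1: "d \<in> D \<Longrightarrow> orbit phi d \<noteq> orbit phi (al d)"
    and g2: "d \<in> D \<Longrightarrow> e \<in> D \<Longrightarrow> orbit phi d = orbit phi e \<Longrightarrow> orbit phi (al d) = orbit phi (al e) \<Longrightarrow> d = e" for d e
    using assms by (auto simp: good_def)
  have lab: "label c \<noteq> label (rev_code c)" if "c \<in> codes" for c
    using that by (cases c) (auto simp: codes_def isg_neq not_sym[OF isg_neq(1)] g1)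
  show "orbit (face_succ rot) e \<noteq> orbit (face_succ rot) (prod.swap e)" if "e \<in> parcs blow" for e
    using that lab by (auto simp: parcs_blow arc_of_rev orbit_eq_iff)
  have lab2: "c = c'" if "c \<in> codes" "c' \<in> codes" "label c = label c'" "label (rev_code c) = label (rev_code c')" for c c'
    using that g1 g2[of "base c" "base c'"]
    by (cases c; cases c') (auto simp: codes_def isg_neq not_sym[OF isg_neq(2)])
  show "e = e'" if "e \<in> parcs blow" "e' \<in> parcs blow" "orbit (face_succ rot) e = orbit (face_succ rot) e'"
    "orbit (face_succ rot) (prod.swap e) = orbit (face_succ rot) (prod.swap e')" for e e'
  proof -
    obtain c c' where c: "c \<in> codes" "e = arc_of c" "c' \<in> codes" "e' = arc_of c'"
      using \<open>e \<in> parcs blow\<close> \<open>e' \<in> parcs blow\<close> by (auto simp: parcs_blow)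
    then have "label c = label c'" "label (rev_code c) = label (rev_code c')"
      using that(3,4) by (simp_all add: arc_of_rev orbit_eq_iff)
    then show ?thesis using lab2[OF c(1,3)] c by simp
  qed
  show "3 \<le> card (orbit (face_succ rot) e)" if "e \<in> parcs blow" for e
  proof -
    obtain c where c: "c \<in> codes" "e = arc_of c" using \<open>e \<in> parcs blow\<close> by (auto simp: parcs_blow)
    have 1: "face_code c \<noteq> c" if "c \<in> codes" for c
      using that by (cases c) (simp_all add: codes_def isg_neq)
    have 2: "face_code (face_code c) \<noteq> c" if "c \<in> codes" for c
      using that by (cases c) (simp_all add: codes_def isg_neq)
    have fc: "face_code c \<in> codes" using c by (simp add: face_code_def)
    have "{c, face_code c, face_code (face_code c)} \<subseteq> orbit face_code c"
      using code_orbit_self[OF c(1)] by (auto intro: orbit.intros)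
    then have "card {c, face_code c, face_code (face_code c)} \<le> card (orbit face_code c)"
      using finite_subset[OF code_orbit_sub[OF c(1)] finite_codes(1)] by (rule card_mono[rotated])
    moreover have "card {c, face_code c, face_code (face_code c)} = 3"
      using 1[OF c(1)] 2[OF c(1)] 1[OF fc] not_sym by (simp add: eq_commute)
    moreover have "card (arc_of ` orbit face_code c) = card (orbit face_code c)"
      using inj_on_subset[OF arc_of_inj code_orbit_sub[OF c(1)]] by (rule card_image)
    ultimately show ?thesis using c by (simp add: orbit_arc_of)
  qed
qed

text \<open>If both sides of the edge of \<open>d\<close> were one face, its walk would leave
  \<open>Z d\<close> twice, by \<open>Zz d\<close> and by \<open>Zr d\<close>.\<close>

lemma polyhedral_sides:
  assumes "polyhedral blow rot" "d \<in> D"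
  shows "orbit phi d \<noteq> orbit phi (al d)"
proof
  assume eq: "orbit phi d = orbit phi (al d)"
  have c: "Zz d \<in> codes" "Zr d \<in> codes" using assms(2) by (simp_all add: codes_def)
  let ?F = "orbit (face_succ rot) (arc_of (Zz d))"
  have "orbit face_code (Zz d) = orbit face_code (Zr d)" using c eq by (simp add: orbit_rep)
  then have "Zz d \<in> orbit face_code (Zz d)" "Zr d \<in> orbit face_code (Zz d)"
    using code_orbit_self[OF c(1)] code_orbit_self[OF c(2)] by simp_all
  then have F: "arc_of (Zz d) \<in> ?F" "arc_of (Zr d) \<in> ?F" unfolding orbit_arc_of[OF c(1)] by blast+
  have "?F \<in> faces blow rot" unfolding faces_def parcs_blow using c by blast
  then have "inj_on fst ?F" using assms(1) by (simp add: polyhedral_def simple_face_def)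
  then have "arc_of (Zz d) = arc_of (Zr d)" by (rule inj_onD[OF _ _ F]) simp
  then show False using inj_onD[OF arc_of_inj _ c] by simp
qed

end

section \<open>All polyhedral embeddings of the blow-up\<close>

definition flip :: "('d \<Rightarrow> bool) \<Rightarrow> ('d \<Rightarrow> 'd) \<Rightarrow> 'd \<Rightarrow> 'd" where
  "flip s f d = (if s d then f d else inv f d)"

section \<open>Flips of a combinatorial map\<close>

context comb_map
begin

definition invariant :: "('d \<Rightarrow> bool) \<Rightarrow> bool" where
  "invariant s \<longleftrightarrow> (\<forall>d. s (sg d) = s d)"

lemma invariantI:
  assumes "\<And>d. d \<in> D \<Longrightarrow> s (sg d) = s d"
  shows "invariant s"
  using assms permutes_not_in[OF sg] unfolding invariant_def by metis

lemma invariant_simps: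
  assumes "invariant s"
  shows "s (sg d) = s d" "s (isg d) = s d"
proof -
  show *: "s (sg d) = s d" for d using assms by (simp add: invariant_def)
  show "s (isg d) = s d" using *[of "isg d"] by simp
qed

lemma invariant_not: "invariant s \<Longrightarrow> invariant (\<lambda>d. \<not> s d)"
  by (simp add: invariant_def)

lemma flip_flip_not:
  assumes "invariant s"
  shows "flip s sg (flip (\<lambda>d. \<not> s d) sg d) = d"
  by (simp add: flip_def invariant_simps[OF assms])

lemma inv_flip: "invariant s \<Longrightarrow> inv (flip s sg) = flip (\<lambda>d. \<not> s d) sg"
  using flip_flip_not[of s] flip_flip_not[OF invariant_not, of s]
  by (intro inv_equality) auto

lemma flip_permutes: "invariant s \<Longrightarrow> flip s sg permutes D"
  using flip_flip_not[of s] flip_flip_not[OF invariant_not, of s]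
    permutes_not_in[OF sg] permutes_not_in[OF permutes_inv[OF sg]]
  by (intro bij_imp_permutes bij_betwI[where g = "flip (\<lambda>d. \<not> s d) sg"]) (simp_all add: flip_def)

lemma flip_orbit:
  assumes "invariant s" "d \<in> D"
  shows "orbit (flip s sg) d = orbit sg d"
proof (cases "s d")
  case True
  have "x \<in> D \<and> s x" if "x \<in> orbit sg d" for x
    using that by induct (use assms True in \<open>simp_all add: invariant_simps\<close>)
  then show ?thesis by (intro orbit_cong) (auto simp: flip_def sg_orbit_self assms)
next
  case False
  have "x \<in> D \<and> \<not> s x" if "x \<in> orbit isg d" for x
    using that by induct (use assms False in \<open>simp_all add: invariant_simps\<close>)
  then have "orbit (flip s sg) d = orbit isg d"
    by (intro orbit_cong) (auto simp: flip_def sg_orbit_self isg_orbit assms)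
  then show ?thesis by (simp add: isg_orbit)
qed

lemma comb_map_flip:
  assumes "invariant s"
  shows "comb_map D (flip s sg) al"
proof
  show "flip s sg permutes D" by (rule flip_permutes[OF assms])
  show "flip s sg d \<noteq> d" "flip s sg (flip s sg d) \<noteq> d" if "d \<in> D" for d
    using that by (simp_all add: flip_def invariant_simps[OF assms] sg_neq sg_sg_neq isg_neq)
  fix S assume S: "S \<subseteq> D" "S \<noteq> {}" "\<And>d. d \<in> S \<Longrightarrow> flip s sg d \<in> S" "\<And>d. d \<in> S \<Longrightarrow> al d \<in> S"
  have "x \<in> S" if "d \<in> S" "x \<in> orbit (flip s sg) d" for x d
    using that(2) by induct (use S(3) that(1) in auto)
  then have "sg d \<in> S" if "d \<in> S" for d
    using that S(1) flip_orbit[OF assms, of d] orbit.base[of sg d] by blast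
  then show "S = D" using conn S by blast
qed (use fin nonempty al_neq in auto)

end

section \<open>The blow-up of a flipped map\<close>

context blowup
begin

text \<open>\<open>turn_code\<close> has order three, so applying it twice gives the reversed
  rotation.\<close>

definition frot :: "('d \<Rightarrow> bool) \<Rightarrow> 'v \<times> 'v \<Rightarrow> 'v \<times> 'v" where
  "frot s a = (if a \<in> arc_of ` codes then let c = inv_into codes arc_of a in
     arc_of (if s (base c) then turn_code c else turn_code (turn_code c)) else a)"

lemma frot_arc_of: "c \<in> codes \<Longrightarrow> frot s (arc_of c) = arc_of (if s (base c) then turn_code c else turn_code (turn_code c))"
  by (simp add: frot_def inv_into_f_f[OF arc_of_inj])

text \<open>Flipping the rotation at some vertices of the map gives the same cubic graph, with the
  vertices of the flipped discs renamed.\<close>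

lemma frot_cong:
  assumes "\<And>d. d \<in> D \<Longrightarrow> s d = s' d"
  shows "frot s = frot s'"
proof
  fix a
  have "base (inv_into codes arc_of a) \<in> D" if "a \<in> arc_of ` codes" using inv_into_into[OF that] by (simp add: codes_def)
  then show "frot s a = frot s' a" using assms by (simp add: frot_def Let_def)
qed

text \<open>The pentagon of \<open>d\<close> has one side at \<open>d\<close> and one at
  \<open>sg d\<close>. Reversing the ring exchanges these sides, so \<open>U\<close> and
  \<open>W\<close> move from \<open>d\<close> to \<open>sg d\<close>, while the apex
  \<open>Z d\<close> keeps its name.\<close>

definition flipv :: "('d \<Rightarrow> bool) \<Rightarrow> ('d \<Rightarrow> 'v) \<Rightarrow> 'd \<Rightarrow> 'v" where
  "flipv s V d = (if s d then V d else V (sg d))"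

text \<open>The old code of the arc that has code \<open>c\<close> after its ring is reversed;
  \<open>arc_of_flip\<close> states this.\<close>

primrec mirror_code :: "'d arc \<Rightarrow> 'd arc" where
  "mirror_code (Uw d) = Uw (sg d)" | "mirror_code (Ur d) = Ul (sg d)" | "mirror_code (Ul d) = Ur (sg d)"
| "mirror_code (Wz d) = Wl (sg d)" | "mirror_code (Wu d) = Wu (sg d)" | "mirror_code (Wl d) = Wz (sg d)"
| "mirror_code (Zz d) = Zz d" | "mirror_code (Zr d) = Zw d" | "mirror_code (Zw d) = Zr d"

context
  fixes s assumes s: "invariant s"
begin

text \<open>The vertex names are parameters of \<open>blowup\<close> for this purpose: the flipped
  map is blown up on the same vertices under other names, so everything proved about the unflipped
  blow-up holds for each flip.\<close>

lemma blowup_flip: "blowup D (flip s sg) al (flipv s U) (flipv s W) Z"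
proof -
  interpret F: comb_map D "flip s sg" al by (rule comb_map_flip[OF s])
  have "inj_on (flipv s V) D" if "inj_on V D" for V :: "'d \<Rightarrow> 'v"
  proof (rule inj_onI)
    fix d e assume *: "d \<in> D" "e \<in> D" "flipv s V d = flipv s V e"
    define f where "f d = (if s d then d else sg d)" for d
    have "V (f d) = V (f e)" using *(3) by (simp add: flipv_def f_def if_distrib[of V])
    then have "f d = f e" using that * by (auto simp: f_def inj_on_eq_iff split: if_splits)
    moreover from this have "s d = s e"
      using invariant_simps[OF s] by (metis f_def)
    ultimately show "d = e" by (simp add: f_def split: if_splits)
  qed
  then show ?thesis using inj disj
    by unfold_locales (auto simp: flipv_def)
qed

interpretation F: blowup D "flip s sg" al "flipv s U" "flipv s W" Z
  by (rule blowup_flip)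

lemma mirror_code_in: "c \<in> codes \<Longrightarrow> mirror_code c \<in> codes"
  by (cases c) (simp_all add: codes_def)

lemma base_mirror_code: "s (base (mirror_code c)) = s (base c)"
  by (cases c) (simp_all add: invariant_simps[OF s])

lemma arc_of_flip:
  assumes "c \<in> codes"
  shows "F.arc_of c = arc_of (if s (base c) then c else mirror_code c)"
  using assms
  by (cases c) (simp_all add: inv_flip[OF s], simp_all add: codes_def flipv_def flip_def invariant_simps[OF s])

lemma mirror_code_surj:
  assumes "c \<in> codes"
  obtains c' where "c' \<in> codes" "c = mirror_code c'"
proof -
  have "\<exists>c'. c' \<in> codes \<and> c = mirror_code c'"
  proof (cases c)
    case (Uw d) then show ?thesis using assms by (intro exI[of _ "Uw (isg d)"]) (simp add: codes_def)
  next
    case (Ur d) then show ?thesis using assms by (intro exI[of _ "Ul (isg d)"]) (simp add: codes_def)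
  next
    case (Ul d) then show ?thesis using assms by (intro exI[of _ "Ur (isg d)"]) (simp add: codes_def)
  next
    case (Wz d) then show ?thesis using assms by (intro exI[of _ "Wl (isg d)"]) (simp add: codes_def)
  next
    case (Wu d) then show ?thesis using assms by (intro exI[of _ "Wu (isg d)"]) (simp add: codes_def)
  next
    case (Wl d) then show ?thesis using assms by (intro exI[of _ "Wz (isg d)"]) (simp add: codes_def)
  next
    case (Zz d) then show ?thesis using assms by (intro exI[of _ "Zz d"]) (simp add: codes_def)
  next
    case (Zr d) then show ?thesis using assms by (intro exI[of _ "Zw d"]) (simp add: codes_def)
  next
    case (Zw d) then show ?thesis using assms by (intro exI[of _ "Zr d"]) (simp add: codes_def)
  qed
  then show ?thesis using that by blast
qed

lemma flip_code_surj:
  assumes "c \<in> codes"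
  obtains c' where "c' \<in> codes" "c = (if s (base c') then c' else mirror_code c')" "s (base c') = s (base c)"
proof (cases "s (base c)")
  case True then show ?thesis using that[of c] assms by simp
next
  case False
  obtain c' where c': "c' \<in> codes" "c = mirror_code c'" using mirror_code_surj[OF assms] .
  have b: "s (base c') = s (base c)" unfolding c'(2) by (rule base_mirror_code[symmetric])
  show ?thesis by (rule that[OF c'(1) _ b]) (use b False c'(2) in simp)
qed

lemma arcs_flip: "F.arc_of ` codes = arc_of ` codes"
proof -
  have "F.arc_of ` codes = arc_of ` (\<lambda>c. if s (base c) then c else mirror_code c) ` codes"
    unfolding image_image by (rule image_cong[OF refl arc_of_flip])
  also have "(\<lambda>c. if s (base c) then c else mirror_code c) ` codes = codes"
  proof
    show "(\<lambda>c. if s (base c) then c else mirror_code c) ` codes \<subseteq> codes" using mirror_code_in by auto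
    show "codes \<subseteq> (\<lambda>c. if s (base c) then c else mirror_code c) ` codes"
    proof
      fix c assume "c \<in> codes"
      then obtain c' where "c' \<in> codes" "c = (if s (base c') then c' else mirror_code c')"
        by (rule flip_code_surj)
      then show "c \<in> (\<lambda>c. if s (base c) then c else mirror_code c) ` codes"
        by (intro image_eqI[of _ _ c'])
    qed
  qed
  finally show ?thesis .
qed

lemma flipv_image: "flipv s V ` D = V ` D"
proof
  show "flipv s V ` D \<subseteq> V ` D" by (auto simp: flipv_def)
  show "V ` D \<subseteq> flipv s V ` D"
  proof
    fix v assume "v \<in> V ` D"
    then obtain d where "d \<in> D" "v = V d" by blast
    then have "v = flipv s V (if s d then d else isg d)" "(if s d then d else isg d) \<in> D"
      by (simp_all add: flipv_def invariant_simps[OF s])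
    then show "v \<in> flipv s V ` D" by (rule image_eqI)
  qed
qed

lemma blow_flip: "F.blow = blow"
  using arcs_flip flipv_image[of U] flipv_image[of W] by (simp add: F.blow_def blow_def)

lemma rot_flip: "F.rot = frot s"
proof
  fix a show "F.rot a = frot s a"
  proof (cases "a \<in> arc_of ` codes")
    case False then show ?thesis using arcs_flip by (simp add: F.rot_def frot_def)
  next
    case True
    then obtain c where c: "c \<in> codes" "a = arc_of c" by blast
    obtain c' where c': "c' \<in> codes" "c = (if s (base c') then c' else mirror_code c')" "s (base c') = s (base c)"
      using flip_code_surj[OF c(1)] .
    have cc: "c = (if s (base c) then c' else mirror_code c')" using c'(2) unfolding c'(3) .
    have "F.arc_of c' = a" unfolding c(2) arc_of_flip[OF c'(1)] using c'(2) by (simp only:)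
    then have 1: "F.rot a = F.arc_of (turn_code c')" using F.rot_arc_of[OF c'(1)] by (simp only:)
    have "s (base (turn_code c')) = s (base c)" using c'(3) by (cases c') simp_all
    then have 2: "F.arc_of (turn_code c') = arc_of (if s (base c) then turn_code c' else mirror_code (turn_code c'))"
      using arc_of_flip[of "turn_code c'"] c'(1) by (simp only: codes_simps)
    \<comment> \<open>A reflection conjugates the rotation into its inverse.\<close>
    have 3: "mirror_code (turn_code c') = turn_code (turn_code (mirror_code c'))"
      by (cases c') simp_all
    show ?thesis unfolding 1 2 3 unfolding c(2) frot_arc_of[OF c(1)]
    proof (cases "s (base c)")
      case True
      then have "c = c'" using cc by (simp only: if_True)
      then show "arc_of (if s (base c) then turn_code c' else turn_code (turn_code (mirror_code c'))) =
        arc_of (if s (base c) then turn_code c else turn_code (turn_code c))" using True by simp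
    next
      case False
      then have "c = mirror_code c'" using cc by (simp only: if_False)
      then show "arc_of (if s (base c) then turn_code c' else turn_code (turn_code (mirror_code c'))) =
        arc_of (if s (base c) then turn_code c else turn_code (turn_code c))" using False by (simp only: if_False)
    qed
  qed
qed

lemma embedding_frot: "embedding blow (frot s)"
  using F.embedding blow_flip rot_flip by simp

lemma has_genus_frot: "has_genus blow (frot s) g \<longleftrightarrow> comb_map.genus D (flip s sg) al (int g)"
  using F.has_genus_iff[of g] blow_flip rot_flip by simp

lemma polyhedral_frot: "comb_map.good D (flip s sg) al \<Longrightarrow> polyhedral blow (frot s)"
  using F.polyhedral_if_good blow_flip rot_flip by simp

lemma polyhedral_frot_sides:
  assumes "polyhedral blow (frot s)" "d \<in> D"
  shows "orbit (comb_map.phi (flip s sg) al) d \<noteq> orbit (comb_map.phi (flip s sg) al) (al d)"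
  using F.polyhedral_sides[OF _ assms(2)] assms(1) blow_flip rot_flip by simp

end

lemma frot_eqD:
  assumes "\<forall>e\<in>parcs blow. frot s e = frot s' e" "d \<in> D"
  shows "s d = s' d"
proof -
  have c: "Zz d \<in> codes" "Zr d \<in> codes" "Zw d \<in> codes" using assms(2) by (simp_all add: codes_def)
  have "arc_of (Zr d) \<noteq> arc_of (Zw d)" using inj_onD[OF arc_of_inj _ c(2,3)] by auto
  moreover have "frot s (arc_of (Zz d)) = frot s' (arc_of (Zz d))" using assms(1) c unfolding parcs_blow by blast
  ultimately show ?thesis unfolding frot_arc_of[OF c(1)] by (cases "s d"; cases "s' d"; simp del: arc_of.simps)
qed

text \<open>Equal bits at \<open>Z d\<close> would make one of the two rotations undo itself there,
  but a rotation of order three is no involution.\<close>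

lemma frot_mirror_eqD:
  assumes "invariant s'" "\<forall>e\<in>parcs blow. frot s e = mirror (frot s') e" "d \<in> D"
  shows "s d \<noteq> s' d"
proof
  assume eq: "s d = s' d"
  have c: "Zz d \<in> codes" "Zr d \<in> codes" "Zw d \<in> codes" using assms(3) by (simp_all add: codes_def)
  have "arc_of (Zr d) \<noteq> arc_of (Zw d)" using inj_onD[OF arc_of_inj _ c(2,3)] by auto
  have bij: "bij (frot s')"
    using embedding_frot[OF assms(1)] by (auto simp: embedding_def intro: permutes_bij)
  have "frot s (arc_of (Zz d)) = inv (frot s') (arc_of (Zz d))" using assms(2) c unfolding parcs_blow mirror_def by blast
  then have "frot s' (frot s (arc_of (Zz d))) = arc_of (Zz d)" using bij by (simp add: bij_is_surj surj_f_inv_f)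
  then have "turn_code (turn_code (Zz d)) = Zz d \<or> turn_code (Zz d) = Zz d"
    using eq c inj_onD[OF arc_of_inj _ c(3,1)] inj_onD[OF arc_of_inj _ c(2,1)]
    by (cases "s' d") (simp_all add: frot_arc_of del: arc_of.simps)
  then show False by simp
qed

section \<open>Exhaustion of the polyhedral embeddings\<close>

text \<open>By \<open>pentagon_facial\<close> all corners of a pentagon turn the same way. The
  pentagons of \<open>d\<close> and \<open>sg d\<close> share \<open>U (sg d)\<close> and
  \<open>W (sg d)\<close>, so the direction is constant around a ring and gives one bit for each
  vertex of the map.\<close>

theorem polyhedral_cases:
  assumes poly: "polyhedral blow nx"
  obtains s where "invariant s" "nx = frot s"
proof -
  have emb: "embedding blow nx" using poly by (simp add: polyhedral_def)
  note rc = rotation_cubic[OF cubic emb]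
  \<comment> \<open>\<open>P c\<close> says that the tail of \<open>c\<close> has its intended
    rotation. At a cubic vertex the reversed rotation is the only alternative, so \<open>P\<close>
    does not depend on the arc chosen at the tail.\<close>
  define P where "P c \<longleftrightarrow> nx (arc_of c) = arc_of (turn_code c)" for c
  have arcs: "{e' \<in> parcs blow. fst e' = fst (arc_of c)} = {arc_of c, arc_of (turn_code c), arc_of (turn_code (turn_code c))}"
    if "c \<in> codes" for c
  proof -
    have "{e' \<in> parcs blow. fst e' = v} = out_arcs (with_proj blow) v" for v by (auto simp: out_arcs_def)
    then show ?thesis using that by (cases c) (auto simp: codes_def out_arcs_blow)
  qed
  have ne: "arc_of c \<noteq> arc_of (turn_code c)" "arc_of c \<noteq> arc_of (turn_code (turn_code c))" if "c \<in> codes" for c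
  proof -
    have "c \<noteq> turn_code c" "c \<noteq> turn_code (turn_code c)" by (cases c; simp)+
    then show "arc_of c \<noteq> arc_of (turn_code c)" "arc_of c \<noteq> arc_of (turn_code (turn_code c))"
      using that arc_of_inj by (simp_all add: inj_on_eq_iff)
  qed
  have nx_cases: "nx (arc_of c) = arc_of (turn_code c) \<or> nx (arc_of c) = arc_of (turn_code (turn_code c))"
    if c: "c \<in> codes" for c
  proof -
    have e: "arc_of c \<in> parcs blow" using c by (simp add: parcs_blow)
    have "nx (arc_of c) \<in> {arc_of c, arc_of (turn_code c), arc_of (turn_code (turn_code c))}"
      unfolding arcs[OF c, symmetric] rc(6)[OF e] by blast
    then show ?thesis using rc(3)[OF e] by blast
  qed
  have P_turn: "P (turn_code c)" if c: "c \<in> codes" "P c" for c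
  proof (rule ccontr)
    assume "\<not> P (turn_code c)"
    then have "nx (arc_of (turn_code c)) = arc_of c"
      using nx_cases[of "turn_code c"] c by (simp add: P_def turn_code_3)
    then show False using rc(4)[of "arc_of c"] c by (simp add: P_def parcs_blow)
  qed
  have P_iff: "P (turn_code c) \<longleftrightarrow> P c" if c: "c \<in> codes" for c
    using P_turn[of c] P_turn[of "turn_code c"] P_turn[of "turn_code (turn_code c)"] c by (auto simp: turn_code_3)
  have notP: "\<not> P c" if "c \<in> codes" "nx (arc_of c) = arc_of (turn_code (turn_code c))" for c
    using ne(1)[of "turn_code c"] that by (simp add: P_def)
  define s where "s d \<longleftrightarrow> (if d \<in> D then P (Zz d) else True)" for d
  \<comment> \<open>Everything on the pentagon of \<open>d\<close> is compared with its apex. The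
    statement for \<open>Uw (sg d)\<close> is the link to the next pentagon, which contains this
    vertex as well.\<close>
  have bits: "P (Uw d) = P (Zz d) \<and> P (Uw (sg d)) = P (Zz d) \<and> P (Wz d) = P (Zz d)" if d: "d \<in> D" for d
  proof -
    have cs: "Uw d \<in> codes" "Uw (sg d) \<in> codes" "Ur d \<in> codes" "Ul (sg d) \<in> codes" "Wu d \<in> codes" "Wu (sg d) \<in> codes"
      "Wz d \<in> codes" "Zw d \<in> codes" "Zr d \<in> codes" "Zz d \<in> codes" "Wl (sg d) \<in> codes"
      using d by (simp_all add: codes_def)
    have in_arcs: "(x, y) \<in> parcs blow \<longleftrightarrow> (\<exists>c\<in>codes. arc_of c = (x, y))" for x y unfolding parcs_blow image_iff by (metis (no_types))
    have non: "(U d, W (sg d)) \<notin> parcs blow" "(U (sg d), Z d) \<notin> parcs blow" "(W (sg d), W d) \<notin> parcs blow"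
      "(Z d, U d) \<notin> parcs blow" "(W d, U (sg d)) \<notin> parcs blow"
    proof -
      have "False" if "c \<in> codes" "arc_of c = (U d, W (sg d)) \<or> arc_of c = (U (sg d), Z d) \<or> arc_of c = (W (sg d), W d)
        \<or> arc_of c = (Z d, U d) \<or> arc_of c = (W d, U (sg d))" for c
        using that d by (cases c) (auto simp: codes_def sg_neq not_sym[OF sg_neq])
      then show "(U d, W (sg d)) \<notin> parcs blow" "(U (sg d), Z d) \<notin> parcs blow" "(W (sg d), W d) \<notin> parcs blow"
        "(Z d, U d) \<notin> parcs blow" "(W d, U (sg d)) \<notin> parcs blow" unfolding in_arcs by blast+
    qed
    have arcs5: "(U d, U (sg d)) \<in> parcs blow" "(U (sg d), W (sg d)) \<in> parcs blow" "(W (sg d), Z d) \<in> parcs blow"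
      "(Z d, W d) \<in> parcs blow" "(W d, U d) \<in> parcs blow"
      using cs(2,3,5,8,11)[THEN imageI[of _ _ arc_of]] by (simp_all add: parcs_blow)
    note pent = pentagon_facial[OF cubic emb poly arcs5 non, unfolded turn_def[OF cubic emb]]
    have 3: "P (Ur d) = P (Uw d)" "P (Wu (sg d)) = P (Wz (sg d))" "P (Zr d) = P (Zz d)" "P (Zw d) = P (Zz d)"
      "P (Wu d) = P (Wz d)" "P (Ul (sg d)) = P (Uw (sg d))"
      using P_iff[of "Uw d"] P_iff[of "Wz (sg d)"] P_iff[of "Zz d"] P_iff[of "Zr d"] P_iff[of "Wz d"]
        P_iff[of "Ul (sg d)"] cs d by (simp_all add: codes_def)
    from pent show ?thesis
    proof
      assume "nx (U (sg d), U d) = (U (sg d), W (sg d)) \<and> nx (W (sg d), U (sg d)) = (W (sg d), Z d) \<and>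
        nx (Z d, W (sg d)) = (Z d, W d) \<and> nx (W d, Z d) = (W d, U d) \<and> nx (U d, W d) = (U d, U (sg d))"
      then have "P (Ul (sg d))" "P (Zr d)" "P (Wz d)" "P (Uw d)" by (simp_all add: P_def)
      then show ?thesis using 3 by simp
    next
      assume "nx (U (sg d), W (sg d)) = (U (sg d), U d) \<and> nx (W (sg d), Z d) = (W (sg d), U (sg d)) \<and>
        nx (Z d, W d) = (Z d, W (sg d)) \<and> nx (W d, U d) = (W d, Z d) \<and> nx (U d, U (sg d)) = (U d, W d)"
      then have "\<not> P (Uw (sg d))" "\<not> P (Zw d)" "\<not> P (Wu d)" "\<not> P (Ur d)"
        using cs by (simp_all add: notP)
      then show ?thesis using 3 by simp
    qed
  qed
  have "invariant s"
  proof (rule invariantI)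
    fix d assume "d \<in> D"
    then have "P (Uw (sg d)) = P (Zz d)" "P (Uw (sg d)) = P (Zz (sg d))" using bits[of d] bits[of "sg d"] by simp_all
    then show "s (sg d) = s d" using \<open>d \<in> D\<close> by (simp add: s_def)
  qed
  moreover have "nx = frot s"
  proof
    fix a show "nx a = frot s a"
    proof (cases "a \<in> arc_of ` codes")
      case False
      then show ?thesis using emb permutes_not_in[of nx "parcs blow" a] by (simp add: frot_def embedding_def parcs_blow)
    next
      case True
      then obtain c where c: "c \<in> codes" "a = arc_of c" by blast
      have b: "base c \<in> D" using c by (simp add: codes_def)
      have cs: "Uw (base c) \<in> codes" "Wz (base c) \<in> codes" "Zz (base c) \<in> codes"
        "Ur (base c) \<in> codes" "Wu (base c) \<in> codes" "Zr (base c) \<in> codes"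
        using b by (simp_all add: codes_def)
      have "P c = P (Zz (base c))"
        using bits[OF b] cs[THEN P_iff] by (cases c) simp_all
      then have "P c = s (base c)" using b by (simp add: s_def)
      then show ?thesis using c nx_cases[OF c(1)] by (auto simp: frot_arc_of P_def)
    qed
  qed
  ultimately show ?thesis by (rule that)
qed

end

section \<open>Merging maps at marked corners\<close>

text \<open>The orbits of the points \<open>q k i\<close> under \<open>f i\<close>, for all \<open>i\<close>, are spliced into one orbit of \<open>F\<close>:
  instead of closing up at \<open>q k i\<close>, the orbit continues in the copy \<open>c k i\<close>.\<close>

locale orbit_merge =
  fixes n p :: nat and D :: "nat \<Rightarrow> 'a set" and f :: "nat \<Rightarrow> 'a \<Rightarrow> 'a"
    and q :: "nat \<Rightarrow> nat \<Rightarrow> 'a" and c :: "nat \<Rightarrow> nat \<Rightarrow> nat" and F :: "nat \<times> 'a \<Rightarrow> nat \<times> 'a"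
  assumes n: "n > 0" and finD: "i < n \<Longrightarrow> finite (D i)" and bij: "i < n \<Longrightarrow> bij_betw (f i) (D i) (D i)"
    and q_in: "k < p \<Longrightarrow> i < n \<Longrightarrow> q k i \<in> D i"
    and q_orbits: "k < p \<Longrightarrow> l < p \<Longrightarrow> i < n \<Longrightarrow> q l i \<in> orbit (f i) (q k i) \<Longrightarrow> l = k"
    and c_in: "k < p \<Longrightarrow> i < n \<Longrightarrow> c k i < n"
    and c_trans: "k < p \<Longrightarrow> J \<subseteq> {..<n} \<Longrightarrow> J \<noteq> {} \<Longrightarrow> (\<And>i. i \<in> J \<Longrightarrow> c k i \<in> J) \<Longrightarrow> J = {..<n}"
    and F_bij: "bij_betw F (SIGMA i:{..<n}. D i) (SIGMA i:{..<n}. D i)"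
    and F_other: "i < n \<Longrightarrow> d \<in> D i \<Longrightarrow> (\<And>k. k < p \<Longrightarrow> d \<noteq> q k i) \<Longrightarrow> F (i, d) = (i, f i d)"
    and F_mark: "i < n \<Longrightarrow> k < p \<Longrightarrow> F (i, q k i) = (c k i, f (c k i) (q k (c k i)))"
begin

abbreviation "E \<equiv> SIGMA i:{..<n}. D i"

definition merged :: "nat \<Rightarrow> (nat \<times> 'a) set" where
  "merged k = (SIGMA j:{..<n}. orbit (f j) (q k j))"

lemma finE: "finite E"
  using finD by auto

lemmas o_self = bij_orbit_self[OF finD bij] and o_sub = bij_orbit_subset[OF bij] and o_eq = bij_orbit_eq[OF finD bij]

lemma in_own_orbit: "k < p \<Longrightarrow> i < n \<Longrightarrow> q k i \<in> orbit (f i) (q k i)"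
  using o_self[of i "q k i"] q_in by simp

lemma orbit_unmarked:
  assumes "i < n" "d \<in> D i" "\<And>k. k < p \<Longrightarrow> q k i \<notin> orbit (f i) d"
  shows "orbit F (i, d) = Pair i ` orbit (f i) d"
proof (rule orbit_inverse[symmetric])
  show "d \<in> orbit (f i) d" using o_self assms by blast
  show "F (i, x) = (i, f i x)" if "x \<in> orbit (f i) d" for x
    using that assms o_sub[OF assms(1,2)] by (intro F_other) auto
qed

lemma F_in_merged:
  assumes "k < p" "x \<in> merged k"
  shows "F x \<in> merged k"
proof -
  obtain j y where x: "x = (j, y)" "j < n" "y \<in> orbit (f j) (q k j)" using assms(2) by (auto simp: merged_def)
  show ?thesis
  proof (cases "y = q k j")
    case True
    then have "F x = (c k j, f (c k j) (q k (c k j)))" using F_mark[OF x(2) assms(1)] x(1) by simp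
    then show ?thesis using c_in[OF assms(1) x(2)] by (auto simp: merged_def intro: orbit.base)
  next
    case False
    have "y \<noteq> q l j" if "l < p" for l using q_orbits[OF assms(1) that x(2)] x(3) False by auto
    moreover have "y \<in> D j" using x o_sub[OF x(2) q_in[OF assms(1) x(2)]] by blast
    ultimately have "F x = (j, f j y)" using F_other[OF x(2)] x(1) by simp
    then show ?thesis using x by (auto simp: merged_def intro: orbit.step)
  qed
qed

text \<open>A walk that starts behind the marked point of a copy covers the whole orbit there before
  it reaches the marked point and jumps. The copies that are entered thus form a set closed under
  \<open>c k\<close>, and \<open>c_trans\<close> makes this set everything.\<close>

lemma orbit_start:
  assumes k: "k < p" and i: "i < n"
  shows "orbit F (i, f i (q k i)) = merged k"
proof
  let ?x = "(i, f i (q k i))"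
  have xm: "?x \<in> merged k" using i by (auto simp: merged_def intro: orbit.base)
  show "orbit F ?x \<subseteq> merged k"
  proof
    fix x assume "x \<in> orbit F ?x"
    then show "x \<in> merged k" by induct (use F_in_merged[OF k] xm in auto)
  qed
  have xE: "?x \<in> E" using i k q_in o_sub[OF i q_in[OF k i]] orbit.base[of "f i" "q k i"] by auto
  have whole: "(j, y) \<in> orbit F ?x" if "(j, f j (q k j)) \<in> orbit F ?x" "j < n" "y \<in> orbit (f j) (q k j)" for j y
    using that(3)
  proof induction
    case base then show ?case using that(1) .
  next
    case (step y)
    show ?case
    proof (cases "y = q k j")
      case True then show ?thesis using that(1) by simp
    next
      case False
      have "y \<noteq> q l j" if "l < p" for l using q_orbits[OF k that \<open>j < n\<close>] step(1) False by auto
      moreover have "y \<in> D j" using step(1) o_sub[OF \<open>j < n\<close> q_in[OF k \<open>j < n\<close>]] by blast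
      ultimately have "F (j, y) = (j, f j y)" using F_other[OF \<open>j < n\<close>] by simp
      then show ?thesis using orbit.step[OF step(2)] by simp
    qed
  qed
  define J where "J = {j \<in> {..<n}. (j, f j (q k j)) \<in> orbit F ?x}"
  have "J = {..<n}"
  proof (rule c_trans[OF k])
    have "i \<in> J" using bij_orbit_self[OF finE F_bij xE] i by (simp add: J_def)
    then show "J \<noteq> {}" by blast
    fix j assume "j \<in> J"
    then have j: "j < n" "(j, f j (q k j)) \<in> orbit F ?x" by (simp_all add: J_def)
    have "(j, q k j) \<in> orbit F ?x" using whole[OF j(2,1) in_own_orbit[OF k j(1)]] .
    then have "F (j, q k j) \<in> orbit F ?x" by (rule orbit.step)
    then show "c k j \<in> J" using F_mark[OF j(1) k] c_in[OF k j(1)] by (simp add: J_def)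
  qed (auto simp: J_def)
  then have "(j, f j (q k j)) \<in> orbit F ?x" if "j < n" for j
  proof -
    have "j \<in> J" using that \<open>J = {..<n}\<close> by simp
    then show ?thesis by (simp add: J_def)
  qed
  then show "merged k \<subseteq> orbit F ?x" using whole by (auto simp: merged_def)
qed

lemma orbit_marked:
  assumes "i < n" "d \<in> D i" "k < p" "q k i \<in> orbit (f i) d"
  shows "orbit F (i, d) = merged k"
proof -
  have xE: "(i, f i (q k i)) \<in> E"
    using assms(1,3) o_sub[OF assms(1) q_in[OF assms(3,1)]] orbit.base[of "f i" "q k i"] by auto
  have "orbit (f i) (q k i) = orbit (f i) d" using o_eq[OF assms(1) assms(1) assms(2,4)] .
  then have "(i, d) \<in> merged k" using o_self[OF assms(1) assms(1,2)] assms(1) by (simp add: merged_def)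
  then show ?thesis using bij_orbit_eq[OF finE F_bij xE, of "(i, d)"] orbit_start[OF assms(3,1)] by simp
qed

definition marked :: "nat \<Rightarrow> 'a \<Rightarrow> bool" where
  "marked i d \<longleftrightarrow> (\<exists>k<p. q k i \<in> orbit (f i) d)"

lemma merged_sym:
  assumes "k < p" "l < p" "merged k = merged l"
  shows "k = l"
proof -
  have "(0, q k 0) \<in> merged l" using assms(3) in_own_orbit[OF assms(1) n] n by (auto simp: merged_def)
  then show ?thesis using q_orbits[OF assms(2,1) n] by (simp add: merged_def)
qed

text \<open>Distinct unmarked orbits stay distinct, so an identification needs marks on both sides.
  Which marks these are is left open here and recovered by \<open>merged_sym\<close> where it
  matters.\<close>

lemma orbit_eqD:
  assumes "i < n" "d \<in> D i" "j < n" "e \<in> D j" "orbit F (i, d) = orbit F (j, e)"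
  shows "(i = j \<and> orbit (f i) d = orbit (f j) e) \<or> (marked i d \<and> marked j e)"
proof -
  have *: "marked j e \<Longrightarrow> \<exists>k<p. orbit F (j, e) = merged k" if "j < n" "e \<in> D j" for j e
    using orbit_marked that unfolding marked_def by blast
  have **: "\<not> marked j e \<Longrightarrow> orbit F (j, e) = Pair j ` orbit (f j) e" if "j < n" "e \<in> D j" for j e
    using orbit_unmarked that unfolding marked_def by blast
  have no: False if "k < p" "j < n" "e \<in> D j" "\<not> marked j e" "merged k = Pair j ` orbit (f j) e" for k j e
  proof -
    have "(j, q k j) \<in> merged k" using in_own_orbit[OF that(1,2)] that(2) by (simp add: merged_def)
    then show False using that by (auto simp: marked_def)
  qed
  show ?thesis
  proof (cases "marked i d"; cases "marked j e")
    assume "\<not> marked i d" "\<not> marked j e"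
    then have eq: "Pair i ` orbit (f i) d = Pair j ` orbit (f j) e" using ** assms by simp
    then have "i = j" using orbit_nonempty[of "f i" d] by auto
    then have "orbit (f i) d = orbit (f j) e" using eq by (auto simp: image_iff)
    then show ?thesis using \<open>i = j\<close> by simp
  next
    assume "marked i d" "\<not> marked j e"
    then show ?thesis using *[of i d] **[of j e] no[of _ j e] assms by metis
  next
    assume "\<not> marked i d" "marked j e"
    then show ?thesis using *[of j e] **[of i d] no[of _ i d] assms by metis
  qed auto
qed

lemma orbit_eq_same:
  assumes "i < n" "d \<in> D i" "e \<in> D i" "orbit (f i) d = orbit (f i) e"
  shows "orbit F (i, d) = orbit F (i, e)"
proof (cases "marked i d")
  case True
  then obtain k where "k < p" "q k i \<in> orbit (f i) d" by (auto simp: marked_def)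
  then show ?thesis using orbit_marked assms by metis
next
  case False
  then show ?thesis using orbit_unmarked[OF assms(1,2)] orbit_unmarked[OF assms(1,3)] assms(4)
    by (auto simp: marked_def)
qed

text \<open>For each of the \<open>p\<close> marks, one orbit from every copy is absorbed into a
  single one. The count is over the integers to allow the subtraction.\<close>

lemma card_orbits:
  "int (card (orbit F ` E)) = (\<Sum>i<n. int (card (orbit (f i) ` D i)) - int p) + int p"
proof -
  define M where "M i = (\<lambda>k. orbit (f i) (q k i)) ` {..<p}" for i
  define R where "R i = image (Pair i) ` (orbit (f i) ` D i - M i)" for i
  have M_iff: "marked i d \<longleftrightarrow> orbit (f i) d \<in> M i" if "i < n" "d \<in> D i" for i d
  proof
    assume "marked i d"
    then obtain k where "k < p" "q k i \<in> orbit (f i) d" by (auto simp: marked_def)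
    then show "orbit (f i) d \<in> M i" using o_eq[OF that(1) that(1,2)] by (auto simp: M_def)
  next
    assume "orbit (f i) d \<in> M i"
    then obtain k where "k < p" "orbit (f i) d = orbit (f i) (q k i)" by (auto simp: M_def)
    then show "marked i d" using in_own_orbit[of k i] that by (auto simp: marked_def)
  qed
  have eq: "orbit F ` E = merged ` {..<p} \<union> (\<Union>i<n. R i)"
  proof
    show "orbit F ` E \<subseteq> merged ` {..<p} \<union> (\<Union>i<n. R i)"
    proof
      fix Q assume "Q \<in> orbit F ` E"
      then obtain i d where id: "i < n" "d \<in> D i" "Q = orbit F (i, d)" by auto
      show "Q \<in> merged ` {..<p} \<union> (\<Union>i<n. R i)"
      proof (cases "marked i d")
        case True
        then obtain k where "k < p" "q k i \<in> orbit (f i) d" by (auto simp: marked_def)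
        then show ?thesis using orbit_marked[OF id(1,2)] id(3) by blast
      next
        case False
        then have "Q = Pair i ` orbit (f i) d" using orbit_unmarked[OF id(1,2)] id(3) by (auto simp: marked_def)
        then have "Q \<in> R i" using False M_iff[OF id(1,2)] id(2) unfolding R_def by blast
        then show ?thesis using id(1) by blast
      qed
    qed
    have "merged k \<in> orbit F ` E" if "k < p" for k
      using orbit_marked[OF n q_in[OF that n] that in_own_orbit[OF that n]] q_in[OF that n] n
      by (auto intro!: image_eqI[of _ _ "(0, q k 0)"])
    moreover have "Q \<in> orbit F ` E" if "i < n" "Q \<in> R i" for i Q
    proof -
      obtain d where d: "d \<in> D i" "orbit (f i) d \<notin> M i" "Q = Pair i ` orbit (f i) d"
        using \<open>Q \<in> R i\<close> by (auto simp: R_def)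
      then have "\<not> marked i d" using M_iff[OF that(1)] by simp
      then have "Q = orbit F (i, d)" using orbit_unmarked[OF that(1) d(1)] d(3) by (auto simp: marked_def)
      moreover have "(i, d) \<in> E" using d that by simp
      ultimately show ?thesis by blast
    qed
    ultimately show "merged ` {..<p} \<union> (\<Union>i<n. R i) \<subseteq> orbit F ` E" by blast
  qed
  have inj: "inj_on (image (Pair i)) A" for i :: nat and A :: "'a set set"
    by (auto intro!: inj_onI simp: inj_image_eq_iff inj_def)
  have finR: "finite (R i)" if "i < n" for i using finD[OF that] by (simp add: R_def)
  have cardM: "card (M i) = p" if "i < n" for i
  proof -
    have "inj_on (\<lambda>k. orbit (f i) (q k i)) {..<p}"
      using q_orbits in_own_orbit that by (intro inj_onI) (metis lessThan_iff)
    then show ?thesis by (simp add: M_def card_image)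
  qed
  have cardR: "int (card (R i)) = int (card (orbit (f i) ` D i)) - int p" if "i < n" for i
  proof -
    have sub: "M i \<subseteq> orbit (f i) ` D i" using q_in[OF _ that] by (auto simp: M_def)
    have fo: "finite (orbit (f i) ` D i)" using finD[OF that] by simp
    have "card (R i) = card (orbit (f i) ` D i - M i)" unfolding R_def by (rule card_image[OF inj])
    also have "\<dots> = card (orbit (f i) ` D i) - p"
      using card_Diff_subset[OF finite_subset[OF sub fo] sub] cardM[OF that] by simp
    finally show ?thesis using card_mono[OF fo sub] cardM[OF that] by simp
  qed
  have "card (\<Union>i<n. R i) = (\<Sum>i<n. card (R i))"
  proof (rule card_UN_disjoint)
    show "\<forall>i\<in>{..<n}. \<forall>j\<in>{..<n}. i \<noteq> j \<longrightarrow> R i \<inter> R j = {}"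
    proof (intro ballI impI)
      fix i j :: nat assume "i \<noteq> j"
      have False if "Q \<in> R i" "Q \<in> R j" for Q
      proof -
        obtain d where "Q = Pair i ` orbit (f i) d" using \<open>Q \<in> R i\<close> by (auto simp: R_def)
        moreover obtain e where "Q = Pair j ` orbit (f j) e" using \<open>Q \<in> R j\<close> by (auto simp: R_def)
        ultimately show False using orbit_nonempty[of "f i" d] \<open>i \<noteq> j\<close> by auto
      qed
      then show "R i \<inter> R j = {}" by blast
    qed
  qed (use finR in auto)
  moreover have "card (merged ` {..<p}) = p"
    using card_image[of merged "{..<p}"] merged_sym by (simp add: inj_on_def)
  moreover have "merged ` {..<p} \<inter> (\<Union>i<n. R i) = {}"
  proof -
    have False if "k < p" "i < n" "merged k \<in> R i" for k i
    proof -
      obtain d where d: "d \<in> D i" "orbit (f i) d \<notin> M i" "merged k = Pair i ` orbit (f i) d"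
        using \<open>merged k \<in> R i\<close> by (auto simp: R_def)
      have "(i, q k i) \<in> merged k" using in_own_orbit[OF that(1,2)] that(2) by (simp add: merged_def)
      then have "marked i d" using d that by (auto simp: marked_def)
      then show False using M_iff[OF that(2) d(1)] d(2) by simp
    qed
    then show ?thesis by blast
  qed
  moreover have "finite (\<Union>i<n. R i)" using finR by auto
  ultimately have "card (orbit F ` E) = p + (\<Sum>i<n. card (R i))"
    unfolding eq by (subst card_Un_disjoint) auto
  then show ?thesis using cardR by simp
qed

end

section \<open>Splicing copies of maps at marked vertices\<close>

text \<open>The marks are the darts below \<open>p\<close> in every copy, and
  \<open>mark_orbits\<close> puts them at different vertices; so the copies are spliced mark by
  mark.\<close>

locale merged_map =
  fixes n p :: nat and D :: "nat \<Rightarrow> nat set" and sg al :: "nat \<Rightarrow> nat \<Rightarrow> nat"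
  assumes n: "n > 0" and p: "p > 0"
    and base_map: "i < n \<Longrightarrow> comb_map (D i) (sg i) (al i)"
    and mark_in: "k < p \<Longrightarrow> i < n \<Longrightarrow> k \<in> D i"
    and mark_orbits: "k < p \<Longrightarrow> l < p \<Longrightarrow> i < n \<Longrightarrow> l \<in> orbit (sg i) k \<Longrightarrow> l = k"
begin

definition E :: "(nat \<times> nat) set" where
  "E = (SIGMA i:{..<n}. D i)"

definition nxt :: "nat \<Rightarrow> nat" where
  "nxt i = (if Suc i = n then 0 else Suc i)"

definition prv :: "nat \<Rightarrow> nat" where
  "prv i = (if i = 0 then n - 1 else i - 1)"

lemma nxt_prv [simp]: "i < n \<Longrightarrow> nxt i < n" "i < n \<Longrightarrow> prv i < n" "i < n \<Longrightarrow> nxt (prv i) = i" "i < n \<Longrightarrow> prv (nxt i) = i"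
  by (auto simp: nxt_def prv_def)

lemma nxt_trans:
  assumes "J \<subseteq> {..<n}" "J \<noteq> {}" "\<And>i. i \<in> J \<Longrightarrow> nxt i \<in> J"
  shows "J = {..<n}"
proof -
  have up: "j \<in> J" if "i \<in> J" "i \<le> j" "j < n" for i j
    using that(2,3)
  proof (induction j rule: dec_induct)
    case base then show ?case using that(1) by simp
  next
    case (step m) then show ?case using assms(3)[of m] by (simp add: nxt_def)
  qed
  obtain i where "i \<in> J" "i < n" using assms(1,2) by auto
  then have "n - 1 \<in> J" using up[of i "n - 1"] by simp
  then have "0 \<in> J" using assms(3)[of "n - 1"] n by (simp add: nxt_def)
  then show ?thesis using up[of 0] assms(1) by auto
qed

lemma prv_trans:
  assumes "J \<subseteq> {..<n}" "J \<noteq> {}" "\<And>i. i \<in> J \<Longrightarrow> prv i \<in> J"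
  shows "J = {..<n}"
proof -
  have down: "i \<in> J" if "j \<in> J" "i \<le> j" for i j
    using that(2)
  proof (induction i rule: inc_induct)
    case base then show ?case using that(1) by simp
  next
    case (step m) then show ?case using assms(3)[of "Suc m"] by (simp add: prv_def)
  qed
  obtain i where "i \<in> J" using assms(2) by auto
  then have "0 \<in> J" using down[of i 0] by simp
  then have "n - 1 \<in> J" using assms(3)[of 0] by (simp add: prv_def)
  then show ?thesis using down[of "n - 1"] assms(1) n by (auto simp: less_eq_Suc_le)
qed

text \<open>For every mark \<open>k\<close> the vertices carrying \<open>k\<close> are merged into one vertex: their rotations
  are cut open behind the dart \<open>k\<close> and concatenated along the cyclic order of the copies.\<close>

definition msg :: "nat \<times> nat \<Rightarrow> nat \<times> nat" where
  "msg x = (case x of (i, d) \<Rightarrow>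
    if i < n \<and> d \<in> D i then if d < p then (nxt i, sg (nxt i) d) else (i, sg i d) else (i, d))"

definition mal :: "nat \<times> nat \<Rightarrow> nat \<times> nat" where
  "mal x = (fst x, al (fst x) (snd x))"

lemma msg_simps:
  "i < n \<Longrightarrow> k < p \<Longrightarrow> msg (i, k) = (nxt i, sg (nxt i) k)"
  "i < n \<Longrightarrow> d \<in> D i \<Longrightarrow> \<not> d < p \<Longrightarrow> msg (i, d) = (i, sg i d)"
  "(i, d) \<notin> E \<Longrightarrow> msg (i, d) = (i, d)"
  using mark_in by (auto simp: msg_def E_def)

lemma base_simps [simp]:
  assumes "i < n"
  shows "sg i d \<in> D i \<longleftrightarrow> d \<in> D i" "inv (sg i) d \<in> D i \<longleftrightarrow> d \<in> D i" "sg i (inv (sg i) d) = d"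
    "inv (sg i) (sg i d) = d" "sg i d = sg i e \<longleftrightarrow> d = e"
    "d \<in> D i \<Longrightarrow> al i d \<in> D i" "d \<in> D i \<Longrightarrow> al i (al i d) = d"
proof -
  interpret comb_map "D i" "sg i" "al i" using base_map[OF assms] .
  show "sg i d \<in> D i \<longleftrightarrow> d \<in> D i" "inv (sg i) d \<in> D i \<longleftrightarrow> d \<in> D i" "sg i (inv (sg i) d) = d"
    "inv (sg i) (sg i d) = d" "sg i d = sg i e \<longleftrightarrow> d = e"
    "d \<in> D i \<Longrightarrow> al i d \<in> D i" "d \<in> D i \<Longrightarrow> al i (al i d) = d" by simp_all
qed

lemma msg_permutes: "msg permutes E"
proof (rule bij_imp_permutes)
  define minv where "minv x = (case x of (i, e) \<Rightarrow>
    let d = inv (sg i) e in if d < p then (prv i, d) else (i, d))" for x :: "nat \<times> nat"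
  show "bij_betw msg E E"
  proof (rule bij_betwI[where g = minv])
    show "msg \<in> E \<rightarrow> E" using mark_in by (auto simp: E_def msg_def)
    show "minv \<in> E \<rightarrow> E" using mark_in by (auto simp: E_def minv_def Let_def)
    show "minv (msg x) = x" if "x \<in> E" for x
      using that by (auto simp: E_def msg_def minv_def Let_def)
    show "msg (minv x) = x" if "x \<in> E" for x
      using that mark_in by (auto simp: E_def msg_def minv_def Let_def)
  qed
qed (auto simp: msg_simps)

lemma inv_msg:
  assumes "i < n" "d \<in> D i" "msg (i, d) = y"
  shows "inv msg y = (i, d)"
  using permutes_inverses(2)[OF msg_permutes, of "(i, d)"] assms(3) by simp

lemma msg_bij: "bij_betw msg (SIGMA i:{..<n}. D i) (SIGMA i:{..<n}. D i)"
  using permutes_imp_bij[OF msg_permutes] by (simp add: E_def)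

sublocale V: orbit_merge n p D sg "\<lambda>k i. k" "\<lambda>k. nxt" msg
proof
  fix i assume i: "i < n"
  interpret comb_map "D i" "sg i" "al i" using base_map[OF i] .
  show "finite (D i)" "bij_betw (sg i) (D i) (D i)" using fin sg_bij by auto
  show "msg (i, d) = (i, sg i d)" if "d \<in> D i" "\<And>k. k < p \<Longrightarrow> d \<noteq> k" for d
    using msg_simps(2)[OF i that(1)] that(2)[of d] by blast
qed (use n mark_in mark_orbits nxt_trans msg_bij msg_simps(1) in auto)

sublocale M: comb_map E msg mal
proof
  show "finite E" using V.finE by (simp add: E_def)
  show "E \<noteq> {}" using n p mark_in[of 0 0] by (auto simp: E_def)
  show "msg permutes E" by (rule msg_permutes)
  fix x
  assume "x \<in> E"
  then obtain i d where x: "x = (i, d)" "i < n" "d \<in> D i" by (auto simp: E_def)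
  interpret comb_map "D i" "sg i" "al i" using base_map[OF x(2)] .
  show "mal x \<in> E" "mal (mal x) = x" "mal x \<noteq> x" using x al_neq by (auto simp: mal_def E_def)
  \<comment> \<open>The successor of a mark is at the same vertex and hence no mark, so two steps of
    \<open>msg\<close> change the copy at most once.\<close>
  have nd: "sg j k \<noteq> k" "sg j (sg j k) \<noteq> k" "\<not> sg j k < p" if "k < p" "j < n" for j k
  proof -
    interpret J: comb_map "D j" "sg j" "al j" using base_map[OF that(2)] .
    show "sg j k \<noteq> k" "sg j (sg j k) \<noteq> k" using J.sg_neq J.sg_sg_neq mark_in that by auto
    then show "\<not> sg j k < p" using mark_orbits[OF that(1) _ that(2), of "sg j k"] orbit.base[of "sg j" k] by auto
  qed
  show "msg x \<noteq> x"
    using x sg_neq nd by (cases "d < p") (auto simp: msg_simps)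
  show "msg (msg x) \<noteq> x"
  proof (cases "d < p")
    case True
    have "sg (nxt i) d \<in> D (nxt i)" using mark_in[OF True, of "nxt i"] x by simp
    then have "msg (msg x) = (nxt i, sg (nxt i) (sg (nxt i) d))"
      using x True nd(3)[OF True, of "nxt i"] by (simp add: msg_simps)
    then show ?thesis using x nd(2)[OF True, of "nxt i"] by auto
  next
    case False
    have "sg i d \<in> D i" using x by simp
    show ?thesis
    proof (cases "sg i d < p")
      case True
      then have m: "msg (msg x) = (nxt i, sg (nxt i) (sg i d))" using x False by (simp add: msg_simps)
      show ?thesis
      proof
        assume "msg (msg x) = x"
        then have "nxt i = i" "sg i (sg i d) = d" using m x by auto
        then show False using sg_sg_neq[OF x(3)] by simp
      qed
    next
      case False
      then show ?thesis using x \<open>\<not> d < p\<close> \<open>sg i d \<in> D i\<close> sg_sg_neq by (simp add: msg_simps)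
    qed
  qed
next
  fix S assume S: "S \<subseteq> E" "S \<noteq> {}" "\<And>d. d \<in> S \<Longrightarrow> msg d \<in> S" "\<And>d. d \<in> S \<Longrightarrow> mal d \<in> S"
  have orb: "y \<in> S" if "x \<in> S" "y \<in> orbit msg x" for x y
    using that(2) by induct (use S(3) that(1) in auto)
  have whole: "D i = {d. (i, d) \<in> S}" if i: "i < n" and ne: "\<exists>d. (i, d) \<in> S" for i
  proof -
    interpret comb_map "D i" "sg i" "al i" using base_map[OF i] .
    have "{d. (i, d) \<in> S} = D i"
    proof (rule conn)
      show "{d. (i, d) \<in> S} \<subseteq> D i" using S(1) by (auto simp: E_def)
      show "{d. (i, d) \<in> S} \<noteq> {}" using ne by blast
      fix d assume "d \<in> {d. (i, d) \<in> S}"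
      then have d: "(i, d) \<in> S" by simp
      then have dD: "d \<in> D i" using S(1) by (auto simp: E_def)
      show "al i d \<in> {d. (i, d) \<in> S}" using S(4)[OF d] by (simp add: mal_def)
      show "sg i d \<in> {d. (i, d) \<in> S}"
      \<comment> \<open>At a mark \<open>msg\<close> leaves the copy, but its orbit is the whole
        merged vertex and so contains the successor inside the copy as well.\<close>
      proof (cases "d < p")
        case True
        have "orbit msg (i, d) = V.merged d" using V.orbit_marked[OF i dD True] V.o_self[OF i i dD] by simp
        then have "(i, sg i d) \<in> orbit msg (i, d)" using i orbit.base[of "sg i" d] by (simp add: V.merged_def)
        then show ?thesis using orb[OF d] by simp
      next
        case False
        then show ?thesis using S(3)[OF d] msg_simps(2)[OF i dD] by simp
      qed
    qed
    then show ?thesis by simp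
  qed
  define J where "J = {i \<in> {..<n}. \<exists>d. (i, d) \<in> S}"
  have "J = {..<n}"
  proof (rule nxt_trans)
    show "J \<noteq> {}" using S(1,2) by (auto simp: J_def E_def)
    fix i assume "i \<in> J"
    then have i: "i < n" "\<exists>d. (i, d) \<in> S" by (auto simp: J_def)
    then have "(i, 0) \<in> S" using whole[OF i] mark_in[OF p i(1)] by blast
    then have "msg (i, 0) \<in> S" by (rule S(3))
    then show "nxt i \<in> J" using i p by (auto simp: J_def msg_simps)
  qed (auto simp: J_def)
  then have "\<exists>d. (i, d) \<in> S" if "i < n" for i using that unfolding J_def by blast
  then have "E \<subseteq> S" using whole by (auto simp: E_def)
  then show "S = E" using S(1) by blast
qed

section \<open>Faces of the spliced map under flips\<close>

definition fphi :: "(nat \<times> nat \<Rightarrow> bool) \<Rightarrow> nat \<Rightarrow> nat \<Rightarrow> nat" where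
  "fphi s i = comb_map.phi (flip (\<lambda>d. s (i, d)) (sg i)) (al i)"

text \<open>The dart preceding the marked corner \<open>k\<close> on the face through this corner.\<close>

definition fmark :: "(nat \<times> nat \<Rightarrow> bool) \<Rightarrow> nat \<Rightarrow> nat \<Rightarrow> nat" where
  "fmark s k i = al i (if s (i, k) then k else sg i k)"

text \<open>Flips that extend to the spliced map: constant on the vertices of each copy, equal at
  vertices that are merged, and such that different marks lie on different faces, as
  \<open>orbit_merge\<close> demands for the faces.\<close>

definition compatible :: "(nat \<times> nat \<Rightarrow> bool) \<Rightarrow> bool" where
  "compatible s \<longleftrightarrow> (\<forall>i<n. comb_map.invariant (sg i) (\<lambda>d. s (i, d))) \<and> (\<forall>i<n. \<forall>k<p. s (i, k) = s (0, k)) \<and>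
    (\<forall>i<n. \<forall>k<p. \<forall>l<p. fmark s l i \<in> orbit (fphi s i) (fmark s k i) \<longrightarrow> l = k)"

context
  fixes s assumes comp: "compatible s"
begin

lemma compatibleD:
  "i < n \<Longrightarrow> comb_map.invariant (sg i) (\<lambda>d. s (i, d))" "i < n \<Longrightarrow> k < p \<Longrightarrow> s (i, k) = s (0, k)"
  "i < n \<Longrightarrow> k < p \<Longrightarrow> l < p \<Longrightarrow> fmark s l i \<in> orbit (fphi s i) (fmark s k i) \<Longrightarrow> l = k"
  using comp unfolding compatible_def by blast+

lemma s_sg:
  assumes "i < n"
  shows "s (i, sg i d) = s (i, d)" "s (i, inv (sg i) d) = s (i, d)"
  using comb_map.invariant_simps[OF base_map[OF assms] compatibleD(1)[OF assms]] by auto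

lemma invariant_compatible: "M.invariant s"
proof (rule M.invariantI)
  fix x assume "x \<in> E"
  then obtain i d where x: "x = (i, d)" "i < n" "d \<in> D i" by (auto simp: E_def)
  show "s (msg x) = s x"
  proof (cases "d < p")
    case True
    have "s (nxt i, d) = s (i, d)" using compatibleD(2)[OF x(2) True] compatibleD(2)[of "nxt i", OF _ True] x(2) by simp
    then show ?thesis using x True s_sg[of "nxt i"] by (simp add: msg_simps)
  next
    case False then show ?thesis using x s_sg by (simp add: msg_simps)
  qed
qed

lemma comb_map_base_flip:
  assumes "i < n"
  shows "comb_map (D i) (flip (\<lambda>d. s (i, d)) (sg i)) (al i)"
  using comb_map.comb_map_flip[OF base_map[OF assms] compatibleD(1)[OF assms]] .

lemma fphi_eq: "i < n \<Longrightarrow> fphi s i d = (if s (i, al i d) then sg i (al i d) else inv (sg i) (al i d))"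
  using comb_map.phi_def[OF comb_map_base_flip] by (simp add: fphi_def flip_def)

lemma phi_flip_eq: "comb_map.phi (flip s msg) mal x = (if s (mal x) then msg (mal x) else inv msg (mal x))"
  using comb_map.phi_def[OF M.comb_map_flip[OF invariant_compatible]] by (simp add: flip_def)

text \<open>Faces are spliced by the same mechanism as vertices, now at the darts
  \<open>fmark\<close>. A face passes a flipped vertex by \<open>inv msg\<close>, so it visits the
  copies backwards, which explains \<open>prv\<close>.\<close>

lemma orbit_merge_flip: "orbit_merge n p D (fphi s) (fmark s) (\<lambda>k i. if s (0, k) then nxt i else prv i)
  (comb_map.phi (flip s msg) mal)"
proof
  show "bij_betw (comb_map.phi (flip s msg) mal) (SIGMA i:{..<n}. D i) (SIGMA i:{..<n}. D i)"
    using comb_map.phi_bij[OF M.comb_map_flip[OF invariant_compatible]] by (simp add: E_def)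
  fix i assume i: "i < n"
  interpret B: comb_map "D i" "flip (\<lambda>d. s (i, d)) (sg i)" "al i" by (rule comb_map_base_flip[OF i])
  show "finite (D i)" "bij_betw (fphi s i) (D i) (D i)" using B.fin B.phi_bij by (auto simp: fphi_def)
  show "fmark s k i \<in> D i" if "k < p" for k using mark_in[OF that i] i by (simp add: fmark_def)
  show "l = k" if "k < p" "l < p" "fmark s l i \<in> orbit (fphi s i) (fmark s k i)" for k l
    using compatibleD(3)[OF i] that by blast
  show "comb_map.phi (flip s msg) mal (i, d) = (i, fphi s i d)"
    if d: "d \<in> D i" and other: "\<And>k. k < p \<Longrightarrow> d \<noteq> fmark s k i" for d
  proof (cases "s (i, al i d)")
    case True
    have "\<not> al i d < p"
    proof
      assume "al i d < p"
      then show False using other[of "al i d"] True i d by (simp add: fmark_def)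
    qed
    then show ?thesis using True i d by (simp add: phi_flip_eq fphi_eq mal_def msg_simps)
  next
    case False
    define e where "e = inv (sg i) (al i d)"
    have e: "e \<in> D i" "sg i e = al i d" using i d by (simp_all add: e_def)
    have "\<not> s (i, e)" using s_sg(1)[OF i, of e] e False by simp
    have "\<not> e < p"
    proof
      assume "e < p"
      then show False using other[of e] \<open>\<not> s (i, e)\<close> i d e by (simp add: fmark_def)
    qed
    then have "msg (i, e) = (i, al i d)" using i e by (simp add: msg_simps)
    then have "inv msg (i, al i d) = (i, e)" by (rule inv_msg[OF i e(1)])
    then show ?thesis using False i d by (simp add: phi_flip_eq fphi_eq mal_def e_def)
  qed
  show "comb_map.phi (flip s msg) mal (i, fmark s k i) =
    ((if s (0, k) then nxt i else prv i), fphi s (if s (0, k) then nxt i else prv i) (fmark s k (if s (0, k) then nxt i else prv i)))"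
    if k: "k < p" for k
  proof (cases "s (0, k)")
    case True
    then have s: "s (i, k)" "s (nxt i, k)" using compatibleD(2)[OF i k] compatibleD(2)[of "nxt i", OF _ k] i by simp_all
    then show ?thesis using True i k mark_in[OF k i] mark_in[OF k, of "nxt i"]
      by (simp add: phi_flip_eq fphi_eq mal_def fmark_def msg_simps)
  next
    case False
    then have s: "\<not> s (i, k)" "\<not> s (prv i, k)" using compatibleD(2)[OF i k] compatibleD(2)[of "prv i", OF _ k] i by simp_all
    have "msg (prv i, k) = (i, sg i k)" using i k by (simp add: msg_simps)
    then have "inv msg (i, sg i k) = (prv i, k)" using inv_msg[of "prv i" k] mark_in[OF k] i by simp
    then show ?thesis using False s i k mark_in[OF k i] mark_in[OF k, of "prv i"] s_sg
      by (simp add: phi_flip_eq fphi_eq mal_def fmark_def)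
  qed
next
  fix k J assume J: "J \<subseteq> {..<n}" "J \<noteq> {}" and cl: "\<And>i. i \<in> J \<Longrightarrow> (if s (0, k) then nxt i else prv i) \<in> J"
  show "J = {..<n}"
  proof (cases "s (0, k)")
    case True then show ?thesis using nxt_trans[OF J] cl by simp
  next
    case False then show ?thesis using prv_trans[OF J] cl by simp
  qed
qed (use n in auto)

interpretation O: orbit_merge n p D "fphi s" "fmark s" "\<lambda>k i. if s (0, k) then nxt i else prv i"
  "comb_map.phi (flip s msg) mal"
  by (rule orbit_merge_flip)

text \<open>By \<open>far\<close> no edge has marked faces on both sides. Two edges of different
  copies with the same pair of faces would need exactly that, so both edges lie in one copy. There
  equal merged faces come from equal marks, hence from equal faces of the copy, and the simple dual
  of the copy applies.\<close>

lemma good_merged: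
  assumes good: "\<And>i. i < n \<Longrightarrow> comb_map.good (D i) (flip (\<lambda>d. s (i, d)) (sg i)) (al i)"
    and far: "\<And>i d k l. \<lbrakk>i < n; d \<in> D i; k < p; l < p; fmark s k i \<in> orbit (fphi s i) d\<rbrakk>
      \<Longrightarrow> fmark s l i \<notin> orbit (fphi s i) (al i d)"
  shows "comb_map.good E (flip s msg) mal"
proof -
  interpret G: comb_map E "flip s msg" mal by (rule M.comb_map_flip[OF invariant_compatible])
  have g1: "orbit (fphi s i) d \<noteq> orbit (fphi s i) (al i d)" if "i < n" "d \<in> D i" for i d
    using good[OF that(1)] that comb_map.good_def[OF comb_map_base_flip[OF that(1)]] by (simp add: fphi_def)
  have g2: "d = e" if "i < n" "d \<in> D i" "e \<in> D i" "orbit (fphi s i) d = orbit (fphi s i) e"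
    "orbit (fphi s i) (al i d) = orbit (fphi s i) (al i e)" for i d e
    using good[OF that(1)] that comb_map.good_def[OF comb_map_base_flip[OF that(1)]] by (auto simp: fphi_def)
  have nm: "\<not> (O.marked i d \<and> O.marked i (al i d))" if "i < n" "d \<in> D i" for i d
    using far[OF that] by (auto simp: O.marked_def)
  show ?thesis unfolding G.good_def
  proof (intro conjI ballI impI)
    fix x assume "x \<in> E"
    then obtain i d where x: "x = (i, d)" "i < n" "d \<in> D i" by (auto simp: E_def)
    show "orbit G.phi x \<noteq> orbit G.phi (mal x)"
    proof
      assume "orbit G.phi x = orbit G.phi (mal x)"
      then show False using O.orbit_eqD[of i d i "al i d"] x g1[OF x(2,3)] nm[OF x(2,3)] by (auto simp: mal_def)
    qed
    fix y assume "y \<in> E" and eq: "orbit G.phi x = orbit G.phi y" "orbit G.phi (mal x) = orbit G.phi (mal y)"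
    then obtain j e where y: "y = (j, e)" "j < n" "e \<in> D j" by (auto simp: E_def)
    have 1: "(i = j \<and> orbit (fphi s i) d = orbit (fphi s j) e) \<or> (O.marked i d \<and> O.marked j e)"
      using O.orbit_eqD[of i d j e] x y eq by simp
    have 2: "(i = j \<and> orbit (fphi s i) (al i d) = orbit (fphi s j) (al j e)) \<or> (O.marked i (al i d) \<and> O.marked j (al j e))"
      using O.orbit_eqD[of i "al i d" j "al j e"] x y eq by (simp add: mal_def)
    have "i = j" using 1 2 nm[OF x(2,3)] by blast
    have same: "orbit (fphi s i) d = orbit (fphi s i) e" if "d \<in> D i" "e \<in> D i" "O.marked i d" "O.marked i e"
      "orbit G.phi (i, d) = orbit G.phi (i, e)" for d e
    proof -
      obtain k where k: "k < p" "fmark s k i \<in> orbit (fphi s i) d" using \<open>O.marked i d\<close> by (auto simp: O.marked_def)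
      obtain l where l: "l < p" "fmark s l i \<in> orbit (fphi s i) e" using \<open>O.marked i e\<close> by (auto simp: O.marked_def)
      have "O.merged k = O.merged l"
        using O.orbit_marked[OF x(2) that(1) k] O.orbit_marked[OF x(2) that(2) l] that(5) by simp
      then have "k = l" using O.merged_sym k l by blast
      then show ?thesis using O.o_eq[OF x(2) x(2) that(1) k(2)] O.o_eq[OF x(2) x(2) that(2) l(2)] by simp
    qed
    have "orbit (fphi s i) d = orbit (fphi s i) e"
      using 1 same[of d e] x y eq \<open>i = j\<close> by auto
    moreover have "orbit (fphi s i) (al i d) = orbit (fphi s i) (al i e)"
      using 2 same[of "al i d" "al i e"] x y eq \<open>i = j\<close> by (auto simp: mal_def)
    ultimately show "x = y" using g2[OF x(2,3)] x y \<open>i = j\<close> by simp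
  qed
qed

text \<open>Edges add up, while each mark costs \<open>n - 1\<close> vertices and
  \<open>n - 1\<close> faces. Solving \<open>2 - 2g = (sum of 2 - 2 h i) - 2p(n - 1)\<close> for
  \<open>g\<close> gives the correction term: none for one mark, \<open>n - 1\<close> for
  two.\<close>

lemma genus_merged:
  assumes "\<And>i. i < n \<Longrightarrow> comb_map.genus (D i) (flip (\<lambda>d. s (i, d)) (sg i)) (al i) (h i)"
  shows "comb_map.genus E (flip s msg) mal ((\<Sum>i<n. h i) + (int p - 1) * (int n - 1))"
proof -
  interpret G: comb_map E "flip s msg" mal by (rule M.comb_map_flip[OF invariant_compatible])
  have "orbit (flip s msg) ` E = orbit msg ` E"
    by (rule image_cong[OF refl M.flip_orbit[OF invariant_compatible]])
  then have V: "int (card (orbit (flip s msg) ` E)) = (\<Sum>i<n. int (card (orbit (sg i) ` D i)) - int p) + int p"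
    using V.card_orbits by (simp add: E_def)
  have F: "int (card (orbit G.phi ` E)) = (\<Sum>i<n. int (card (orbit (fphi s i) ` D i)) - int p) + int p"
    using O.card_orbits by (simp add: E_def)
  have b: "2 * (int (card (orbit (sg i) ` D i)) - int p) + 2 * (int (card (orbit (fphi s i) ` D i)) - int p)
      = int (card (D i)) + 4 - 4 * h i - 4 * int p" if "i < n" for i
  proof -
    interpret B: comb_map "D i" "sg i" "al i" by (rule base_map[OF that])
    have "orbit (flip (\<lambda>d. s (i, d)) (sg i)) ` D i = orbit (sg i) ` D i"
      by (rule image_cong[OF refl B.flip_orbit[OF compatibleD(1)[OF that]]])
    then show ?thesis using assms[OF that] comb_map.genus_def[OF comb_map_base_flip[OF that]] by (simp add: fphi_def)
  qed
  have "card E = (\<Sum>i<n. card (D i))" using V.finD by (simp add: E_def)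
  moreover have "2 * (\<Sum>i<n. int (card (orbit (sg i) ` D i)) - int p) + 2 * (\<Sum>i<n. int (card (orbit (fphi s i) ` D i)) - int p)
    = (\<Sum>i<n. int (card (D i)) + 4 - 4 * h i - 4 * int p)"
    unfolding sum_distrib_left sum.distrib[symmetric] using b by (intro sum.cong) auto
  ultimately show ?thesis unfolding G.genus_def V F
    by (simp add: sum.distrib sum_subtractf sum_distrib_left[symmetric] sum_distrib_right[symmetric] algebra_simps)
qed

text \<open>Splicing only identifies faces, so an edge with a single face in its copy obstructs the
  spliced embedding. This lets one bad copy spoil the flip of small genus in (d).\<close>

lemma sides_merged:
  assumes "i < n" "d \<in> D i" "orbit (fphi s i) d = orbit (fphi s i) (al i d)"
  shows "(i, d) \<in> E" "orbit (comb_map.phi (flip s msg) mal) (i, d) = orbit (comb_map.phi (flip s msg) mal) (mal (i, d))"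
  using O.orbit_eq_same[OF assms(1,2) _ assms(3)] assms by (auto simp: E_def mal_def)

end

end

section \<open>Automorphisms of the blow-up\<close>

context blowup
begin

abbreviation adj :: "'v \<Rightarrow> 'v \<Rightarrow> bool" where
  "adj x y \<equiv> (x, y) \<in> parcs blow"

lemma adj_iff:
  assumes "d \<in> D"
  shows "adj (U d) y \<longleftrightarrow> y = U (sg d) \<or> y = U (isg d) \<or> y = W d"
    "adj (W d) y \<longleftrightarrow> y = Z d \<or> y = U d \<or> y = Z (isg d)"
    "adj (Z d) y \<longleftrightarrow> y = Z (al d) \<or> y = W (sg d) \<or> y = W d"
proof -
  have "adj v y \<longleftrightarrow> (v, y) \<in> out_arcs (with_proj blow) v" for v by (simp add: out_arcs_def)
  then show "adj (U d) y \<longleftrightarrow> y = U (sg d) \<or> y = U (isg d) \<or> y = W d"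
    "adj (W d) y \<longleftrightarrow> y = Z d \<or> y = U d \<or> y = Z (isg d)"
    "adj (Z d) y \<longleftrightarrow> y = Z (al d) \<or> y = W (sg d) \<or> y = W d"
    using out_arcs_blow[OF assms] by auto
qed

lemma adj_sym: "adj x y \<longleftrightarrow> adj y x"
  using cubic_arcs(2)[OF cubic embedding, of "(x, y)"] cubic_arcs(2)[OF cubic embedding, of "(y, x)"] by auto

lemma adj_verts: "adj x y \<Longrightarrow> x \<in> pverts blow" "adj x y \<Longrightarrow> y \<in> pverts blow"
  using cubic_arcs(4,5)[OF cubic embedding, of "(x, y)"] by auto

lemma verts_cases:
  assumes "x \<in> pverts blow"
  obtains d where "d \<in> D" "x = U d" | d where "d \<in> D" "x = W d" | d where "d \<in> D" "x = Z d"
  using assms by (auto simp: blow_def)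

lemma verts_in [simp]: "d \<in> D \<Longrightarrow> U d \<in> pverts blow" "d \<in> D \<Longrightarrow> W d \<in> pverts blow" "d \<in> D \<Longrightarrow> Z d \<in> pverts blow"
  by (auto simp: blow_def)

section \<open>Triangles as landmarks\<close>

text \<open>The edge of \<open>d\<close> is a loop whose two darts are consecutive. In the graph its
  ends \<open>Z d\<close> and \<open>Z (al d)\<close> then have a common neighbour of kind
  \<open>W\<close>, which makes a triangle.\<close>

definition looped :: "'d \<Rightarrow> bool" where
  "looped d \<longleftrightarrow> al d = sg d \<or> sg (al d) = d"

definition flanked :: "'d \<Rightarrow> bool" where
  "flanked d \<longleftrightarrow> \<not> looped d \<and> looped (sg d) \<and> looped (isg d)"

text \<open>Exactly one neighbour in the rotation belongs to a loop, which tells the two sides of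
  the pentagon of \<open>d\<close> apart.\<close>

definition asym :: "'d \<Rightarrow> bool" where
  "asym d \<longleftrightarrow> \<not> looped d \<and> looped (sg d) \<noteq> looped (isg d)"

definition tri :: "'v \<Rightarrow> bool" where
  "tri x \<longleftrightarrow> (\<exists>y z. adj x y \<and> adj y z \<and> adj z x)"

lemma looped_al: "d \<in> D \<Longrightarrow> looped (al d) \<longleftrightarrow> looped d"
  by (auto simp: looped_def)

lemma tri_neighbours:
  assumes "\<And>y. adj x y \<longleftrightarrow> y = a \<or> y = b \<or> y = c"
  shows "tri x \<longleftrightarrow> adj a b \<or> adj a c \<or> adj b c"
proof -
  have "\<not> adj y y" for y using cubic_arcs(3)[OF cubic embedding, of "(y, y)"] by auto
  moreover have "tri x \<longleftrightarrow> (\<exists>y z. adj x y \<and> adj x z \<and> adj y z)"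
    unfolding tri_def using adj_sym by blast
  ultimately show ?thesis unfolding assms using adj_sym by blast
qed

lemma al_isg_iff: "d \<in> D \<Longrightarrow> al (isg d) = d \<longleftrightarrow> al d = isg d"
  using al_al[of d] al_al[of "isg d"] by (metis sg_simps(2))

text \<open>A vertex of degree three would have an inner ring that is itself a triangle. The
  hypothesis \<open>deg\<close> excludes this and leaves only the triangles at loops.\<close>

lemma tri_iff:
  assumes d: "d \<in> D" and deg: "\<And>d. d \<in> D \<Longrightarrow> sg (sg (sg d)) \<noteq> d"
  shows "\<not> tri (U d)" "tri (W d) \<longleftrightarrow> al (isg d) = d" "tri (Z d) \<longleftrightarrow> looped d"
proof -
  have s: "sg d \<in> D" "isg d \<in> D" "al d \<in> D" using d by simp_all
  have "isg d \<noteq> sg (sg d)" using deg[OF d] by (metis sg_simps(3))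
  then show "\<not> tri (U d)"
    unfolding tri_neighbours[OF adj_iff(1)[OF d]] using d s sg_neq[OF d] isg_neq[OF d]
    by (simp add: adj_iff not_sym[OF sg_neq] not_sym[OF isg_neq(1)])
  show "tri (W d) \<longleftrightarrow> al (isg d) = d"
    unfolding tri_neighbours[OF adj_iff(2)[OF d]] al_isg_iff[OF d] using d s isg_neq[OF d]
    by (auto simp: adj_iff)
  show "tri (Z d) \<longleftrightarrow> looped d"
    unfolding tri_neighbours[OF adj_iff(3)[OF d]] using d s sg_neq[OF d] al_neq[OF d]
    by (auto simp: adj_iff looped_def)
qed

lemma not_tri_W:
  assumes "d \<in> D" "\<not> looped d" "\<And>d. d \<in> D \<Longrightarrow> sg (sg (sg d)) \<noteq> d"
  shows "\<not> tri (W d)" "\<not> tri (W (sg d))"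
proof -
  have "al (isg d) \<noteq> d" using assms(1,2) al_isg_iff[of d] by (auto simp: looped_def)
  then show "\<not> tri (W d)" using tri_iff(2)[OF assms(1,3)] by simp
  show "\<not> tri (W (sg d))" using tri_iff(2)[of "sg d", OF _ assms(3)] assms(1,2) by (auto simp: looped_def)
qed

text \<open>The loops of the map are the only triangles. A vertex \<open>Z d\<close> between two loops is
  recognised by two neighbours that are adjacent to different triangles.\<close>

definition between :: "'v \<Rightarrow> bool" where
  "between x \<longleftrightarrow> \<not> tri x \<and> (\<exists>y y' z z'. adj x y \<and> adj x y' \<and> y \<noteq> y' \<and> \<not> tri y \<and> \<not> tri y' \<and>
     adj y z \<and> adj y' z' \<and> tri z \<and> tri z' \<and> z \<noteq> z' \<and> \<not> adj z z')"

definition near :: "'v \<Rightarrow> bool" where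
  "near y \<longleftrightarrow> (\<exists>z. adj y z \<and> tri z)"

end

text \<open>The unique flanked dart is the seed of a propagation. By \<open>reach\<close> all darts
  are obtained from \<open>al d0\<close> by turning around vertices and by crossing edges to darts
  with \<open>asym\<close>, where a reflection would be noticed. By \<open>loops_apart\<close>
  consecutive looped darts belong to one loop.\<close>

locale rigid_blowup = blowup +
  fixes d0
  assumes deg: "d \<in> D \<Longrightarrow> sg (sg (sg d)) \<noteq> d"
    and loops_apart: "d \<in> D \<Longrightarrow> looped d \<Longrightarrow> looped (sg d) \<Longrightarrow> al d = sg d"
    and d0: "d0 \<in> D" "flanked d0" and d0_unique: "d \<in> D \<Longrightarrow> flanked d \<Longrightarrow> d = d0"
    and d0_asym: "asym (al d0)"
    and reach: "S \<subseteq> D \<Longrightarrow> (\<And>d. d \<in> S \<Longrightarrow> sg d \<in> S) \<Longrightarrow> al d0 \<in> S \<Longrightarrow>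
      (\<And>d. d \<in> D \<Longrightarrow> al d \<in> S \<Longrightarrow> asym d \<Longrightarrow> d \<in> S) \<Longrightarrow> S = D"
begin

lemmas tri = tri_iff[OF _ deg]

lemma looped_flank:
  assumes "d \<in> D" "looped d" "looped (isg d)"
  shows "al (isg d) = d"
  using loops_apart[of "isg d"] assms by simp

lemma near_iff:
  assumes d: "d \<in> D"
  shows "near (U d) \<longleftrightarrow> al (isg d) = d"
    "\<not> tri (W d) \<Longrightarrow> near (W d) \<longleftrightarrow> looped d \<or> looped (isg d)"
    "\<not> tri (Z d) \<Longrightarrow> \<not> near (Z d)"
proof -
  have s: "sg d \<in> D" "isg d \<in> D" "al d \<in> D" using d by simp_all
  show "near (U d) \<longleftrightarrow> al (isg d) = d"
    unfolding near_def adj_iff[OF d] using tri[OF d] tri[OF s(1)] tri[OF s(2)] by blast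
  show "near (W d) \<longleftrightarrow> looped d \<or> looped (isg d)" if "\<not> tri (W d)"
    unfolding near_def adj_iff[OF d] using tri[OF d] tri[OF s(2)] by blast
  show "\<not> near (Z d)" if "\<not> tri (Z d)"
  proof -
    have "\<not> looped d" using that tri[OF d] by simp
    then have "\<not> tri (W (sg d))" "\<not> tri (W d)" "\<not> tri (Z (al d))"
      using not_tri_W[OF d _ deg] tri[OF s(3)] looped_al[OF d] by simp_all
    then show ?thesis unfolding near_def adj_iff[OF d] by blast
  qed
qed

text \<open>At \<open>W d\<close> only \<open>U d\<close> can be a neighbour outside triangles with
  a triangle next to it. At \<open>Z d\<close> the two neighbours must be \<open>W d\<close> and
  \<open>W (sg d)\<close>, which makes \<open>d\<close> flanked. At \<open>U d\<close> the two
  triangle vertices would either be adjacent on one loop, or one dart would belong to two different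
  loops.\<close>

lemma between_imp:
  assumes "x \<in> pverts blow" "between x"
  shows "x = Z d0"
proof -
  obtain y y' z z' where b: "\<not> tri x" "adj x y" "adj x y'" "y \<noteq> y'" "\<not> tri y" "\<not> tri y'"
    "adj y z" "adj y' z'" "tri z" "tri z'" "z \<noteq> z'" "\<not> adj z z'"
    using assms(2) unfolding between_def by blast
  have ny: "near y" "near y'" using b unfolding near_def by blast+
  from assms(1) show ?thesis
  proof (cases rule: verts_cases)
    case (2 d)
    have "y = U d \<or> near y \<and> (y = Z d \<or> y = Z (isg d))" "y' = U d \<or> near y' \<and> (y' = Z d \<or> y' = Z (isg d))"
      using b(2,3) ny unfolding 2(2) adj_iff[OF 2(1)] by blast+
    then have "y = U d" "y' = U d" using near_iff(3)[OF 2(1)] near_iff(3)[of "isg d"] 2(1) b(5,6) by auto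
    then show ?thesis using b(4) by simp
  next
    case (3 d)
    have "\<not> looped d" using b(1) tri[OF 3(1)] 3(2) by simp
    then have "\<not> near (Z (al d))" using near_iff(3)[of "al d"] tri[of "al d"] looped_al[OF 3(1)] 3(1) by simp
    then have "(y = W (sg d) \<and> y' = W d) \<or> (y = W d \<and> y' = W (sg d))"
      using b(2-4) ny unfolding 3(2) adj_iff[OF 3(1)] by blast
    then have n: "near (W d)" "near (W (sg d))" "\<not> tri (W d)" "\<not> tri (W (sg d))" using ny b(5,6) by auto
    then have "looped (sg d)" "looped (isg d)"
      using near_iff(2)[OF 3(1)] near_iff(2)[of "sg d"] 3(1) \<open>\<not> looped d\<close> by auto
    then have "flanked d" using \<open>\<not> looped d\<close> by (simp add: flanked_def)
    then show ?thesis using d0_unique 3 by simp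
  next
    case (1 d)
    have s: "sg d \<in> D" "isg d \<in> D" using 1(1) by simp_all
    have tz: "tri z \<Longrightarrow> adj (U e) z \<Longrightarrow> z = W e \<and> al (isg e) = e" if "e \<in> D" for z e
      using tri[OF that] tri[of "sg e"] tri[of "isg e"] that unfolding adj_iff[OF that] by auto
    have tw: "tri z \<Longrightarrow> adj (W d) z \<Longrightarrow> (z = Z d \<and> looped d) \<or> (z = Z (isg d) \<and> looped (isg d))" for z
      using tri[OF 1(1)] tri[OF s(2)] unfolding adj_iff[OF 1(1)] by auto
    have lp: "al e = sg e \<Longrightarrow> looped e \<and> looped (sg e)" if "e \<in> D" for e
      using that al_al[OF that] by (auto simp: looped_def)
    have key: False if "adj (U d) y" "adj (U d) y'" "y \<noteq> y'" "\<not> tri y" "\<not> tri y'" "adj y z" "adj y' z'"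
      "tri z" "tri z'" "\<not> adj z z'" "(y = U (sg d) \<and> y' = U (isg d)) \<or> (y = U (sg d) \<and> y' = W d) \<or> (y = U (isg d) \<and> y' = W d)"
      for y y' z z'
      using that(11)
    proof (elim disjE conjE)
      assume y: "y = U (sg d)" "y' = U (isg d)"
      then have "al d = sg d" "al (isg (isg d)) = isg d"
        using tz[OF s(1)] tz[OF s(2)] that 1(1) by auto
      then have "looped d" "looped (isg d)" using lp[of "isg (isg d)"] lp[of d] 1(1) by auto
      then have "al (isg d) = d" using looped_flank[OF 1(1)] by simp
      then have "isg d = sg d" using \<open>al d = sg d\<close> al_al[OF s(2)] by simp
      then show False using isg_neq(3)[OF 1(1)] by simp
    next
      assume y: "y = U (sg d)" "y' = W d"
      then have z: "z = W (sg d)" "al d = sg d" using tz[OF s(1)] that 1(1) by auto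
      then have ld: "looped d" using lp[OF 1(1)] by simp
      from tw[of z'] y that have "(z' = Z d) \<or> (z' = Z (isg d) \<and> looped (isg d))" by auto
      then show False
      proof
        assume "z' = Z d"
        then show False using that(10) z adj_iff(2)[OF s(1)] by simp
      next
        assume "z' = Z (isg d) \<and> looped (isg d)"
        then have "al (isg d) = d" using looped_flank[OF 1(1) ld] by simp
        then have "isg d = sg d" using \<open>al d = sg d\<close> al_al[OF s(2)] by simp
        then show False using isg_neq(3)[OF 1(1)] by simp
      qed
    next
      assume y: "y = U (isg d)" "y' = W d"
      then have z: "z = W (isg d)" "al (isg (isg d)) = isg d" using tz[OF s(2)] that 1(1) by auto
      then have ld: "looped (isg d)" using lp[of "isg (isg d)"] 1(1) by simp
      from tw[of z'] y that have "(z' = Z d \<and> looped d) \<or> z' = Z (isg d)" by auto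
      then show False
      proof
        assume "z' = Z (isg d)"
        then show False using that(10) z adj_iff(2)[OF s(2)] by simp
      next
        assume "z' = Z d \<and> looped d"
        then have "al (isg d) = d" using looped_flank[OF 1(1)] ld by simp
        then have "al (isg d) = al (isg (isg (isg d))) \<or> isg (isg d) = d" using z(2) al_al[of "isg (isg d)"] 1(1) by simp
        then show False using isg_neq(2)[OF 1(1)] z(2) \<open>al (isg d) = d\<close> al_al[of "isg (isg d)"] 1(1) by simp
      qed
    qed
    have "(y = U (sg d) \<and> y' = U (isg d)) \<or> (y = U (sg d) \<and> y' = W d) \<or> (y = U (isg d) \<and> y' = W d) \<or>
      (y' = U (sg d) \<and> y = U (isg d)) \<or> (y' = U (sg d) \<and> y = W d) \<or> (y' = U (isg d) \<and> y = W d)"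
      using b(2-4) unfolding 1(2) adj_iff[OF 1(1)] by blast
    moreover have "\<not> adj z' z" using b(12) adj_sym by blast
    ultimately show ?thesis using key[of y y' z z'] key[of y' y z' z] b 1(2) by blast
  qed
qed

lemma between_d0: "between (Z d0)"
proof -
  have f: "\<not> looped d0" "looped (sg d0)" "looped (isg d0)" using d0 by (auto simp: flanked_def)
  have s: "sg d0 \<in> D" "isg d0 \<in> D" using d0 by simp_all
  have t: "\<not> tri (W d0)" "\<not> tri (W (sg d0))" "\<not> tri (Z d0)"
    using not_tri_W[OF d0(1) f(1) deg] tri[OF d0(1)] f(1) by simp_all
  \<comment> \<open>If both neighbours of \<open>d0\<close> belonged to the same loop, that loop
    would close up consecutively behind \<open>d0\<close> and the vertex would have degree
    three.\<close>
  have "al (isg d0) \<noteq> sg d0"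
  proof
    assume a: "al (isg d0) = sg d0"
    then have "sg d0 = d0 \<or> sg (sg d0) = isg d0" using f(3) by (auto simp: looped_def)
    then show False using sg_neq[OF d0(1)] deg[OF d0(1)] d0(1) by (metis sg_simps(3))
  qed
  then have "\<not> adj (Z (isg d0)) (Z (sg d0))" "Z (isg d0) \<noteq> Z (sg d0)" "W d0 \<noteq> W (sg d0)"
    using s d0(1) isg_neq(3)[OF d0(1)] sg_neq[OF d0(1)] not_sym by (auto simp: adj_iff(3))
  moreover have "adj (Z d0) (W d0)" "adj (Z d0) (W (sg d0))" "adj (W d0) (Z (isg d0))" "adj (W (sg d0)) (Z (sg d0))"
    using adj_iff d0(1) s by simp_all
  moreover have "tri (Z (isg d0))" "tri (Z (sg d0))" using tri[OF s(1)] tri[OF s(2)] f by simp_all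
  ultimately show ?thesis unfolding between_def using t by blast
qed

section \<open>Automorphisms of a rigid blow-up\<close>

context
  fixes f assumes iso: "graph_isomorphism f blow blow"
begin

lemma f_bij: "bij_betw f (pverts blow) (pverts blow)"
  using iso by (simp add: graph_isomorphism_def)

lemma f_in: "x \<in> pverts blow \<Longrightarrow> f x \<in> pverts blow"
  using f_bij by (auto simp: bij_betw_def)

lemma f_inj: "x \<in> pverts blow \<Longrightarrow> y \<in> pverts blow \<Longrightarrow> f x = f y \<longleftrightarrow> x = y"
  using f_bij by (auto simp: bij_betw_def inj_on_def)

lemma f_surj: "y \<in> pverts blow \<Longrightarrow> \<exists>x\<in>pverts blow. y = f x"
  using f_bij by (auto simp: bij_betw_def)

lemma f_adj:
  assumes "x \<in> pverts blow" "y \<in> pverts blow"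
  shows "adj (f x) (f y) \<longleftrightarrow> adj x y"
proof
  assume "adj (f x) (f y)"
  then have "(f x, f y) \<in> map_prod f f ` parcs blow" using iso by (simp add: graph_isomorphism_def)
  then obtain x' y' where *: "f x = f x'" "f y = f y'" "adj x' y'" by auto
  then have "x = x'" "y = y'" using assms adj_verts[OF *(3)] f_inj by auto
  then show "adj x y" using *(3) by simp
next
  assume "adj x y"
  then have "map_prod f f (x, y) \<in> map_prod f f ` parcs blow" by (rule imageI)
  then show "adj (f x) (f y)" using iso by (simp add: graph_isomorphism_def)
qed

lemma f_adjI: "adj x y \<Longrightarrow> adj (f x) (f y)"
  using f_adj adj_verts by blast

lemma f_tri:
  assumes "x \<in> pverts blow"
  shows "tri (f x) \<longleftrightarrow> tri x"
proof
  assume "tri x" then show "tri (f x)" unfolding tri_def using f_adjI by blast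
next
  assume "tri (f x)"
  then obtain y' z' where *: "adj (f x) y'" "adj y' z'" "adj z' (f x)" unfolding tri_def by blast
  then obtain y z where "y \<in> pverts blow" "y' = f y" "z \<in> pverts blow" "z' = f z"
    using f_surj adj_verts by metis
  then show "tri x" using * f_adj assms unfolding tri_def by blast
qed

lemma f_near: "near x \<Longrightarrow> near (f x)"
  unfolding near_def using f_adjI f_tri adj_verts(2) by blast

lemma f_between:
  assumes "x \<in> pverts blow" "between x"
  shows "between (f x)"
proof -
  obtain y y' z z' where b: "\<not> tri x" "adj x y" "adj x y'" "y \<noteq> y'" "\<not> tri y" "\<not> tri y'"
    "adj y z" "adj y' z'" "tri z" "tri z'" "z \<noteq> z'" "\<not> adj z z'"
    using assms(2) unfolding between_def by blast
  have v: "y \<in> pverts blow" "y' \<in> pverts blow" "z \<in> pverts blow" "z' \<in> pverts blow"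
    using b adj_verts by blast+
  have "\<not> tri (f x)" "adj (f x) (f y)" "adj (f x) (f y')" "f y \<noteq> f y'" "\<not> tri (f y)" "\<not> tri (f y')"
    "adj (f y) (f z)" "adj (f y') (f z')" "tri (f z)" "tri (f z')" "f z \<noteq> f z'" "\<not> adj (f z) (f z')"
    using b v assms(1) f_tri f_adj f_inj by simp_all
  then show ?thesis unfolding between_def by blast
qed

lemma third_neighbour:
  assumes "x \<in> pverts blow" "\<And>y. adj x y \<longleftrightarrow> y = a \<or> y = b \<or> y = c" "f x = x" "f a = a" "f b = b" "c \<noteq> a" "c \<noteq> b"
  shows "f c = c"
proof -
  have "adj x a" "adj x b" "adj x c" using assms(2) by blast+
  then have "adj x (f c)" "f c \<noteq> f a" "f c \<noteq> f b"
    using f_adjI[of x c] assms(3,6,7) f_inj adj_verts(2) by auto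
  then show ?thesis using assms(2,4,5) by auto
qed

definition fixed :: "'a \<Rightarrow> bool" where
  "fixed d \<longleftrightarrow> f (U d) = U d \<and> f (U (sg d)) = U (sg d) \<and> f (W d) = W d \<and> f (W (sg d)) = W (sg d) \<and> f (Z d) = Z d"

text \<open>The next pentagon shares two vertices with the fixed one. Its vertices
  \<open>U (sg (sg d))\<close> and \<open>Z (sg d)\<close> are third neighbours of fixed vertices,
  and the remaining vertex is a common neighbour of these two.\<close>

lemma fixed_sg:
  assumes "d \<in> D" "fixed d"
  shows "fixed (sg d)"
proof -
  note d = assms(1)
  have s: "sg d \<in> D" "sg (sg d) \<in> D" "al (sg d) \<in> D" using d by simp_all
  have fx: "f (U d) = U d" "f (U (sg d)) = U (sg d)" "f (W d) = W d" "f (W (sg d)) = W (sg d)" "f (Z d) = Z d"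
    using assms(2) by (simp_all add: fixed_def)
  have 1: "f (U (sg (sg d))) = U (sg (sg d))"
    by (rule third_neighbour[of "U (sg d)" "U d" "W (sg d)"])
      (use s d fx sg_sg_neq[OF d] in \<open>auto simp: adj_iff\<close>)
  have 2: "f (Z (sg d)) = Z (sg d)"
    by (rule third_neighbour[of "W (sg d)" "U (sg d)" "Z d"])
      (use s d fx sg_neq[OF d] in \<open>auto simp: adj_iff\<close>)
  have "adj (f (Z (sg d))) (f (W (sg (sg d))))" "adj (f (U (sg (sg d)))) (f (W (sg (sg d))))"
    using s by (intro f_adjI; simp add: adj_iff)+
  then have "adj (Z (sg d)) (f (W (sg (sg d))))" "adj (U (sg (sg d))) (f (W (sg (sg d))))" using 1 2 by simp_all
  then have "f (W (sg (sg d))) = W (sg (sg d))"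
    using s d unfolding adj_iff[OF s(1)] adj_iff[OF s(2)] by auto
  then show ?thesis using 1 2 fx by (simp add: fixed_def)
qed

text \<open>Once the edge from \<open>Z d\<close> to \<open>Z (al d)\<close> is fixed, the pentagon
  could still be reflected. A triangle lies beyond exactly one of its sides, and triangles are
  preserved, so the reflection is impossible.\<close>

lemma fixed_asym:
  assumes d: "d \<in> D" and a: "asym d" and fz: "f (Z d) = Z d" "f (Z (al d)) = Z (al d)"
  shows "fixed d"
proof -
  have s: "sg d \<in> D" "isg d \<in> D" "al d \<in> D" using d by simp_all
  have nl: "\<not> looped d" using a by (simp add: asym_def)
  have tr: "f x = y \<Longrightarrow> x \<in> pverts blow \<Longrightarrow> tri x \<longleftrightarrow> tri y" for x y using f_tri by auto
  have swap: "f (W d) = W d \<and> f (W (sg d)) = W (sg d) \<or> f (W d) = W (sg d) \<and> f (W (sg d)) = W d"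
  proof -
    have "adj (Z d) (f (W d))" "adj (Z d) (f (W (sg d)))"
      using f_adjI[of "Z d" "W d"] f_adjI[of "Z d" "W (sg d)"] fz d by (simp_all add: adj_iff)
    moreover have "f (W d) \<noteq> f (W (sg d))" "f (W d) \<noteq> f (Z (al d))" "f (W (sg d)) \<noteq> f (Z (al d))"
      using f_inj d s sg_neq[OF d] not_sym[OF sg_neq[OF d]] by auto
    ultimately show ?thesis using fz(2) unfolding adj_iff[OF d] by auto
  qed
  have nW: "adj (f (W d)) (f (Z (isg d)))" "adj (f (W d)) (f (U d))" "adj (f (W (sg d))) (f (Z (sg d)))"
    "adj (f (W (sg d))) (f (U (sg d)))" "adj (f (U d)) (f (U (sg d)))"
    using d s by (intro f_adjI; simp add: adj_iff)+
  have ne: "f (Z (isg d)) \<noteq> Z d" "f (Z (sg d)) \<noteq> Z d" "f (U d) \<noteq> Z d" "f (U (sg d)) \<noteq> Z d" "f (Z (isg d)) \<noteq> f (U d)"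
      "f (Z (sg d)) \<noteq> f (U (sg d))"
    using f_inj[of _ "Z d"] fz d s sg_neq[OF d] isg_neq[OF d] f_inj by auto
  have t: "tri (f (Z (isg d))) \<longleftrightarrow> looped (isg d)" "tri (f (Z (sg d))) \<longleftrightarrow> looped (sg d)" "\<not> tri (f (U d))" "\<not> tri (f (U (sg d)))"
    "\<not> tri (U d)" "\<not> tri (U (sg d))" "tri (Z (isg d)) \<longleftrightarrow> looped (isg d)" "tri (Z (sg d)) \<longleftrightarrow> looped (sg d)"
    using f_tri tri[OF d] tri[OF s(1)] tri[OF s(2)] d s by simp_all
  have W: "f (W d) = W d" "f (W (sg d)) = W (sg d)"
  proof -
    have False if "f (W d) = W (sg d)" "f (W (sg d)) = W d"
    proof (cases "looped (sg d)")
      case True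
      then have "\<not> looped (isg d)" using a by (simp add: asym_def)
      moreover have "f (Z (sg d)) = U d \<or> f (Z (sg d)) = Z (isg d)"
        using nW(3) ne unfolding that adj_iff[OF d] by blast
      ultimately show False using t True by auto
    next
      case False
      then have "looped (isg d)" using a by (simp add: asym_def)
      moreover have "f (Z (isg d)) = U (sg d) \<or> f (Z (isg d)) = Z (sg d)"
        using nW(1) ne unfolding that adj_iff[OF s(1)] by auto
      ultimately show False using t False by auto
    qed
    then show "f (W d) = W d" "f (W (sg d)) = W (sg d)" using swap by blast+
  qed
  \<comment> \<open>With both \<open>W\<close> fixed, \<open>U d\<close> might still change places
    with \<open>Z (isg d)\<close>, and likewise on the other side. On the side of the loop only one
    of the two lies in a triangle; the edge from \<open>U d\<close> to \<open>U (sg d)\<close> then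
    settles the other side.\<close>
  have cd: "f (Z (isg d)) = U d \<or> f (Z (isg d)) = Z (isg d)" "f (U d) = U d \<or> f (U d) = Z (isg d)"
    "f (Z (sg d)) = U (sg d) \<or> f (Z (sg d)) = Z (sg d)" "f (U (sg d)) = U (sg d) \<or> f (U (sg d)) = Z (sg d)"
    using nW(1-4) ne unfolding W adj_iff[OF d] adj_iff[OF s(1)] by auto
  have noadj: "\<not> adj (Z (isg d)) (U (sg d))" "\<not> adj (U d) (Z (sg d))"
    using d s by (simp_all add: adj_iff)
  have "f (U d) = U d \<and> f (U (sg d)) = U (sg d)"
  proof (cases "looped (sg d)")
    case True
    then have "f (Z (sg d)) = Z (sg d)" using cd(3) t by auto
    then have "f (U (sg d)) = U (sg d)" using cd(4) ne(6) by auto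
    moreover from this have "f (U d) = U d" using cd(2) nW(5) noadj(1) by auto
    ultimately show ?thesis by simp
  next
    case False
    then have "looped (isg d)" using a by (simp add: asym_def)
    then have "f (Z (isg d)) = Z (isg d)" using cd(1) t by auto
    then have "f (U d) = U d" using cd(2) ne(5) by auto
    moreover from this have "f (U (sg d)) = U (sg d)" using cd(4) nW(5) noadj(2) by auto
    ultimately show ?thesis by simp
  qed
  then show ?thesis using W fz by (simp add: fixed_def)
qed

text \<open>\<open>Z d0\<close> is the only vertex with \<open>between\<close>. Among its neighbours
  the two of kind \<open>W\<close> have a triangle next to them and \<open>Z (al d0)\<close> has
  none, so the latter is fixed too.\<close>

lemma fixed_seed: "f (Z d0) = Z d0" "f (Z (al d0)) = Z (al d0)"
proof -
  have "between (f (Z d0))" using f_between between_d0 d0(1) by simp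
  then show 1: "f (Z d0) = Z d0" using between_imp f_in d0(1) by simp
  have fl: "\<not> looped d0" "looped (sg d0)" "looped (isg d0)" using d0 by (auto simp: flanked_def)
  have s: "sg d0 \<in> D" "isg d0 \<in> D" "al d0 \<in> D" using d0 by simp_all
  have t: "\<not> tri (W d0)" "\<not> tri (W (sg d0))"
    using not_tri_W[OF d0(1) fl(1) deg] by simp_all
  have nr: "near (W d0)" "near (W (sg d0))" using near_iff(2)[OF d0(1)] near_iff(2)[OF s(1)] t fl d0(1) by simp_all
  have na: "\<not> near (Z (al d0))" using near_iff(3)[OF s(3)] tri[OF s(3)] looped_al[OF d0(1)] fl(1) by simp
  have "near (f (W d0))" "near (f (W (sg d0)))" using nr f_near by blast+
  moreover have "adj (Z d0) (f (W d0))" "adj (Z d0) (f (W (sg d0)))" "adj (Z d0) (f (Z (al d0)))"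
    using f_adjI[of "Z d0" "W d0"] f_adjI[of "Z d0" "W (sg d0)"] f_adjI[of "Z d0" "Z (al d0)"] 1 d0(1) by (simp_all add: adj_iff)
  moreover have "f (W d0) \<noteq> f (W (sg d0))" "f (W d0) \<noteq> f (Z (al d0))" "f (W (sg d0)) \<noteq> f (Z (al d0))"
    using f_inj d0(1) s sg_neq[OF d0(1)] not_sym[OF sg_neq[OF d0(1)]] by auto
  ultimately show "f (Z (al d0)) = Z (al d0)" using na unfolding adj_iff[OF d0(1)] by metis
qed

theorem automorphism_trivial:
  assumes "x \<in> pverts blow"
  shows "f x = x"
proof -
  define S where "S = {d \<in> D. fixed d}"
  have "S = D"
  proof (rule reach)
    show "S \<subseteq> D" by (auto simp: S_def)
    show "sg d \<in> S" if "d \<in> S" for d using that fixed_sg by (auto simp: S_def)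
    show "al d0 \<in> S" using fixed_asym[of "al d0"] fixed_seed d0_asym d0(1) by (simp add: S_def)
    \<comment> \<open>Crossing an edge: \<open>Z (al d)\<close> and its two neighbours of kind
      \<open>W\<close> are fixed, so the third neighbour \<open>Z d\<close> is fixed, and
      \<open>asym d\<close> does the rest.\<close>
    fix d assume d: "d \<in> D" "al d \<in> S" "asym d"
    have ad: "al d \<in> D" "sg (al d) \<in> D" using d(1) by simp_all
    have fx: "f (Z (al d)) = Z (al d)" "f (W (al d)) = W (al d)" "f (W (sg (al d))) = W (sg (al d))"
      using d(2) by (simp_all add: S_def fixed_def)
    have "f (Z d) = Z d"
    proof (rule third_neighbour[OF _ _ fx])
      show "Z (al d) \<in> pverts blow" using ad by simp
      show "adj (Z (al d)) y \<longleftrightarrow> y = W (al d) \<or> y = W (sg (al d)) \<or> y = Z d" for y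
        using adj_iff(3)[OF ad(1)] d(1) by auto
      show "Z d \<noteq> W (al d)" "Z d \<noteq> W (sg (al d))" using ad d(1) by simp_all
    qed
    then show "d \<in> S" using fixed_asym[OF d(1,3)] d(1) fx(1) by (simp add: S_def)
  qed
  have *: "fixed d" if "d \<in> D" for d
  proof -
    have "d \<in> S" using that \<open>S = D\<close> by simp
    then show ?thesis by (simp add: S_def)
  qed
  from assms show ?thesis by (cases rule: verts_cases) (use * in \<open>auto simp: fixed_def\<close>)
qed

end

end

section \<open>Maps given by lists of cycles\<close>

definition perm_of :: "nat list list \<Rightarrow> nat \<Rightarrow> nat" where
  "perm_of cs d = (case map_of (concat (map (\<lambda>c. zip c (rotate1 c)) cs)) d of Some e \<Rightarrow> e | None \<Rightarrow> d)"

lemma perm_of_nth: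
  assumes "distinct (concat cs)" "c \<in> set cs" "i < length c"
  shows "perm_of cs (c ! i) = c ! (Suc i mod length c)"
proof -
  let ?ps = "concat (map (\<lambda>c. zip c (rotate1 c)) cs)"
  have "map fst ?ps = concat cs" by (simp add: map_concat comp_def)
  moreover have "(c ! i, c ! (Suc i mod length c)) \<in> set ?ps"
    using assms(2,3) by (auto simp: set_zip nth_rotate1 intro!: bexI[of _ c] exI[of _ i])
  ultimately have "map_of ?ps (c ! i) = Some (c ! (Suc i mod length c))"
    using assms(1) by (intro map_of_is_SomeI) simp_all
  then show ?thesis by (simp add: perm_of_def)
qed

lemma perm_of_other: "d \<notin> set (concat cs) \<Longrightarrow> perm_of cs d = d"
proof -
  assume d: "d \<notin> set (concat cs)"
  have "d \<notin> fst ` set (concat (map (\<lambda>c. zip c (rotate1 c)) cs))"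
    using d by (auto dest: set_zip_leftD)
  then have "map_of (concat (map (\<lambda>c. zip c (rotate1 c)) cs)) d = None"
    by (simp add: map_of_eq_None_iff)
  then show ?thesis by (simp add: perm_of_def)
qed

lemma in_cycle:
  assumes "d \<in> set (concat cs)"
  obtains c i where "c \<in> set cs" "i < length c" "d = c ! i"
  using assms by (auto simp: in_set_conv_nth)

lemma in_cycle_index:
  assumes "d \<in> set (concat cs)"
  obtains i where "i < length cs" "d \<in> set (cs ! i)"
proof -
  obtain c where "c \<in> set cs" "d \<in> set c" using assms by auto
  then show ?thesis using that by (metis in_set_conv_nth)
qed

lemma perm_of_rev:
  assumes "distinct (concat cs)"
  shows "perm_of (map rev cs) (perm_of cs d) = d"
proof (cases "d \<in> set (concat cs)")
  case False
  moreover from this have "d \<notin> set (concat (map rev cs))" by auto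
  ultimately show ?thesis using perm_of_other[of d cs] perm_of_other[of d "map rev cs"] by simp
next
  case True
  then obtain c i where c: "c \<in> set cs" "i < length c" "d = c ! i" by (rule in_cycle)
  have dist: "distinct (concat (map rev cs))"
    using assms by (induct cs) auto
  have rc: "rev c \<in> set (map rev cs)" using c by simp
  have 1: "perm_of cs d = c ! (Suc i mod length c)" using perm_of_nth[OF assms c(1,2)] c(3) by simp
  show ?thesis
  proof (cases "Suc i = length c")
    case True
    then have "perm_of cs d = rev c ! (length c - 1)" using 1 by (simp add: rev_nth)
    then have "perm_of (map rev cs) (perm_of cs d) = rev c ! (Suc (length c - 1) mod length c)"
      using perm_of_nth[OF dist rc, of "length c - 1"] c(2) by simp
    also have "Suc (length c - 1) = length c" using c(2) by simp
    also have "length c mod length c = 0" by simp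
    also have "rev c ! 0 = c ! i" using c(2) by (simp add: rev_nth True[symmetric])
    finally show ?thesis using c(3) by simp
  next
    case False
    then have "perm_of cs d = rev c ! (length c - Suc (Suc i))" using 1 c(2) by (simp add: rev_nth)
    then have "perm_of (map rev cs) (perm_of cs d) = rev c ! (Suc (length c - Suc (Suc i)) mod length c)"
      using perm_of_nth[OF dist rc, of "length c - Suc (Suc i)"] c(2) False by simp
    also have "Suc (length c - Suc (Suc i)) mod length c = length c - Suc i" using False c(2) by simp
    also have "rev c ! (length c - Suc i) = c ! i" using c(2) by (simp add: rev_nth)
    finally show ?thesis using c(3) by simp
  qed
qed

lemma distinct_concat_rev: "distinct (concat (map rev cs)) \<longleftrightarrow> distinct (concat cs)"
  by (induct cs) auto

lemma perm_of_rev':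
  assumes "distinct (concat cs)"
  shows "perm_of cs (perm_of (map rev cs) d) = d"
  using perm_of_rev[of "map rev cs" d] assms by (simp add: distinct_concat_rev comp_def)

lemma inv_perm_of: "distinct (concat cs) \<Longrightarrow> inv (perm_of cs) = perm_of (map rev cs)"
  by (intro inv_equality) (simp_all add: perm_of_rev perm_of_rev')

lemma perm_of_permutes:
  assumes "distinct (concat cs)"
  shows "perm_of cs permutes set (concat cs)"
proof -
  have "bij (perm_of cs)"
    by (intro o_bij[where g = "perm_of (map rev cs)"]) (auto simp: fun_eq_iff perm_of_rev perm_of_rev' assms)
  then show ?thesis using perm_of_other by (auto simp: permutes_def bij_iff)
qed

lemma cycle_orbit:
  assumes "\<And>i. i < length c \<Longrightarrow> f (c ! i) = c ! (Suc i mod length c)" "d \<in> set c"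
  shows "orbit f d = set c"
proof -
  obtain i where i: "i < length c" "d = c ! i" using assms(2) by (auto simp: in_set_conv_nth)
  have pow: "(f ^^ m) d = c ! ((i + m) mod length c)" for m
  proof (induct m)
    case 0 then show ?case using i by simp
  next
    case (Suc m)
    have "(i + m) mod length c < length c" using i by (intro mod_less_divisor) auto
    then show ?case using Suc assms(1) by (simp add: mod_Suc_eq)
  qed
  show ?thesis
  proof
    show "orbit f d \<subseteq> set c"
    proof
      fix x assume "x \<in> orbit f d"
      then obtain m where "x = c ! ((i + m) mod length c)" unfolding orbit_altdef pow by blast
      then show "x \<in> set c" using i by (auto intro!: nth_mem mod_less_divisor)
    qed
    show "set c \<subseteq> orbit f d"
    proof
      fix x assume "x \<in> set c"
      then obtain j where j: "j < length c" "x = c ! j" by (auto simp: in_set_conv_nth)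
      have "i + (length c + j - i) = length c + j" using i by simp
      then have "x = (f ^^ (length c + j - i)) d" unfolding pow using j by simp
      moreover have "0 < length c + j - i" using i by simp
      ultimately show "x \<in> orbit f d" unfolding orbit_altdef by blast
    qed
  qed
qed

lemma rotate1_cycle:
  assumes "map f c = rotate1 c" "i < length c"
  shows "f (c ! i) = c ! (Suc i mod length c)"
  using arg_cong[OF assms(1), of "\<lambda>xs. xs ! i"] assms(2) by (simp add: nth_rotate1)

lemma orbits_cycles:
  assumes "distinct (concat cs)" "[] \<notin> set cs" "\<And>c d. c \<in> set cs \<Longrightarrow> d \<in> set c \<Longrightarrow> orbit f d = set c"
  shows "card (orbit f ` set (concat cs)) = length cs"
proof -
  have "orbit f ` set (concat cs) = set ` set cs"
  proof
    show "orbit f ` set (concat cs) \<subseteq> set ` set cs" using assms(3) by auto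
    show "set ` set cs \<subseteq> orbit f ` set (concat cs)"
    proof
      fix Q assume "Q \<in> set ` set cs"
      then obtain c where c: "c \<in> set cs" "Q = set c" by blast
      then have "c \<noteq> []" using assms(2) by blast
      then have "hd c \<in> set c" by simp
      then show "Q \<in> orbit f ` set (concat cs)" using assms(3)[OF c(1)] c by auto
    qed
  qed
  moreover have "distinct cs" using assms(1,2) by (simp add: distinct_concat_iff removeAll_id)
  moreover have "inj_on set (set cs)"
  proof (rule inj_onI, rule ccontr)
    fix c c' assume c: "c \<in> set cs" "c' \<in> set cs" "set c = set c'" "c \<noteq> c'"
    then have "set c \<inter> set c' = {}" using assms(1) unfolding distinct_concat_iff by blast
    then have "set c = {}" unfolding c(3) by (simp only: Int_absorb)
    then show False using c(1) assms(2) by (simp only: set_empty)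
  qed
  ultimately show ?thesis by (simp add: card_image distinct_card)
qed

section \<open>Certificates for maps\<close>

text \<open>A certificate of connectivity: each further vertex has a dart whose edge leads back to a
  vertex listed before.\<close>

primrec linked_from :: "(nat \<Rightarrow> nat) \<Rightarrow> nat list \<Rightarrow> nat list list \<Rightarrow> bool" where
  "linked_from f seen [] = True"
| "linked_from f seen (c # cs) = ((\<exists>d\<in>set c. f d \<in> set seen) \<and> linked_from f (c @ seen) cs)"

definition partitions :: "nat \<Rightarrow> nat list list \<Rightarrow> bool" where
  "partitions N cs \<longleftrightarrow> distinct (concat cs) \<and> length (concat cs) = N \<and> list_all (\<lambda>d. d < N) (concat cs)"

definition cyclic_perm :: "(nat \<Rightarrow> nat) \<Rightarrow> nat list list \<Rightarrow> bool" where
  "cyclic_perm f cs \<longleftrightarrow> list_all (\<lambda>c. map f c = rotate1 c) cs"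

definition map_ok :: "nat \<Rightarrow> nat list list \<Rightarrow> nat list list \<Rightarrow> bool" where
  "map_ok N vs es \<longleftrightarrow> partitions N vs \<and> partitions N es \<and> vs \<noteq> [] \<and>
     list_all (\<lambda>c. 3 \<le> length c) vs \<and> list_all (\<lambda>c. length c = 2) es \<and>
     linked_from (perm_of es) (hd vs) (tl vs)"

lemma partitionsD:
  assumes "partitions N cs"
  shows "distinct (concat cs)" "set (concat cs) = {..<N}"
proof -
  show d: "distinct (concat cs)" using assms by (simp add: partitions_def)
  have "card (set (concat cs)) = N" using assms distinct_card[OF d] by (simp add: partitions_def)
  moreover have "set (concat cs) \<subseteq> {..<N}" using assms by (auto simp: partitions_def list_all_iff)
  ultimately show "set (concat cs) = {..<N}" by (intro card_subset_eq) simp_all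
qed

lemma cyclic_perm_of:
  assumes "distinct (concat cs)"
  shows "cyclic_perm (perm_of cs) cs"
proof -
  have "map (perm_of cs) c = rotate1 c" if "c \<in> set cs" for c
    using perm_of_nth[OF assms that] by (intro nth_equalityI) (simp_all add: nth_rotate1)
  then show ?thesis by (simp add: cyclic_perm_def list_all_iff)
qed

text \<open>The darts seen so far behave as one class for membership in \<open>S\<close>; the
  linking dart attaches the next cycle to this class, so the induction continues with
  \<open>c @ seen\<close>.\<close>

lemma linked_closed:
  assumes "linked_from f seen cs" "\<And>c x y. c \<in> set cs \<Longrightarrow> x \<in> set c \<Longrightarrow> y \<in> set c \<Longrightarrow> x \<in> S \<Longrightarrow> y \<in> S"
    "\<And>x y. x \<in> set seen \<Longrightarrow> y \<in> set seen \<Longrightarrow> x \<in> S \<Longrightarrow> y \<in> S"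
    "\<And>x. x \<in> S \<longleftrightarrow> f x \<in> S" "x \<in> set (concat (seen # cs))" "y \<in> set (concat (seen # cs))" "x \<in> S"
  shows "y \<in> S"
  using assms
proof (induct cs arbitrary: seen)
  case Nil
  show ?case by (rule Nil.prems(3)[OF _ _ Nil.prems(7)]) (use Nil.prems(5,6) in simp_all)
next
  case (Cons c cs)
  obtain d where d: "d \<in> set c" "f d \<in> set seen" using Cons.prems(1) by auto
  show ?case
  proof (rule Cons.hyps[of "c @ seen"])
    show "linked_from f (c @ seen) cs" using Cons.prems(1) by simp
    show "y \<in> S" if "x \<in> set (c @ seen)" "y \<in> set (c @ seen)" "x \<in> S" for x y
    proof -
      have cc: "a \<in> S \<longleftrightarrow> d \<in> S" if "a \<in> set c" for a
        using Cons.prems(2)[of c a d] Cons.prems(2)[of c d a] that d(1) list.set_intros(1)[of c cs] by blast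
      have ss: "a \<in> S \<longleftrightarrow> f d \<in> S" if "a \<in> set seen" for a
        using Cons.prems(3)[OF that d(2)] Cons.prems(3)[OF d(2) that] by blast
      have "d \<in> S \<longleftrightarrow> f d \<in> S" by (rule Cons.prems(4))
      moreover have "x \<in> S \<longleftrightarrow> d \<in> S" using that(1) cc[of x] ss[of x] calculation by auto
      moreover have "y \<in> S \<longleftrightarrow> d \<in> S" using that(2) cc[of y] ss[of y] calculation by auto
      ultimately show ?thesis using that(3) by blast
    qed
    show "x \<in> set (concat ((c @ seen) # cs))" "y \<in> set (concat ((c @ seen) # cs))" using Cons.prems(5,6) by auto
    show "b \<in> S" if "c' \<in> set cs" "a \<in> set c'" "b \<in> set c'" "a \<in> S" for c' a b
      by (rule Cons.prems(2)[OF list.set_intros(2)[OF that(1)] that(2-4)])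
  qed (rule Cons.prems(4), rule Cons.prems(7))
qed

lemma map_ok_facts:
  assumes "map_ok N vs es"
  shows "distinct (concat vs)" "set (concat vs) = {..<N}" "distinct (concat es)" "set (concat es) = {..<N}"
    "[] \<notin> set vs" "c \<in> set vs \<Longrightarrow> d \<in> set c \<Longrightarrow> orbit (perm_of vs) d = set c"
proof -
  show *: "distinct (concat vs)" "set (concat vs) = {..<N}" "distinct (concat es)" "set (concat es) = {..<N}"
    using assms partitionsD unfolding map_ok_def by blast+
  show "[] \<notin> set vs" using assms by (auto simp: map_ok_def list_all_iff)
  show "c \<in> set vs \<Longrightarrow> d \<in> set c \<Longrightarrow> orbit (perm_of vs) d = set c"
    by (rule cycle_orbit) (auto intro: perm_of_nth[OF *(1)])
qed

lemma comb_map_of: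
  assumes ok: "map_ok N vs es"
  shows "comb_map {..<N} (perm_of vs) (perm_of es)"
proof
  note F = map_ok_facts[OF ok]
  show "finite {..<N}" by simp
  show "{..<N} \<noteq> {}"
  proof -
    have hv: "hd vs \<in> set vs" using ok by (simp add: map_ok_def)
    then have "hd vs \<noteq> []" using F(5) by metis
    then have "hd (hd vs) \<in> set (concat vs)" unfolding set_concat using hv by (intro UN_I[of "hd vs"]) simp_all
    then show ?thesis using F(2) by blast
  qed
  show "perm_of vs permutes {..<N}" using perm_of_permutes[OF F(1)] F(2) by simp
  have ep: "perm_of es permutes {..<N}" using perm_of_permutes[OF F(3)] F(4) by simp
  fix d
  assume d: "d \<in> {..<N}"
  then show "perm_of es d \<in> {..<N}" using permutes_in_image[OF ep] by blast
  have "d \<in> set (concat es)" using d F(4) by simp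
  then obtain c i where c: "c \<in> set es" "i < length c" "d = c ! i" by (rule in_cycle)
  have "length c = 2" using ok c by (auto simp: map_ok_def list_all_iff)
  then obtain a b where ab: "c = [a, b]" by (auto simp: numeral_2_eq_2 length_Suc_conv)
  have "distinct c" using F(3) c(1) by (meson distinct_concat_iff)
  have "perm_of es a = b" "perm_of es b = a"
    using perm_of_nth[OF F(3) c(1), of 0] perm_of_nth[OF F(3) c(1), of 1] ab by simp_all
  moreover have "d = a \<or> d = b" using c ab by (auto simp: nth_Cons split: nat.splits)
  ultimately show "perm_of es (perm_of es d) = d" "perm_of es d \<noteq> d" using \<open>distinct c\<close> ab by auto
  have "d \<in> set (concat vs)" using d F(2) by simp
  then obtain c i where c: "c \<in> set vs" "i < length c" "d = c ! i" by (rule in_cycle)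
  have dc: "distinct c" using F(1) c(1) by (meson distinct_concat_iff)
  have l: "3 \<le> length c" using ok c by (auto simp: map_ok_def list_all_iff)
  have 1: "perm_of vs d = c ! (Suc i mod length c)" using perm_of_nth[OF F(1) c(1,2)] c(3) by simp
  have m: "Suc i mod length c < length c" using c(2) by (intro mod_less_divisor) auto
  have 2: "perm_of vs (perm_of vs d) = c ! (Suc (Suc i) mod length c)"
    using perm_of_nth[OF F(1) c(1) m] 1 by (simp add: mod_Suc_eq)
  have m2: "Suc (Suc i) mod length c < length c" using c(2) by (intro mod_less_divisor) auto
  have "Suc i mod length c \<noteq> i" "Suc (Suc i) mod length c \<noteq> i"
    using c(2) l by (auto simp: mod_Suc)
  then show "perm_of vs d \<noteq> d" "perm_of vs (perm_of vs d) \<noteq> d"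
    using 1 2 c nth_eq_iff_index_eq[OF dc m c(2)] nth_eq_iff_index_eq[OF dc m2 c(2)] by auto
next
  note F = map_ok_facts[OF ok]
  fix S assume S: "S \<subseteq> {..<N}" "S \<noteq> {}" "\<And>d. d \<in> S \<Longrightarrow> perm_of vs d \<in> S" "\<And>d. d \<in> S \<Longrightarrow> perm_of es d \<in> S"
  have cyc: "y \<in> S" if "c \<in> set vs" "x \<in> set c" "y \<in> set c" "x \<in> S" for c x y
  proof -
    have "y \<in> orbit (perm_of vs) x" using F(6)[OF that(1,2)] that(3) by simp
    then show ?thesis by induct (use S(3) that(4) in auto)
  qed
  have inv: "perm_of es (perm_of es x) = x" for x
  proof (cases "x \<in> set (concat es)")
    case True
    then obtain c i where c: "c \<in> set es" "i < length c" "x = c ! i" by (rule in_cycle)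
    have "length c = 2" using ok c by (auto simp: map_ok_def list_all_iff)
    moreover from this have "i = 0 \<or> i = 1" using c(2) by linarith
    ultimately have "Suc (Suc i mod length c) mod length c = i" by (elim disjE) simp_all
    moreover have "Suc i mod length c < length c" using c(2) by (intro mod_less_divisor) auto
    ultimately show ?thesis using perm_of_nth[OF F(3) c(1)] c(2,3) by simp
  next
    case False then show ?thesis using perm_of_other[of x es] by simp
  qed
  have vs: "vs = hd vs # tl vs" using ok by (simp add: map_ok_def)
  obtain x where x: "x \<in> S" using S(2) by blast
  have all: "set (concat (hd vs # tl vs)) = {..<N}" using F(2) vs by metis
  have "y \<in> S" if "y < N" for y
  proof (rule linked_closed[of "perm_of es" "hd vs" "tl vs" S x y])
    show "linked_from (perm_of es) (hd vs) (tl vs)" using ok by (simp add: map_ok_def)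
    show "b \<in> S" if "c \<in> set (tl vs)" "a \<in> set c" "b \<in> set c" "a \<in> S" for c a b
      using cyc[OF _ that(2-4)] that(1) vs by (metis list.set_intros(2))
    show "b \<in> S" if "a \<in> set (hd vs)" "b \<in> set (hd vs)" "a \<in> S" for a b
      using cyc[OF _ that] vs by (metis list.set_intros(1))
    show "a \<in> S \<longleftrightarrow> perm_of es a \<in> S" for a using S(4)[of a] S(4)[of "perm_of es a"] inv by auto
    show "x \<in> set (concat (hd vs # tl vs))" using all x S(1) by blast
    show "y \<in> set (concat (hd vs # tl vs))" using all that by blast
  qed (rule x)
  then show "S = {..<N}" using S(1) by auto
qed

section \<open>Flips of listed maps and certificates for their faces\<close>

definition flip_cycles :: "bool list \<Rightarrow> nat list list \<Rightarrow> nat list list" where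
  "flip_cycles bs vs = map (\<lambda>(b, c). if b then c else rev c) (zip bs vs)"

definition flip_bits :: "bool list \<Rightarrow> nat list list \<Rightarrow> nat \<Rightarrow> bool" where
  "flip_bits bs vs d = list_ex (\<lambda>(b, c). b \<and> d \<in> set c) (zip bs vs)"

lemma distinct_flip_cycles:
  assumes "length bs = length vs" "distinct (concat vs)"
  shows "distinct (concat (flip_cycles bs vs)) \<and> set (concat (flip_cycles bs vs)) = set (concat vs)"
  using assms by (induct bs vs rule: list_induct2) (auto simp: flip_cycles_def)

lemma index_unique:
  assumes "distinct (concat cs)" "i < length cs" "d \<in> set (cs ! i)" "j < length cs" "d \<in> set (cs ! j)"
  shows "i = j"
  using assms
proof (induct cs arbitrary: i j)
  case (Cons c cs)
  show ?case
  proof (cases i; cases j)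
    fix i' j' assume "i = Suc i'" "j = Suc j'"
    then show ?thesis using Cons by simp
  qed (use Cons in \<open>auto dest!: nth_mem\<close>)
qed simp

lemma flip_bits_nth:
  assumes "length bs = length vs" "distinct (concat vs)" "i < length vs" "d \<in> set (vs ! i)"
  shows "flip_bits bs vs d = bs ! i"
proof
  assume "bs ! i"
  then show "flip_bits bs vs d" using assms
    by (auto simp: flip_bits_def list_ex_iff in_set_zip intro!: bexI[of _ "(True, vs ! i)"] exI[of _ i])
next
  assume "flip_bits bs vs d"
  then obtain j where j: "j < length vs" "bs ! j" "d \<in> set (vs ! j)"
    by (auto simp: flip_bits_def list_ex_iff in_set_zip)
  have "i = j" by (rule index_unique[OF assms(2-4) j(1,3)])
  then show "bs ! i" using j by simp
qed

lemma perm_of_cong: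
  assumes "distinct (concat cs)" "distinct (concat cs')" "c \<in> set cs" "c \<in> set cs'" "d \<in> set c"
  shows "perm_of cs d = perm_of cs' d"
  using perm_of_nth[OF assms(1,3)] perm_of_nth[OF assms(2,4)] assms(5) by (auto simp: in_set_conv_nth)

lemma flip_perm_of:
  assumes "length bs = length vs" "distinct (concat vs)"
  shows "flip (flip_bits bs vs) (perm_of vs) = perm_of (flip_cycles bs vs)"
proof
  fix d
  note D = distinct_flip_cycles[OF assms]
  show "flip (flip_bits bs vs) (perm_of vs) d = perm_of (flip_cycles bs vs) d"
  proof (cases "d \<in> set (concat vs)")
    case False
    moreover have "perm_of (map rev vs) d = d" using False by (intro perm_of_other) auto
    moreover have "d \<notin> set (concat (flip_cycles bs vs))" using False unfolding conjunct2[OF D] .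
    then have "perm_of (flip_cycles bs vs) d = d" by (rule perm_of_other)
    moreover have "perm_of vs d = d" using False by (rule perm_of_other)
    ultimately show ?thesis by (simp add: flip_def inv_perm_of[OF assms(2)])
  next
    case True
    then obtain i where i: "i < length vs" "d \<in> set (vs ! i)" by (rule in_cycle_index)
    have fc: "(if bs ! i then vs ! i else rev (vs ! i)) \<in> set (flip_cycles bs vs)"
      using nth_mem[of i "flip_cycles bs vs"] i(1) assms(1) by (simp add: flip_cycles_def)
    show ?thesis
    proof (cases "bs ! i")
      case True
      then show ?thesis using perm_of_cong[OF assms(2) conjunct1[OF D], of "vs ! i" d] fc i flip_bits_nth[OF assms i]
        by (simp add: flip_def)
    next
      case False
      have "perm_of (map rev vs) d = perm_of (flip_cycles bs vs) d"
        using perm_of_cong[of "map rev vs" "flip_cycles bs vs" "rev (vs ! i)" d] D fc i False assms(2)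
        by (simp add: distinct_concat_rev)
      then show ?thesis using False flip_bits_nth[OF assms i] by (simp add: flip_def inv_perm_of[OF assms(2)])
    qed
  qed
qed

text \<open>Cycles that partition the darts and follow the face successor are exactly the faces of
  the flipped map, so the genus depends only on the lengths of the lists.\<close>

definition faces_ok :: "nat \<Rightarrow> nat list list \<Rightarrow> nat list list \<Rightarrow> bool list \<Rightarrow> nat list list \<Rightarrow> bool" where
  "faces_ok N vs es bs fs \<longleftrightarrow> length bs = length vs \<and> partitions N fs \<and>
     list_all (\<lambda>c. c \<noteq> [] \<and> map (\<lambda>d. perm_of (flip_cycles bs vs) (perm_of es d)) c = rotate1 c) fs"

primrec labelled :: "(nat \<Rightarrow> nat) \<Rightarrow> nat \<Rightarrow> nat list list \<Rightarrow> bool" where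
  "labelled r k [] = True"
| "labelled r k (c # cs) = (list_all (\<lambda>d. r d = k) c \<and> labelled r (k + 1) cs)"

text \<open>With \<open>r\<close> giving the face across each edge, \<open>k\<close> followed by the
  neighbours of face \<open>k\<close> has no repetition: no dual loop and no dual double edge at
  this face.\<close>

primrec neighbours_distinct :: "(nat \<Rightarrow> nat) \<Rightarrow> nat \<Rightarrow> nat list list \<Rightarrow> bool" where
  "neighbours_distinct r k [] = True"
| "neighbours_distinct r k (c # cs) = (distinct (k # map r c) \<and> neighbours_distinct r (k + 1) cs)"

definition good_faces :: "nat list list \<Rightarrow> nat list list \<Rightarrow> bool" where
  "good_faces es fs \<longleftrightarrow> (\<exists>r. labelled r 0 fs \<and> neighbours_distinct (\<lambda>d. r (perm_of es d)) 0 fs)"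

text \<open>To check concrete lists by rewriting, the permutations are replaced by arbitrary functions
  that are only known through their tables.\<close>

lemma map_okI:
  assumes "partitions N vs" "partitions N es" "vs \<noteq> []" "list_all (\<lambda>c. 3 \<le> length c) vs"
    "list_all (\<lambda>c. length c = 2) es" "\<And>f. cyclic_perm f es \<Longrightarrow> linked_from f (hd vs) (tl vs)"
  shows "map_ok N vs es"
  using assms cyclic_perm_of[of es] by (auto simp: map_ok_def partitions_def)

lemma faces_okI:
  assumes ok: "map_ok N vs es" and len: "length bs = length vs" and part: "partitions N fs"
    and tab: "\<And>f g. cyclic_perm f (flip_cycles bs vs) \<Longrightarrow> cyclic_perm g es \<Longrightarrow>
      list_all (\<lambda>c. c \<noteq> [] \<and> map (\<lambda>d. f (g d)) c = rotate1 c) fs"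
  shows "faces_ok N vs es bs fs"
  using tab[OF cyclic_perm_of cyclic_perm_of] len part distinct_flip_cycles[OF len] map_ok_facts(1,3)[OF ok]
  by (simp add: faces_ok_def)

lemma labelled_iff: "labelled r k cs \<longleftrightarrow> (\<forall>i<length cs. \<forall>d\<in>set (cs ! i). r d = k + i)"
proof (induct cs arbitrary: k)
  case (Cons c cs)
  then show ?case by (auto simp: list_all_iff nth_Cons split: nat.splits)
qed simp

lemma neighbours_distinct_iff:
  "neighbours_distinct r k cs \<longleftrightarrow> (\<forall>i<length cs. distinct ((k + i) # map r (cs ! i)))"
proof (induct cs arbitrary: k)
  case (Cons c cs)
  have "(\<forall>i<length (c # cs). distinct ((k + i) # map r ((c # cs) ! i))) \<longleftrightarrow>
    distinct (k # map r c) \<and> (\<forall>i<length cs. distinct ((k + 1 + i) # map r (cs ! i)))"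
    by (simp only: length_Cons All_less_Suc2) simp
  then show ?case using Cons by simp
qed simp

lemma good_facesI:
  assumes ok: "map_ok N vs es" and fok: "faces_ok N vs es bs fs"
    and tab: "\<And>g r. cyclic_perm g es \<Longrightarrow> labelled r 0 fs \<Longrightarrow> neighbours_distinct (\<lambda>d. r (g d)) 0 fs"
  shows "good_faces es fs"
proof -
  have "distinct (concat fs)" using fok partitionsD by (auto simp: faces_ok_def)
  note unique = index_unique[OF this]
  define r where "r d = (THE i. i < length fs \<and> d \<in> set (fs ! i))" for d
  have "r d = i" if "i < length fs" "d \<in> set (fs ! i)" for i d
    unfolding r_def using that unique by (intro the_equality) blast+
  then have "labelled r 0 fs" by (simp add: labelled_iff)
  then show ?thesis using tab[OF cyclic_perm_of[OF map_ok_facts(3)[OF ok]]] unfolding good_faces_def by blast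
qed

context
  fixes N vs es bs fs
  assumes ok: "map_ok N vs es" and fok: "faces_ok N vs es bs fs"
begin

interpretation comb_map "{..<N}" "perm_of vs" "perm_of es"
  by (rule comb_map_of[OF ok])

lemma invariant_bits: "invariant (flip_bits bs vs)"
proof (rule invariantI)
  fix d assume "d \<in> {..<N}"
  then have "d \<in> set (concat vs)" using map_ok_facts(2)[OF ok] by blast
  then obtain i where i: "i < length vs" "d \<in> set (vs ! i)" by (rule in_cycle_index)
  have "perm_of vs d \<in> set (vs ! i)" using map_ok_facts(6)[OF ok nth_mem[OF i(1)] i(2)] orbit.base[of "perm_of vs" d] by simp
  then show "flip_bits bs vs (perm_of vs d) = flip_bits bs vs d"
    using flip_bits_nth[OF _ map_ok_facts(1)[OF ok] i(1)] i(2) fok by (simp add: faces_ok_def)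
qed

interpretation Fl: comb_map "{..<N}" "flip (flip_bits bs vs) (perm_of vs)" "perm_of es"
  by (rule comb_map_flip[OF invariant_bits])

lemma faces_facts: "distinct (concat fs)" "set (concat fs) = {..<N}" "[] \<notin> set fs"
proof -
  show "distinct (concat fs)" "set (concat fs) = {..<N}"
    using fok partitionsD unfolding faces_ok_def by blast+
  show "[] \<notin> set fs" using fok by (auto simp: faces_ok_def list_all_iff)
qed

lemma face_orbit:
  assumes "c \<in> set fs" "d \<in> set c"
  shows "orbit (comb_map.phi (flip (flip_bits bs vs) (perm_of vs)) (perm_of es)) d = set c"
proof (rule cycle_orbit[OF _ assms(2)])
  have "length bs = length vs" using fok by (simp add: faces_ok_def)
  note fp = flip_perm_of[OF this map_ok_facts(1)[OF ok]]
  have "Fl.phi = (\<lambda>d. perm_of (flip_cycles bs vs) (perm_of es d))"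
    by (rule ext) (subst Fl.phi_def, simp only: fp)
  then have "map Fl.phi c = rotate1 c" using fok assms(1) by (simp add: faces_ok_def list_all_iff)
  then show "Fl.phi (c ! i) = c ! (Suc i mod length c)" if "i < length c" for i
    by (rule rotate1_cycle[OF _ that])
qed

lemma genus_of:
  assumes "2 * int (length vs) + 2 * int (length fs) = int N + 4 - 4 * h"
  shows "comb_map.genus {..<N} (flip (flip_bits bs vs) (perm_of vs)) (perm_of es) h"
proof -
  have "orbit (flip (flip_bits bs vs) (perm_of vs)) ` {..<N} = orbit (perm_of vs) ` {..<N}"
    by (rule image_cong[OF refl flip_orbit[OF invariant_bits]])
  moreover have "card (orbit (perm_of vs) ` {..<N}) = length vs"
    using orbits_cycles[of vs] map_ok_facts[OF ok] by metis
  moreover have "card (orbit Fl.phi ` {..<N}) = length fs"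
    using orbits_cycles[of fs] faces_facts face_orbit by metis
  ultimately show ?thesis using assms by (simp add: Fl.genus_def)
qed

lemma good_of:
  assumes "good_faces es fs"
  shows "comb_map.good {..<N} (flip (flip_bits bs vs) (perm_of vs)) (perm_of es)"
  unfolding Fl.good_def
proof (intro conjI ballI impI)
  obtain r where r: "labelled r 0 fs" "neighbours_distinct (\<lambda>d. r (perm_of es d)) 0 fs"
    using assms by (auto simp: good_faces_def)
  fix d assume d: "d \<in> {..<N}"
  have "d \<in> set (concat fs)" using d faces_facts(2) by simp
  then obtain i where i: "i < length fs" "d \<in> set (fs ! i)" by (rule in_cycle_index)
  have od: "orbit Fl.phi d = set (fs ! i)" using face_orbit[OF nth_mem[OF i(1)] i(2)] .
  have rd: "r x = i" if "x \<in> set (fs ! i)" for x using r(1) i(1) that by (simp add: labelled_iff)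
  have nd: "i \<notin> (\<lambda>d. r (perm_of es d)) ` set (fs ! i)" "inj_on (\<lambda>d. r (perm_of es d)) (set (fs ! i))"
    using r(2) i(1) by (auto simp: neighbours_distinct_iff distinct_map)
  have const: "r x = r y" if "x \<in> {..<N}" "y \<in> orbit Fl.phi x" for x y
  proof -
    have "x \<in> set (concat fs)" using that(1) faces_facts(2) by simp
    then obtain j where j: "j < length fs" "x \<in> set (fs ! j)" by (rule in_cycle_index)
    then have "y \<in> set (fs ! j)" using face_orbit[OF nth_mem[OF j(1)] j(2)] that(2) by simp
    then show ?thesis using r(1) j by (simp add: labelled_iff)
  qed
  show "orbit Fl.phi d \<noteq> orbit Fl.phi (perm_of es d)"
  proof
    assume "orbit Fl.phi d = orbit Fl.phi (perm_of es d)"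
    then have "perm_of es d \<in> set (fs ! i)" using od Fl.phi_orbit_self[OF al_in[OF d]] by simp
    then have "r (perm_of es d) = i" by (rule rd)
    then show False using nd(1) i(2) by blast
  qed
  fix e assume e: "e \<in> {..<N}" "orbit Fl.phi d = orbit Fl.phi e" "orbit Fl.phi (perm_of es d) = orbit Fl.phi (perm_of es e)"
  have "e \<in> set (fs ! i)" using e(2) od Fl.phi_orbit_self[OF e(1)] by simp
  moreover have "r (perm_of es d) = r (perm_of es e)"
    using const[OF al_in[OF d], of "perm_of es e"] e(3) Fl.phi_orbit_self[OF al_in[OF e(1)]] by simp
  ultimately show "d = e" using inj_onD[OF nd(2)] i(2) by blast
qed

end

section \<open>The building blocks\<close>

text \<open>The darts below 1, or below 2 for the blocks \<open>theta\<close> and \<open>flexible\<close>, are the marks. The faces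
  belong to the map in which the vertices with the bit \<open>False\<close> are flipped. The blocks were
  found by a computer search. The map \<open>flexible\<close> has simple dual under all four flips, with genus 13
  if \<open>a = b\<close> and 14 otherwise; \<open>theta\<close> has genus 1 with an edge that meets only one face if \<open>a = b\<close>,
  and is planar with simple dual otherwise. The map \<open>heawood\<close> is the Heawood graph with a loop at every
  vertex but the marked one; the flips listed for it are toroidal with simple dual.\<close>

definition marker_rot :: "nat list list" where
  "marker_rot =
  [[0,1,2,3,4,5,6],[7,8,9,10,11]]"

text \<open>Dart 3 stands between the loops \<open>{1, 2}\<close> and \<open>{4, 5}\<close> and
  becomes the seed. Its edge enters the second vertex at dart 7, and the edge \<open>{6, 11}\<close>
  leads from there back to the marked vertex. The third loop \<open>{8, 9}\<close> makes dart 7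
  asymmetric.\<close>

definition marker_edges :: "nat list list" where
  "marker_edges =
  [[1,2],[3,7],[4,5],[0,10],[6,11],[8,9]]"

definition marker_faces :: "nat list list" where
  "marker_faces = [[0,11],[1,3,8,10],[2],[4,6,7],[5],[9]]"

definition theta_rot :: "nat list list" where
  "theta_rot =
  [[0,2,4,5,6],[1,3,7,8,9]]"

definition theta_edges :: "nat list list" where
  "theta_edges =
  [[0,2],[1,3],[4,7],[5,8],[6,9]]"

definition theta_faces :: "bool \<Rightarrow> bool \<Rightarrow> nat list list" where
  "theta_faces a b =
    (if a then if b then
   [[0,4,8,6,1,7,5,9],[2],[3]]
   else
   [[0,4,3,9],[1],[2],[5,7],[6,8]]
   else if b then
   [[0],[1,7,2,6],[3],[4,8],[5,9]]
   else
   [[0],[1],[2,6,8,4,3,9,5,7]])"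

definition flexible_rot :: "nat list list" where
  "flexible_rot =
  [
   [0,2,4,5,6,7,8,9,10,11,12,13,14,15,16,17,18,19,20,21,22,23,24,25,26,27,28,29,30,31,32,33,34,35,36,37,38,39,40,41,42,43,44,45],
   [1,3,46,47,48,49,50,51,52,53,54,55,56,57,58,59,60,61,62,63,64,65,66,67,68,69,70,71,72,73,74,75,76,77,78,79,80,81,82,83,84,85,86,87]]"

definition flexible_edges :: "nat list list" where
  "flexible_edges =
  [[0,2],[1,3],[4,46],[5,52],[6,62],[7,57],[8,65],[9,75],[10,79],[11,54],[12,67],[13,82],[14,70],
   [15,77],[16,49],[17,63],[18,69],[19,83],[20,66],[21,72],[22,86],[23,80],[24,74],[25,84],
   [26,68],[27,61],[28,71],[29,55],[30,47],[31,58],[32,53],[33,87],[34,60],[35,64],[36,48],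
   [37,78],[38,51],[39,56],[40,81],[41,85],[42,73],[43,50],[44,76],[45,59]]"

definition flexible_faces :: "bool \<Rightarrow> bool \<Rightarrow> nat list list" where
  "flexible_faces a b =
    (if a then if b then
   [[0,4,47,31,59],[1,46,5,53,33],[2],[3],[6,63,18,70,15,78,38,52],[7,58,32,54,12,68,27,62],
   [8,66,21,73,43,51,39,57],[9,76,45,60,35,65],[10,80,24,75],[11,55,30,48,37,79],[13,83,20,67],
   [14,71,29,56,40,82],[16,50,44,77],[17,64,36,49],[19,84,26,69],[22,87,34,61,28,72],
   [23,81,41,86],[25,85,42,74]]
   else
   [[0,4,3,87,34,59],[1],[2],[5,51,39,55,30,46],[6,61,28,70,15,76,45,58,32,52],
   [7,56,40,80,24,73,43,49,17,62],[8,64,36,47,31,57],[9,74,25,83,20,65],[10,78,38,50,44,75],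
   [11,53,33,86,23,79],[12,66,21,71,29,54],[13,81,41,84,26,67],[14,69,19,82],[16,48,37,77],
   [18,68,27,60,35,63],[22,85,42,72]]
   else if b then
   [[0],[1,46,2,45,60,33],[3],[4,47,29,56,38,52],[5,53,31,59,44,77,14,71,27,62],
   [6,63,16,50,42,74,23,81,39,57],[7,58,30,48,35,65],[8,66,19,84,24,75],[9,76,43,51,37,79],
   [10,80,22,87,32,54],[11,55,28,72,20,67],[12,68,25,85,40,82],[13,83,18,70],[15,78,36,49],
   [17,64,34,61,26,69],[21,73,41,86]]
   else
   [[0],[1],[2,45,58,30,46],[3,87,32,52,4],[5,51,37,77,14,69,17,62],[6,61,26,67,11,53,31,57],
   [7,56,38,50,42,72,20,65],[8,64,34,59,44,75],[9,74,23,79],[10,78,36,47,29,54],[12,66,19,82],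
   [13,81,39,55,28,70],[15,76,43,49],[16,48,35,63],[18,68,25,83],[21,71,27,60,33,86],
   [22,85,40,80],[24,73,41,84]])"

definition heawood_rot :: "nat list list" where
  "heawood_rot =
  [[0,1,2],[3,4,5,6,7],[8,9,10,11,12],[13,14,15,16,17],[18,19,20,21,22],[23,24,25,26,27],
   [28,29,30,31,32],[33,34,35,36,37],[38,39,40,41,42],[43,44,45,46,47],[48,49,50,51,52],
   [53,54,55,56,57],[58,59,60,61,62],[63,64,65,66,67]]"

definition heawood_edges :: "nat list list" where
  "heawood_edges =
  [[0,3],[1,8],[2,13],[4,5],[6,18],[7,23],[9,10],[11,28],[12,33],[14,15],[16,43],[17,38],[19,20],
   [21,48],[22,53],[24,25],[26,58],[27,63],[29,30],[31,67],[32,52],[34,35],[36,61],[37,57],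
   [39,40],[41,62],[42,51],[44,45],[46,56],[47,66],[49,50],[54,55],[59,60],[64,65]]"

text \<open>The leading bit belongs to the marked vertex and is always \<open>True\<close>: the
  copies then agree at the merged vertex, and no two choices are mirror images of each
  other.\<close>

definition heawood_bits :: "bool list list" where
  "heawood_bits =
   [[True,True,False,False,False,False,True,True,False,False,True,True,False,False],
    [True,False,False,False,True,False,True,False,False,True,True,True,True,True],
    [True,False,True,False,False,False,False,False,True,True,True,False,False,True],
    [True,True,False,True,True,False,False,True,True,False,True,False,False,True],
    [True,False,True,True,False,True,False,True,False,True,True,True,False,False],
    [True,False,False,True,True,True,False,False,False,False,False,True,False,True],
    [True,True,True,False,False,True,True,False,True,False,False,True,False,True],
    [True,True,True,True,True,True,True,True,True,True,True,True,True,True]]"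

definition heawood_faces :: "nat list list list" where
  "heawood_faces =
  [[[0,4,6,22,54,56,45,43,15,13],[1,12,34,36,60,58,25,23,3],[2,17,42,52,28,10,8],[5],
   [7,27,67,32,48,20,18],[9],[11,29,31,66,46,57,33],[14],[16,47,65,63,26,62,40,38],[19],
   [21,49,51,41,61,37,53],[24],[30],[35],[39],[44],[50],[55],[59],[64]],
   [[0,7,27,64,66,43,15,13],[1,12,37,53,18,5,3],[2,17,42,52,28,10,8],[4],
   [6,19,21,49,51,41,58,25,23],[9],[11,29,31,63,26,59,61,35,33],[14],[16,44,46,57,36,62,40,38],
   [20],[22,54,56,47,67,32,48],[24],[30],[34],[39],[45],[50],[55],[60],[65]],
   [[0,7,27,64,66,43,15,13],[1,9,11,32,48,20,18,5,3],[2,17,39,41,61,35,33,8],[4],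
   [6,22,57,36,60,58,25,23],[10],[12,37,56,47,67,30,28],[14],[16,44,46,55,53,21,49,51,38],[19],
   [24],[26,62,42,52,31,63],[29],[34],[40],[45],[50],[54],[59],[65]],
   [[0,4,6,19,21,49,51,38,13],[1,12,34,36,60,58,25,23,3],[2,14,16,47,67,30,28,10,8],[5],
   [7,27,64,66,46,55,53,18],[9],[11,32,48,22,57,33],[15],[17,39,41,61,37,56,45,43],[20],[24],
   [26,62,42,52,31,63],[29],[35],[40],[44],[50],[54],[59],[65]],
   [[0,7,24,26,62,40,38,13],[1,9,11,32,48,20,18,5,3],[2,14,16,44,46,57,33,8],[4],
   [6,22,54,56,47,65,63,23],[10],[12,34,36,60,58,27,67,30,28],[15],[17,42,52,31,66,43],[19],
   [21,49,51,41,61,37,53],[25],[29],[35],[39],[45],[50],[55],[59],[64]],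
   [[0,7,24,26,62,40,38,13],[1,12,37,53,18,5,3],[2,14,16,47,67,30,28,10,8],[4],
   [6,19,21,52,31,63,23],[9],[11,32,51,41,61,35,33],[15],[17,42,50,48,22,54,56,45,43],[20],[25],
   [27,64,66,46,57,36,60,58],[29],[34],[39],[44],[49],[55],[59],[65]],
   [[0,4,6,22,54,56,45,43,15,13],[1,9,11,29,31,63,23,3],[2,17,39,41,61,35,33,8],[5],
   [7,24,26,62,42,50,48,20,18],[10],[12,37,53,21,52,28],[14],[16,47,67,32,51,38],[19],[25],
   [27,64,66,46,57,36,60,58],[30],[34],[40],[44],[49],[55],[59],[65]],
   [[0,4,6,19,21,49,51,38,13],[1,9,11,29,31,63,23,3],[2,14,16,44,46,57,33,8],[5],
   [7,24,26,59,61,37,53,18],[10],[12,34,36,62,42,52,28],[15],[17,39,41,58,27,64,66,43],[20],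
   [22,54,56,47,67,32,48],[25],[30],[35],[40],[45],[50],[55],[60],[65]]]"

section \<open>Verification of the tables\<close>

lemma marker_map_ok: "map_ok 12 marker_rot marker_edges"
proof (rule map_okI)
  show "partitions 12 marker_rot" "partitions 12 marker_edges" "marker_rot \<noteq> []" "list_all (\<lambda>c. 3 \<le> length c) marker_rot"
    "list_all (\<lambda>c. length c = 2) marker_edges"
    by (simp_all add: partitions_def marker_rot_def marker_edges_def)
  fix f assume P: "cyclic_perm f marker_edges"
  note P1 = P[unfolded marker_edges_def cyclic_perm_def, simplified]
  show "linked_from f (hd marker_rot) (tl marker_rot)" by (simp add: marker_rot_def P1)
qed

lemma theta_map_ok: "map_ok 10 theta_rot theta_edges"
proof (rule map_okI)
  show "partitions 10 theta_rot" "partitions 10 theta_edges" "theta_rot \<noteq> []" "list_all (\<lambda>c. 3 \<le> length c) theta_rot"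
    "list_all (\<lambda>c. length c = 2) theta_edges"
    by (simp_all add: partitions_def theta_rot_def theta_edges_def)
  fix f assume P: "cyclic_perm f theta_edges"
  note P1 = P[unfolded theta_edges_def cyclic_perm_def, simplified]
  show "linked_from f (hd theta_rot) (tl theta_rot)" by (simp add: theta_rot_def P1)
qed

lemma flexible_map_ok: "map_ok 88 flexible_rot flexible_edges"
proof (rule map_okI)
  show "partitions 88 flexible_rot" "partitions 88 flexible_edges" "flexible_rot \<noteq> []" "list_all (\<lambda>c. 3 \<le> length c) flexible_rot"
    "list_all (\<lambda>c. length c = 2) flexible_edges"
    by (simp_all add: partitions_def flexible_rot_def flexible_edges_def)
  fix f assume P: "cyclic_perm f flexible_edges"
  note P1 = P[unfolded flexible_edges_def cyclic_perm_def, simplified]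
  show "linked_from f (hd flexible_rot) (tl flexible_rot)" by (simp add: flexible_rot_def P1)
qed

lemma heawood_map_ok: "map_ok 68 heawood_rot heawood_edges"
proof (rule map_okI)
  show "partitions 68 heawood_rot" "partitions 68 heawood_edges" "heawood_rot \<noteq> []" "list_all (\<lambda>c. 3 \<le> length c) heawood_rot"
    "list_all (\<lambda>c. length c = 2) heawood_edges"
    by (simp_all add: partitions_def heawood_rot_def heawood_edges_def)
  fix f assume P: "cyclic_perm f heawood_edges"
  note P1 = P[unfolded heawood_edges_def cyclic_perm_def, simplified]
  show "linked_from f (hd heawood_rot) (tl heawood_rot)" by (simp add: heawood_rot_def P1)
qed

lemma marker_faces_ok:
  "faces_ok 12 marker_rot marker_edges [True, True] marker_faces"
proof (rule faces_okI[OF marker_map_ok])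
  show "length [True, True] = length marker_rot" by - (simp_all add: marker_faces_def marker_rot_def)
  show "partitions 12 marker_faces" by - (simp_all add: partitions_def marker_faces_def)
  fix f g assume "cyclic_perm f (flip_cycles [True, True] marker_rot)" "cyclic_perm g marker_edges"
  then show "list_all (\<lambda>c. c \<noteq> [] \<and> map (\<lambda>d. f (g d)) c = rotate1 c) marker_faces"
    by - (simp_all add: marker_faces_def marker_rot_def marker_edges_def flip_cycles_def cyclic_perm_def)
qed

lemma marker_good: "good_faces marker_edges marker_faces"
proof (rule good_facesI[OF marker_map_ok marker_faces_ok])
  fix g r assume "cyclic_perm g marker_edges" "labelled r 0 marker_faces"
  then show "neighbours_distinct (\<lambda>d. r (g d)) 0 marker_faces"
    by - (simp_all add: marker_faces_def marker_edges_def cyclic_perm_def)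
qed

lemma theta_faces_ok:
  "faces_ok 10 theta_rot theta_edges [a, b] (theta_faces a b)"
proof (rule faces_okI[OF theta_map_ok])
  show "length [a, b] = length theta_rot" by (cases a; cases b) (simp_all add: theta_faces_def theta_rot_def)
  show "partitions 10 (theta_faces a b)" by (cases a; cases b) (simp_all add: partitions_def theta_faces_def)
  fix f g assume "cyclic_perm f (flip_cycles [a, b] theta_rot)" "cyclic_perm g theta_edges"
  then show "list_all (\<lambda>c. c \<noteq> [] \<and> map (\<lambda>d. f (g d)) c = rotate1 c) (theta_faces a b)"
    by (cases a; cases b) (simp_all add: theta_faces_def theta_rot_def theta_edges_def flip_cycles_def cyclic_perm_def)
qed

lemma theta_good:
  assumes "a \<noteq> b"
  shows "good_faces theta_edges (theta_faces a b)"
proof (rule good_facesI[OF theta_map_ok theta_faces_ok])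
  fix g r assume "cyclic_perm g theta_edges" "labelled r 0 (theta_faces a b)"
  then show "neighbours_distinct (\<lambda>d. r (g d)) 0 (theta_faces a b)"
    using assms by (cases a; cases b) (simp_all add: theta_faces_def theta_edges_def cyclic_perm_def)
qed

lemma flexible_faces_ok:
  "faces_ok 88 flexible_rot flexible_edges [a, b] (flexible_faces a b)"
proof (rule faces_okI[OF flexible_map_ok])
  show "length [a, b] = length flexible_rot" by (cases a; cases b) (simp_all add: flexible_faces_def flexible_rot_def)
  show "partitions 88 (flexible_faces a b)" by (cases a; cases b) (simp_all add: partitions_def flexible_faces_def)
  fix f g assume "cyclic_perm f (flip_cycles [a, b] flexible_rot)" "cyclic_perm g flexible_edges"
  then show "list_all (\<lambda>c. c \<noteq> [] \<and> map (\<lambda>d. f (g d)) c = rotate1 c) (flexible_faces a b)"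
    by (cases a; cases b) (simp_all add: flexible_faces_def flexible_rot_def flexible_edges_def flip_cycles_def cyclic_perm_def)
qed

lemma flexible_good: "good_faces flexible_edges (flexible_faces a b)"
proof (rule good_facesI[OF flexible_map_ok flexible_faces_ok])
  fix g r assume "cyclic_perm g flexible_edges" "labelled r 0 (flexible_faces a b)"
  then show "neighbours_distinct (\<lambda>d. r (g d)) 0 (flexible_faces a b)"
    by (cases a; cases b) (simp_all add: flexible_faces_def flexible_edges_def cyclic_perm_def)
qed

lemma below_8:
  fixes b :: nat
  assumes "b < 8"
  shows "b \<in> {0, 1, 2, 3, 4, 5, 6, 7}"
  using assms by auto

lemma heawood_faces_ok:
  assumes b: "b < 8"
  shows "faces_ok 68 heawood_rot heawood_edges (heawood_bits ! b) (heawood_faces ! b)"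
proof (rule faces_okI[OF heawood_map_ok])
  show "length (heawood_bits ! b) = length heawood_rot"
    using below_8[OF b] by (elim insertE emptyE) (simp_all add: heawood_bits_def heawood_rot_def)
  show "partitions 68 (heawood_faces ! b)"
    using below_8[OF b] by (elim insertE emptyE) (simp_all add: partitions_def heawood_faces_def)
  fix f g assume "cyclic_perm f (flip_cycles (heawood_bits ! b) heawood_rot)" "cyclic_perm g heawood_edges"
  then show "list_all (\<lambda>c. c \<noteq> [] \<and> map (\<lambda>d. f (g d)) c = rotate1 c) (heawood_faces ! b)"
    using below_8[OF b] by (elim insertE emptyE)
      (simp_all add: heawood_faces_def heawood_bits_def heawood_rot_def heawood_edges_def flip_cycles_def cyclic_perm_def)
qed

lemma heawood_good:
  assumes b: "b < 8"
  shows "good_faces heawood_edges (heawood_faces ! b)"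
proof (rule good_facesI[OF heawood_map_ok heawood_faces_ok[OF b]])
  fix g r assume "cyclic_perm g heawood_edges" "labelled r 0 (heawood_faces ! b)"
  then show "neighbours_distinct (\<lambda>d. r (g d)) 0 (heawood_faces ! b)"
    using below_8[OF b] by (elim insertE emptyE) (simp_all add: heawood_faces_def heawood_edges_def cyclic_perm_def)
qed

text \<open>Vertices minus edges are 2 - 6, 2 - 5, 2 - 44 and 14 - 34. By Euler's formula these face
  counts mean genus 0 for the marker, 1 or 0 for \<open>theta\<close>, 13 or 14 for
  \<open>flexible\<close>, and 1 for \<open>heawood\<close>.\<close>

lemma number_of_faces:
  "length marker_faces = 6" "length (theta_faces a b) = (if a = b then 3 else 5)"
  "length (flexible_faces a b) = (if a = b then 18 else 16)" "b' < 8 \<Longrightarrow> length (heawood_faces ! b') = 20"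
proof -
  show "b' < 8 \<Longrightarrow> length (heawood_faces ! b') = 20"
    by (drule below_8, elim insertE emptyE) (simp_all add: heawood_faces_def)
qed (simp_all add: marker_faces_def theta_faces_def flexible_faces_def)

lemma marked_tables:
  "cyclic_perm f theta_rot \<Longrightarrow> f 0 = 2 \<and> f 1 = 3" "cyclic_perm f theta_edges \<Longrightarrow> f 0 = 2 \<and> f 1 = 3 \<and> f 4 = 7"
  "cyclic_perm f flexible_rot \<Longrightarrow> f 0 = 2 \<and> f 1 = 3" "cyclic_perm f flexible_edges \<Longrightarrow> f 0 = 2 \<and> f 1 = 3"
  by (simp_all add: cyclic_perm_def theta_rot_def theta_edges_def flexible_rot_def flexible_edges_def)

lemma marked_loops:
  assumes "k < 2"
  shows "perm_of theta_edges k = k + 2" "perm_of theta_rot k = k + 2"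
    "perm_of flexible_edges k = k + 2" "perm_of flexible_rot k = k + 2"
proof -
  have k: "k = 0 \<or> k = 1" using assms by auto
  note cyc = theta_map_ok[THEN map_ok_facts(1), THEN cyclic_perm_of] theta_map_ok[THEN map_ok_facts(3), THEN cyclic_perm_of]
    flexible_map_ok[THEN map_ok_facts(1), THEN cyclic_perm_of] flexible_map_ok[THEN map_ok_facts(3), THEN cyclic_perm_of]
  show "perm_of theta_edges k = k + 2" "perm_of theta_rot k = k + 2"
    "perm_of flexible_edges k = k + 2" "perm_of flexible_rot k = k + 2"
    using k marked_tables(1)[OF cyc(1)] marked_tables(2)[OF cyc(2)] marked_tables(3)[OF cyc(3)] marked_tables(4)[OF cyc(4)]
    by (elim disjE; simp)+
qed

text \<open>These are the insides of the marked loops \<open>{k, k + 2}\<close>. Reversing the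
  vertex exchanges which of the two darts of the loop runs along the inside.\<close>

lemma marked_faces:
  assumes "k < 2"
  shows "[if [a, b] ! k then k + 2 else k] \<in> set (theta_faces a b)"
    "[if [a, b] ! k then k + 2 else k] \<in> set (flexible_faces a b)"
  using assms by (cases a; cases b; auto simp: theta_faces_def flexible_faces_def less_2_cases_iff)+

lemma theta_edge_one_face:
  obtains c where "c \<in> set (theta_faces a a)" "4 \<in> set c" "7 \<in> set c"
  by (rule that[of "if a then [0,4,8,6,1,7,5,9] else [2,6,8,4,3,9,5,7]"]) (simp_all add: theta_faces_def)

lemma theta_edge: "perm_of theta_edges 4 = 7"
  using marked_tables(2)[OF cyclic_perm_of[OF map_ok_facts(3)[OF theta_map_ok]]] by simp

lemma rot_facts:
  "length theta_rot = 2" "length flexible_rot = 2" "length marker_rot = 2" "length heawood_rot = 14"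
  "k < 2 \<Longrightarrow> k \<in> set (theta_rot ! k)" "k < 2 \<Longrightarrow> k \<in> set (flexible_rot ! k)"
  by (auto simp: theta_rot_def flexible_rot_def marker_rot_def heawood_rot_def less_2_cases_iff)

section \<open>Chains of building blocks\<close>

definition flips :: "(nat \<Rightarrow> nat list list) \<Rightarrow> (nat \<Rightarrow> bool list) \<Rightarrow> nat \<times> nat \<Rightarrow> bool" where
  "flips vs bs x = flip_bits (bs (fst x)) (vs (fst x)) (snd x)"

text \<open>The residue modulo 3 is the kind of the vertex, the quotient encodes copy and dart; in
  this way all examples are graphs on natural numbers.\<close>

definition code :: "nat \<Rightarrow> nat \<times> nat \<Rightarrow> nat" where
  "code r x = 3 * prod_encode x + r"

lemma code_eq_iff: "r < 3 \<Longrightarrow> r' < 3 \<Longrightarrow> code r x = code r' y \<longleftrightarrow> r = r' \<and> x = y"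
proof
  assume r: "r < 3" "r' < 3" and eq: "code r x = code r' y"
  have "code r x mod 3 = r" "code r' y mod 3 = r'" using r by (simp_all add: code_def)
  then have "r = r'" using eq by simp
  then show "r = r' \<and> x = y" using eq by (simp add: code_def)
qed simp

locale assembled =
  fixes n p :: nat and N :: "nat \<Rightarrow> nat" and vs es :: "nat \<Rightarrow> nat list list"
  assumes n_pos: "n > 0" and p_pos: "p > 0" and ok: "i < n \<Longrightarrow> map_ok (N i) (vs i) (es i)"
    and marks: "i < n \<Longrightarrow> k < p \<Longrightarrow> k < length (vs i)" "i < n \<Longrightarrow> k < p \<Longrightarrow> k \<in> set (vs i ! k)"
begin

lemma mark_cycle: "i < n \<Longrightarrow> k < p \<Longrightarrow> orbit (perm_of (vs i)) k = set (vs i ! k)"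
  using map_ok_facts(6)[OF ok nth_mem] marks by blast

sublocale merged_map n p "\<lambda>i. {..<N i}" "\<lambda>i. perm_of (vs i)" "\<lambda>i. perm_of (es i)"
proof (rule merged_map.intro)
  show "0 < n" "0 < p" by (rule n_pos p_pos)+
  fix i k assume i: "i < n"
  show "comb_map {..<N i} (perm_of (vs i)) (perm_of (es i))" by (rule comb_map_of[OF ok[OF i]])
  assume k: "k < p"
  have "k \<in> set (concat (vs i))" using marks[OF i k] nth_mem by auto
  then show "k \<in> {..<N i}" using map_ok_facts(2)[OF ok[OF i]] by blast
  fix l assume l: "l < p" "l \<in> orbit (perm_of (vs i)) k"
  show "l = k"
    using index_unique[OF map_ok_facts(1)[OF ok[OF i]] marks(1)[OF i l(1)] marks(2)[OF i l(1)] marks(1)[OF i k]]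
      l(2) mark_cycle[OF i k] by simp
qed

sublocale B: blowup E msg mal "code 0" "code (Suc 0)" "code 2"
  by (intro blowup.intro blowup_axioms.intro M.comb_map_axioms) (simp_all add: inj_on_def code_eq_iff)

section \<open>Embeddings from a list of bits in every copy\<close>

text \<open>The assumptions \<open>loops\<close> concern several marks: each marked corner is then
  the inside of a loop and its face is a single dart, so the merged faces of different marks cannot
  meet along an edge.\<close>

context
  fixes bs :: "nat \<Rightarrow> bool list" and fs :: "nat \<Rightarrow> nat list list"
  assumes fok: "\<And>i. i < n \<Longrightarrow> faces_ok (N i) (vs i) (es i) (bs i) (fs i)"
    and agree: "\<And>i k. i < n \<Longrightarrow> k < p \<Longrightarrow> bs i ! k = bs 0 ! k"
    and loops: "\<And>i k. i < n \<Longrightarrow> k < p \<Longrightarrow> p \<noteq> 1 \<Longrightarrow> perm_of (es i) k = perm_of (vs i) k"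
      "\<And>i k. i < n \<Longrightarrow> k < p \<Longrightarrow> p \<noteq> 1 \<Longrightarrow> [if bs i ! k then perm_of (vs i) k else k] \<in> set (fs i)"
begin

abbreviation "s \<equiv> flips vs bs"

lemma flips_base: "(\<lambda>d. s (i, d)) = flip_bits (bs i) (vs i)"
  by (simp add: flips_def)

lemma flips_nth:
  assumes "i < n" "v < length (vs i)" "d \<in> set (vs i ! v)"
  shows "s (i, d) = bs i ! v"
  using flip_bits_nth[OF _ map_ok_facts(1)[OF ok[OF assms(1)]] assms(2,3)] fok[OF assms(1)]
  by (simp add: flips_def faces_ok_def)

lemma fmark_loop:
  assumes "i < n" "k < p" "p \<noteq> 1"
  shows "fmark s k i = (if bs i ! k then perm_of (vs i) k else k)"
  using loops(1)[OF assms] flips_nth[OF assms(1) marks[OF assms(1,2)]] base_simps(7)[OF assms(1) mark_in[OF assms(2,1)]]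
  by (simp add: fmark_def)

lemma fmark_face:
  assumes "i < n" "k < p" "p \<noteq> 1"
  shows "orbit (fphi s i) (fmark s k i) = {fmark s k i}"
  using face_orbit[OF ok[OF assms(1)] fok[OF assms(1)] loops(2)[OF assms]] fmark_loop[OF assms]
  by (simp add: fphi_def flips_base)

lemma fmark_cycle:
  assumes "i < n" "k < p" "p \<noteq> 1"
  shows "fmark s k i \<in> set (vs i ! k)"
  using fmark_loop[OF assms] marks(2)[OF assms(1,2)] mark_cycle[OF assms(1,2)] orbit.base[of "perm_of (vs i)" k] by simp

lemma cycles_disjoint: "i < n \<Longrightarrow> k < p \<Longrightarrow> l < p \<Longrightarrow> d \<in> set (vs i ! k) \<Longrightarrow> d \<in> set (vs i ! l) \<Longrightarrow> l = k"
  using index_unique[OF map_ok_facts(1)[OF ok]] marks(1) by blast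

lemma compatible_flips: "compatible s"
  unfolding compatible_def
proof (intro conjI allI impI)
  fix i assume i: "i < n"
  show "comb_map.invariant (perm_of (vs i)) (\<lambda>d. s (i, d))"
    unfolding flips_base by (rule invariant_bits[OF ok[OF i] fok[OF i]])
  fix k assume k: "k < p"
  show "s (i, k) = s (0, k)"
    using flips_nth[OF i marks[OF i k]] flips_nth[OF n_pos marks[OF n_pos k]] agree[OF i k] by simp
  fix l assume l: "l < p" "fmark s l i \<in> orbit (fphi s i) (fmark s k i)"
  show "l = k"
  proof (cases "p = 1")
    case False
    then have "fmark s l i = fmark s k i" using fmark_face[OF i k] l(2) by simp
    then show ?thesis using cycles_disjoint[OF i k l(1) fmark_cycle[OF i k False]] fmark_cycle[OF i l(1) False] by simp
  qed (use k l in simp)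
qed

lemma invariant_flips: "M.invariant s"
  by (rule invariant_compatible[OF compatible_flips])

lemma embedding_flips: "embedding B.blow (B.frot s)"
  by (rule B.embedding_frot[OF invariant_flips])

lemma genus_flips:
  assumes "\<And>i. i < n \<Longrightarrow> 2 * int (length (vs i)) + 2 * int (length (fs i)) = int (N i) + 4 - 4 * h i"
    and "int g = (\<Sum>i<n. h i) + (int p - 1) * (int n - 1)"
  shows "has_genus B.blow (B.frot s) g"
proof -
  have "comb_map.genus {..<N i} (flip (\<lambda>d. s (i, d)) (perm_of (vs i))) (perm_of (es i)) (h i)" if "i < n" for i
    unfolding flips_base by (rule genus_of[OF ok[OF that] fok[OF that] assms(1)[OF that]])
  then show ?thesis using genus_merged[OF compatible_flips] B.has_genus_frot[OF invariant_flips] assms(2) by simp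
qed

text \<open>The condition \<open>far\<close> has to be checked. If the two sides of an edge carry
  the marks \<open>k\<close> and \<open>l\<close>, these differ because the dual of the copy has no
  loop. Hence there are several marks, both faces are single darts inside loops, and a loop at
  vertex \<open>k\<close> would have an end at vertex \<open>l\<close>.\<close>

lemma polyhedral_flips:
  assumes "\<And>i. i < n \<Longrightarrow> good_faces (es i) (fs i)"
  shows "polyhedral B.blow (B.frot s)"
proof (rule B.polyhedral_frot[OF invariant_flips], rule good_merged[OF compatible_flips])
  fix i assume i: "i < n"
  show good: "comb_map.good {..<N i} (flip (\<lambda>d. s (i, d)) (perm_of (vs i))) (perm_of (es i))"
    unfolding flips_base by (rule good_of[OF ok[OF i] fok[OF i] assms[OF i]])
  interpret F: comb_map "{..<N i}" "flip (\<lambda>d. s (i, d)) (perm_of (vs i))" "perm_of (es i)"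
    by (rule comb_map_base_flip[OF compatible_flips i])
  fix d k l assume d: "d \<in> {..<N i}" and k: "k < p" and l: "l < p" and m: "fmark s k i \<in> orbit (fphi s i) d"
  have phi: "F.phi = fphi s i" by (simp add: fphi_def)
  have od: "orbit (fphi s i) (fmark s k i) = orbit (fphi s i) d"
    using F.phi_orbit_eq[OF d] m by (simp add: phi)
  show "fmark s l i \<notin> orbit (fphi s i) (perm_of (es i) d)"
  proof
    assume m': "fmark s l i \<in> orbit (fphi s i) (perm_of (es i) d)"
    have "orbit (fphi s i) (fmark s l i) = orbit (fphi s i) (perm_of (es i) d)"
      using F.phi_orbit_eq[OF F.al_in[OF d]] m' by (simp add: phi)
    then have "l \<noteq> k" using good d od unfolding F.good_def phi by metis
    then have p: "p \<noteq> 1" using k l by linarith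
    have "d = fmark s k i" using F.phi_orbit_self[OF d] fmark_face[OF i k p] od by (simp add: phi)
    moreover have "perm_of (es i) d = fmark s l i"
      using F.phi_orbit_self[OF F.al_in[OF d]] fmark_face[OF i l p]
        \<open>orbit (fphi s i) (fmark s l i) = orbit (fphi s i) (perm_of (es i) d)\<close> by (simp add: phi)
    moreover have "perm_of (es i) (fmark s k i) \<in> set (vs i ! k)"
    proof -
      have "perm_of (es i) (fmark s k i) = (if bs i ! k then k else perm_of (vs i) k)"
        using fmark_loop[OF i k p] loops(1)[OF i k p] base_simps(7)[OF i mark_in[OF k i]] by simp
      then show ?thesis using marks(2)[OF i k] mark_cycle[OF i k] orbit.base[of "perm_of (vs i)" k] by simp
    qed
    ultimately have "fmark s l i \<in> set (vs i ! k)" by simp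
    then show False using cycles_disjoint[OF i k l] fmark_cycle[OF i l p] \<open>l \<noteq> k\<close> by simp
  qed
qed

lemma in_polyhedral_embeddings:
  assumes "\<And>i. i < n \<Longrightarrow> good_faces (es i) (fs i)"
    and "\<And>i. i < n \<Longrightarrow> 2 * int (length (vs i)) + 2 * int (length (fs i)) = int (N i) + 4 - 4 * h i"
    and "int g = (\<Sum>i<n. h i) + (int p - 1) * (int n - 1)"
  shows "B.frot s \<in> polyhedral_embeddings B.blow g"
  using polyhedral_flips genus_flips[of h g] assms by (simp add: polyhedral_embeddings_def)

lemma not_polyhedral_flips:
  assumes "i < n" "c \<in> set (fs i)" "d \<in> set c" "perm_of (es i) d \<in> set c"
  shows "\<not> polyhedral B.blow (B.frot s)"
proof
  assume P: "polyhedral B.blow (B.frot s)"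
  note fo = face_orbit[OF ok[OF assms(1)] fok[OF assms(1)] assms(2)]
  have "set (concat (fs i)) = {..<N i}" using fok[OF assms(1)] partitionsD by (auto simp: faces_ok_def)
  then have d: "d \<in> {..<N i}" using assms(2,3) by auto
  have eq: "orbit (fphi s i) d = orbit (fphi s i) (perm_of (es i) d)"
    using fo[OF assms(3)] fo[OF assms(4)] by (simp add: fphi_def flips_base)
  show False using B.polyhedral_frot_sides[OF invariant_flips P] sides_merged[OF compatible_flips assms(1) d eq] by blast
qed

end

text \<open>If every vertex of every copy is marked, a polyhedral embedding is determined by one
  orientation for each mark.\<close>

lemma polyhedral_embedding_flips:
  assumes "polyhedral B.blow nx" and len: "\<And>i. i < n \<Longrightarrow> length (vs i) = p"
  obtains bs where "length bs = p" "nx = B.frot (flips vs (\<lambda>i. bs))"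
proof -
  obtain t where t: "M.invariant t" "nx = B.frot t" using B.polyhedral_cases[OF assms(1)] .
  define bs where "bs = map (\<lambda>k. t (0, k)) [0..<p]"
  have "t x = flips vs (\<lambda>i. bs) x" if xE: "x \<in> E" for x
  proof -
    obtain i d where x: "x = (i, d)" "i < n" "d < N i" using xE by (auto simp: E_def)
    then have "d \<in> set (concat (vs i))" using map_ok_facts(2)[OF ok[OF x(2)]] by blast
    then obtain k where k: "k < length (vs i)" "d \<in> set (vs i ! k)" by (rule in_cycle_index)
    then have kp: "k < p" using len[OF x(2)] by simp
    have const: "t y = t z" if "y \<in> orbit msg z" for y z
      using that by induct (simp_all add: M.invariant_simps(1)[OF t(1)])
    have "orbit msg (0, k) = V.merged k"
      using V.orbit_marked[OF n_pos mark_in[OF kp n_pos] kp] V.in_own_orbit[OF kp n_pos] by simp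
    moreover have "(i, d) \<in> V.merged k" using x(2) k mark_cycle[OF x(2) kp] by (simp add: V.merged_def)
    ultimately have "t (i, d) = t (0, k)" using const by blast
    moreover have "flips vs (\<lambda>i. bs) (i, d) = bs ! k"
      using flip_bits_nth[OF _ map_ok_facts(1)[OF ok[OF x(2)]] k] len[OF x(2)] by (simp add: flips_def bs_def)
    ultimately show ?thesis using kp x(1) by (simp add: bs_def)
  qed
  then have "nx = B.frot (flips vs (\<lambda>i. bs))" using B.frot_cong t(2) by blast
  then show ?thesis using that[of bs] by (simp add: bs_def)
qed

end

section \<open>The constructions\<close>

lemma has_genus_unique: "has_genus G nx g \<Longrightarrow> has_genus G nx g' \<Longrightarrow> g = g'"
  by (simp add: has_genus_def)

lemma finite_embeddings: "finite {nx. embedding G nx}"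
proof (cases "pair_graph G")
  case True
  then interpret pair_graph G .
  have "{nx. embedding G nx} \<subseteq> {nx. nx permutes parcs G}" by (auto simp: embedding_def)
  then show ?thesis using finite_permutations[of "parcs G"] finite_subset by auto
qed (simp add: embedding_def)

lemma finite_polyhedral_embeddings: "finite (polyhedral_embeddings G g)"
  by (rule finite_subset[OF _ finite_embeddings]) (auto simp: polyhedral_embeddings_def polyhedral_def)

text \<open>Each embedding has at most one genus and there are finitely many embeddings. Lower
  bounds on \<open>card\<close> depend on this, as infinite sets have \<open>card\<close>
  zero.\<close>

lemma finite_polyhedral_genera: "finite (polyhedral_genera G)"
proof (rule finite_subset)
  show "finite ((\<lambda>nx. THE g. has_genus G nx g) ` {nx. embedding G nx})" by (rule finite_imageI[OF finite_embeddings])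
  show "polyhedral_genera G \<subseteq> (\<lambda>nx. THE g. has_genus G nx g) ` {nx. embedding G nx}"
  proof
    fix g assume "g \<in> polyhedral_genera G"
    then obtain nx where nx: "embedding G nx" "has_genus G nx g"
      by (auto simp: polyhedral_genera_def polyhedral_embeddings_def polyhedral_def)
    then have "g = (THE g. has_genus G nx g)" using has_genus_unique by (intro the_equality[symmetric]) blast+
    then show "g \<in> (\<lambda>nx. THE g. has_genus G nx g) ` {nx. embedding G nx}" using nx(1) by blast
  qed
qed

lemma marked_cycles:
  "k < 2 \<Longrightarrow> k < length theta_rot \<and> k \<in> set (theta_rot ! k)" "k < 2 \<Longrightarrow> k < length flexible_rot \<and> k \<in> set (flexible_rot ! k)"
  using rot_facts by simp_all

section \<open>Many genera, gaps, and distance from the minimum genus\<close>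

theorem many_genera:
  assumes "k > 0"
  obtains G :: "nat pair_pre_digraph" where "cubic_graph G" "card (polyhedral_genera G) \<ge> k"
proof -
  interpret A: assembled k 1 "\<lambda>_. 88" "\<lambda>_. flexible_rot" "\<lambda>_. flexible_edges"
    using assms flexible_map_ok marked_cycles(2)[of 0] by unfold_locales simp_all
  have "13 * k + j \<in> polyhedral_genera A.B.blow" if j: "j < k" for j
  proof -
    \<comment> \<open>The first bit belongs to the spliced vertex and is common to all copies; the
      second one is free. The \<open>j\<close> copies with different bits have genus 14, the others
      13.\<close>
    have "A.B.frot (flips (\<lambda>_. flexible_rot) (\<lambda>i. [True, \<not> i < j])) \<in> polyhedral_embeddings A.B.blow (13 * k + j)"
    proof (rule A.in_polyhedral_embeddings[where fs = "\<lambda>i. flexible_faces True (\<not> i < j)" and h = "\<lambda>i. 13 + (if i < j then 1 else 0)"])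
      have "(\<Sum>i<k. if i < j then 1 else 0) = int (card ({..<k} \<inter> {i. i < j}))" by (simp add: sum.If_cases)
      also have "{..<k} \<inter> {i. i < j} = {..<j}" using j by auto
      finally show "int (13 * k + j) = (\<Sum>i<k. 13 + (if i < j then 1 else 0)) + (int 1 - 1) * (int k - 1)"
        by (simp add: sum.distrib)
    qed (use flexible_faces_ok flexible_good number_of_faces rot_facts in auto)
    then show ?thesis by (auto simp: polyhedral_genera_def)
  qed
  then have "(\<lambda>j. 13 * k + j) ` {..<k} \<subseteq> polyhedral_genera A.B.blow" by blast
  then have "card ((\<lambda>j. 13 * k + j) ` {..<k}) \<le> card (polyhedral_genera A.B.blow)"
    by (rule card_mono[OF finite_polyhedral_genera])
  then show ?thesis using that A.B.cubic by (simp add: card_image)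
qed

theorem genus_gap:
  assumes "k > 0"
  obtains G :: "nat pair_pre_digraph" and P P' g g' where "cubic_graph G" "P \<in> polyhedral_embeddings G g"
    "P' \<in> polyhedral_embeddings G g'" "g + k \<le> g'" "polyhedral_genera G \<inter> {g<..<g'} = {}"
proof -
  interpret A: assembled k 2 "\<lambda>_. 88" "\<lambda>_. flexible_rot" "\<lambda>_. flexible_edges"
    using assms flexible_map_ok marked_cycles(2) by unfold_locales simp_all
  \<comment> \<open>Besides 13 or 14 for each copy, splicing at two vertices contributes
    \<open>k - 1\<close>.\<close>
  define g where "g a b = (if a = b then 13 else 14) * k + (k - 1)" for a b :: bool
  have emb: "A.B.frot (flips (\<lambda>_. flexible_rot) (\<lambda>i. [a, b])) \<in> polyhedral_embeddings A.B.blow (g a b)" for a b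
  proof (rule A.in_polyhedral_embeddings[where fs = "\<lambda>i. flexible_faces a b" and h = "\<lambda>i. if a = b then 13 else 14"])
    show "int (g a b) = (\<Sum>i<k. if a = b then 13 else 14) + (int 2 - 1) * (int k - 1)"
      using assms by (simp add: g_def of_nat_diff)
    show "[if [a, b] ! l then perm_of flexible_rot l else l] \<in> set (flexible_faces a b)" if "l < 2" for l
      using marked_faces(2)[OF that, of a b] marked_loops(4)[OF that] by (cases "[a, b] ! l") simp_all
  qed (simp_all add: flexible_faces_ok flexible_good number_of_faces rot_facts marked_loops)
  \<comment> \<open>Both vertices are merged with those of the other copies, so two bits describe
    any polyhedral embedding, and the genus only depends on whether they are equal.\<close>
  have only: "h = g True True \<or> h = g True False" if h: "h \<in> polyhedral_genera A.B.blow" for h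
  proof -
    obtain nx where nx: "polyhedral A.B.blow nx" "has_genus A.B.blow nx h"
      using h by (auto simp: polyhedral_genera_def polyhedral_embeddings_def)
    obtain bs where bs: "length bs = 2" "nx = A.B.frot (flips (\<lambda>_. flexible_rot) (\<lambda>i. bs))"
      using A.polyhedral_embedding_flips[OF nx(1)] rot_facts by auto
    then obtain a b where "bs = [a, b]" by (auto simp: numeral_2_eq_2 length_Suc_conv)
    then have "has_genus A.B.blow nx (g a b)" using emb[of a b] bs(2) by (simp add: polyhedral_embeddings_def)
    then have "h = g a b" using has_genus_unique nx(2) by blast
    then show ?thesis by (auto simp: g_def)
  qed
  show ?thesis
  proof (rule that[OF A.B.cubic emb emb])
    show "g True True + k \<le> g True False" by (simp add: g_def)
    show "polyhedral_genera A.B.blow \<inter> {g True True<..<g True False} = {}" using only by force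
  qed
qed

theorem polyhedral_above_mingen:
  obtains G :: "nat pair_pre_digraph" where "cubic_graph G" "polyhedral_genera G \<noteq> {}"
    "min_polyhedral_genus G \<ge> mingen G + k"
proof -
  define N :: "nat \<Rightarrow> nat" where "N i = (if i = 0 then 10 else 88)" for i
  define vs where "vs i = (if i = 0 then theta_rot else flexible_rot)" for i :: nat
  define es where "es i = (if i = 0 then theta_edges else flexible_edges)" for i :: nat
  define fs where "fs a b i = (if i = 0 then theta_faces a b else flexible_faces a b)" for a b and i :: nat
  define h :: "bool \<Rightarrow> bool \<Rightarrow> nat \<Rightarrow> int" where
    "h a b i = (if i = 0 then if a = b then 1 else 0 else if a = b then 13 else 14)" for a b i
  \<comment> \<open>One \<open>theta\<close> block and \<open>k + 1\<close> copies of
    \<open>flexible\<close>: genus 1 and 13 for equal bits, 0 and 14 for different bits, plus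
    \<open>k + 1\<close> from splicing \<open>k + 2\<close> blocks at two vertices. The
    \<open>theta\<close> block costs one unit of the difference, so \<open>k + 1\<close> flexible
    copies leave exactly \<open>k\<close>.\<close>
  define g where "g a b = (if a = b then 1 + 13 * (k + 1) else 14 * (k + 1)) + (k + 1)" for a b :: bool
  interpret A: assembled "k + 2" 2 N vs es
    by unfold_locales (use theta_map_ok flexible_map_ok marked_cycles in \<open>auto simp: N_def vs_def es_def\<close>)
  note defs = N_def vs_def es_def fs_def
  have fok: "faces_ok (N i) (vs i) (es i) [a, b] (fs a b i)" for i a b
    using theta_faces_ok flexible_faces_ok by (simp add: defs)
  have loops: "perm_of (es i) l = perm_of (vs i) l" "[if [a, b] ! l then perm_of (vs i) l else l] \<in> set (fs a b i)"
    if "l < 2" for i l a b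
    using marked_loops[OF that] marked_faces[OF that, of a b] by (cases "[a, b] ! l"; simp add: defs)+
  have euler: "2 * int (length (vs i)) + 2 * int (length (fs a b i)) = int (N i) + 4 - 4 * h a b i" for i a b
    using number_of_faces rot_facts by (simp add: defs h_def)
  have sum: "int (g a b) = (\<Sum>i<k + 2. h a b i) + (int 2 - 1) * (int (k + 2) - 1)" for a b
  proof -
    have "(\<Sum>i<Suc (k + 1). h a b i) = h a b 0 + (\<Sum>i<k + 1. h a b (Suc i))" by (rule sum.lessThan_Suc_shift)
    then show ?thesis by (simp add: h_def g_def)
  qed
  have genus: "has_genus A.B.blow (A.B.frot (flips vs (\<lambda>i. [a, b]))) (g a b)" for a b
    by (rule A.genus_flips[OF fok _ _ _ euler sum]) (use loops in auto)
  have emb: "embedding A.B.blow (A.B.frot (flips vs (\<lambda>i. [a, b])))" for a b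
    by (rule A.embedding_flips[where fs = "fs a b"]) (use fok loops in auto)
  have poly: "polyhedral A.B.blow (A.B.frot (flips vs (\<lambda>i. [a, b])))" if "a \<noteq> b" for a b
    by (rule A.polyhedral_flips[where fs = "fs a b"])
      (use fok loops theta_good[OF that] flexible_good in \<open>auto simp: fs_def es_def\<close>)
  have not_poly: "\<not> polyhedral A.B.blow (A.B.frot (flips vs (\<lambda>i. [a, a])))" for a
  proof -
    obtain c where c: "c \<in> set (theta_faces a a)" "4 \<in> set c" "7 \<in> set c" by (rule theta_edge_one_face)
    show ?thesis
      by (rule A.not_polyhedral_flips[where fs = "fs a a" and i = 0 and c = c and d = 4])
        (use fok loops c theta_edge in \<open>auto simp: fs_def es_def\<close>)
  qed
  have len: "length (vs i) = 2" for i using rot_facts by (simp add: vs_def)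
  have only: "j = g True False" if j: "j \<in> polyhedral_genera A.B.blow" for j
  proof -
    obtain nx where nx: "polyhedral A.B.blow nx" "has_genus A.B.blow nx j"
      using j by (auto simp: polyhedral_genera_def polyhedral_embeddings_def)
    obtain bs where bs: "length bs = 2" "nx = A.B.frot (flips vs (\<lambda>i. bs))"
      using A.polyhedral_embedding_flips[OF nx(1)] len by blast
    then obtain a b where ab: "bs = [a, b]" by (auto simp: numeral_2_eq_2 length_Suc_conv)
    then have "a \<noteq> b" using not_poly nx(1) bs(2) by blast
    moreover have "j = g a b" using has_genus_unique nx(2) genus[of a b] bs(2) ab by blast
    ultimately show ?thesis by (simp add: g_def)
  qed
  have ne: "g True False \<in> polyhedral_genera A.B.blow"
    using poly[of True False] genus[of True False] by (auto simp: polyhedral_genera_def polyhedral_embeddings_def)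
  have "min_polyhedral_genus A.B.blow = g True False"
    unfolding min_polyhedral_genus_def using only LeastI[of "\<lambda>j. j \<in> polyhedral_genera A.B.blow", OF ne] by blast
  \<comment> \<open>The embedding with equal bits fails to be polyhedral only because of the
    \<open>theta\<close> block, and it still bounds the minimum genus.\<close>
  moreover have "mingen A.B.blow \<le> g True True"
    unfolding mingen_def using emb[of True True] genus[of True True] by (intro Least_le) blast
  moreover have "g True True + k = g True False" by (simp add: g_def)
  ultimately have "mingen A.B.blow + k \<le> min_polyhedral_genus A.B.blow" by linarith
  then show ?thesis using that[OF A.B.cubic] ne by blast
qed

section \<open>Tables of loops for the chain\<close>

definition looped_at :: "(nat \<Rightarrow> nat) \<Rightarrow> (nat \<Rightarrow> nat) \<Rightarrow> nat \<Rightarrow> bool" where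
  "looped_at f g d \<longleftrightarrow> g d = f d \<or> f (g d) = d"

text \<open>Dart 0, where the rotation leaves the copy, never follows a looped dart, so patterns
  around loops stay inside a copy. The second clause becomes \<open>loops_apart\<close>; in the last
  one \<open>X\<close> collects the predecessors of flanked darts.\<close>

definition loops_ok :: "(nat \<Rightarrow> nat) \<Rightarrow> (nat \<Rightarrow> nat) \<Rightarrow> nat set \<Rightarrow> nat \<Rightarrow> bool" where
  "loops_ok f g X d \<longleftrightarrow> (looped_at f g d \<longrightarrow> f d \<noteq> 0 \<and> (looped_at f g (f d) \<longrightarrow> g d = f d) \<and>
     (\<not> looped_at f g (f d) \<longrightarrow> looped_at f g (f (f d)) \<longrightarrow> d \<in> X))"

text \<open>A certificate for \<open>reach\<close>: each further vertex is entered at its leading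
  dart, whose edge comes from a vertex reached before, and which has a loop after it but none before
  it.\<close>

primrec asym_linked :: "(nat \<Rightarrow> bool) \<Rightarrow> (nat \<Rightarrow> nat) \<Rightarrow> nat list \<Rightarrow> nat list list \<Rightarrow> bool" where
  "asym_linked l f seen [] = True"
| "asym_linked l f seen (c # cs) = (2 \<le> length c \<and> 0 \<notin> set c \<and> f (hd c) \<in> set seen \<and> \<not> l (hd c) \<and> l (c ! 1) \<and>
     \<not> l (last c) \<and> asym_linked l f (c @ seen) cs)"

lemma asym_linked_closed:
  assumes "asym_linked l f seen cs" "set seen \<subseteq> T"
    and "\<And>c. \<lbrakk>c \<in> set cs; 2 \<le> length c; 0 \<notin> set c; f (hd c) \<in> T; \<not> l (hd c); l (c ! 1); \<not> l (last c)\<rbrakk> \<Longrightarrow> set c \<subseteq> T"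
  shows "set (concat cs) \<subseteq> T"
  using assms
proof (induct cs arbitrary: seen)
  case (Cons c cs)
  then have "set c \<subseteq> T" by (intro Cons.prems(3)) auto
  moreover have "set (concat cs) \<subseteq> T"
  proof (rule Cons.hyps)
    show "asym_linked l f (c @ seen) cs" "set (c @ seen) \<subseteq> T" using Cons.prems(1,2) \<open>set c \<subseteq> T\<close> by simp_all
  qed (use Cons.prems(3) in simp)
  ultimately show ?case by simp
qed simp

text \<open>Splicing sends dart 0 to the successor of dart 0 in the next copy, which is 1 in every
  table. As the edge of 0 is no loop and does not end at 1, the splice neither creates nor destroys
  a loop, even for a single copy.\<close>

definition start_ok :: "(nat \<Rightarrow> nat) \<Rightarrow> (nat \<Rightarrow> nat) \<Rightarrow> bool" where
  "start_ok f g \<longleftrightarrow> f 0 = 1 \<and> g 0 \<noteq> 1 \<and> \<not> looped_at f g 0"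

lemma marker_table:
  assumes "cyclic_perm f marker_rot" "cyclic_perm g marker_edges"
  shows "start_ok f g" "list_all (loops_ok f g {2}) (concat marker_rot)"
    "f 2 = 3" "f 3 = 4" "f 5 = 6" "f 6 = 0" "f 7 = 8" "f 11 = 7" "g 3 = 7" "g 6 = 11"
    "\<not> looped_at f g 3" "looped_at f g 2" "looped_at f g 4" "looped_at f g 5" "\<not> looped_at f g 6"
    "\<not> looped_at f g 7" "looped_at f g 8" "\<not> looped_at f g 11"
proof -
  note 1 = assms(1)[unfolded marker_rot_def cyclic_perm_def, simplified]
  note 2 = assms(2)[unfolded marker_edges_def cyclic_perm_def, simplified]
  show "start_ok f g" "list_all (loops_ok f g {2}) (concat marker_rot)"
    "f 2 = 3" "f 3 = 4" "f 5 = 6" "f 6 = 0" "f 7 = 8" "f 11 = 7" "g 3 = 7" "g 6 = 11"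
    "\<not> looped_at f g 3" "looped_at f g 2" "looped_at f g 4" "looped_at f g 5" "\<not> looped_at f g 6"
    "\<not> looped_at f g 7" "looped_at f g 8" "\<not> looped_at f g 11"
    by (simp_all add: start_ok_def loops_ok_def looped_at_def marker_rot_def 1 2)
qed

lemma heawood_table:
  assumes "cyclic_perm f heawood_rot" "cyclic_perm g heawood_edges"
  shows "start_ok f g" "list_all (loops_ok f g {}) (concat heawood_rot)"
    "asym_linked (looped_at f g) g (hd heawood_rot) (tl heawood_rot)"
proof -
  note 1 = assms(1)[unfolded heawood_rot_def cyclic_perm_def, simplified]
  note 2 = assms(2)[unfolded heawood_edges_def cyclic_perm_def, simplified]
  show "start_ok f g" "list_all (loops_ok f g {}) (concat heawood_rot)"
    "asym_linked (looped_at f g) g (hd heawood_rot) (tl heawood_rot)"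
    by (simp_all add: start_ok_def loops_ok_def looped_at_def heawood_rot_def 1 2)
qed

definition chain_size :: "nat \<Rightarrow> nat" where "chain_size i = (if i = 0 then 12 else 68)"
definition chain_rot :: "nat \<Rightarrow> nat list list" where "chain_rot i = (if i = 0 then marker_rot else heawood_rot)"
definition chain_edges :: "nat \<Rightarrow> nat list list" where "chain_edges i = (if i = 0 then marker_edges else heawood_edges)"

lemma chain_map_ok: "map_ok (chain_size i) (chain_rot i) (chain_edges i)"
  using marker_map_ok heawood_map_ok by (simp add: chain_size_def chain_rot_def chain_edges_def)

lemmas chain_cycles = map_ok_facts[OF chain_map_ok]

abbreviation "csg i \<equiv> perm_of (chain_rot i)"
abbreviation "cal i \<equiv> perm_of (chain_edges i)"

lemmas chain_table = cyclic_perm_of[OF chain_cycles(1)] cyclic_perm_of[OF chain_cycles(3)]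

lemma marker_facts:
  "csg 0 2 = 3" "csg 0 3 = 4" "csg 0 5 = 6" "csg 0 6 = 0" "csg 0 7 = 8" "csg 0 11 = 7" "cal 0 3 = 7" "cal 0 6 = 11"
  "\<not> looped_at (csg 0) (cal 0) 3" "looped_at (csg 0) (cal 0) 2" "looped_at (csg 0) (cal 0) 4"
  "looped_at (csg 0) (cal 0) 5" "\<not> looped_at (csg 0) (cal 0) 6"
  "\<not> looped_at (csg 0) (cal 0) 7" "looped_at (csg 0) (cal 0) 8" "\<not> looped_at (csg 0) (cal 0) 11"
  using marker_table(3-18)[of "csg 0" "cal 0"] chain_table[of 0] by (simp_all only: chain_rot_def chain_edges_def if_True simp_thms)

lemma chain_start: "start_ok (csg i) (cal i)"
  using marker_table(1) heawood_table(1) chain_table[of i] by (simp add: chain_rot_def chain_edges_def split: if_splits)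

lemma chain_loops:
  assumes "d < chain_size i"
  shows "loops_ok (csg i) (cal i) (if i = 0 then {2} else {}) d"
proof -
  have "d \<in> set (concat (chain_rot i))" using assms chain_cycles(2)[of i] by blast
  then show ?thesis
    using marker_table(2)[of "csg i" "cal i"] heawood_table(2)[of "csg i" "cal i"] chain_table[of i]
    unfolding chain_rot_def chain_edges_def list_all_iff by (cases "i = 0") (simp_all only: if_True if_False simp_thms)
qed

lemma chain_lengths: "c \<in> set (chain_rot i) \<Longrightarrow> 0 \<notin> set c \<Longrightarrow> 5 \<le> length c" "7 \<le> length (chain_rot 0 ! 0)"
  by (auto simp: chain_rot_def marker_rot_def heawood_rot_def split: if_splits)

text \<open>The loops serve as landmarks: only one dart of the chain is enclosed by two loops, and from there
  the entry darts of all vertices can be told from the other darts one after the other.\<close>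

locale chain =
  fixes n :: nat
  assumes n_pos: "n > 0"
begin

sublocale assembled n "Suc 0" chain_size chain_rot chain_edges
proof
  show "0 < n" by (rule n_pos)
  show "map_ok (chain_size i) (chain_rot i) (chain_edges i)" for i by (rule chain_map_ok)
  show "k < length (chain_rot i)" "k \<in> set (chain_rot i ! k)" if "k < Suc 0" for i k
    using that by (simp_all add: chain_rot_def marker_rot_def heawood_rot_def)
qed simp

abbreviation "lp i \<equiv> looped_at (csg i) (cal i)"

lemma start: "csg i 0 = 1" "cal i 0 \<noteq> 1" "\<not> lp i 0"
  using chain_start[of i] by (simp_all add: start_ok_def)

lemma loops_okD:
  assumes "d < chain_size i" "lp i d"
  shows "csg i d \<noteq> 0" "lp i (csg i d) \<Longrightarrow> cal i d = csg i d" "\<not> lp i (csg i d) \<Longrightarrow> lp i (csg i (csg i d)) \<Longrightarrow> i = 0 \<and> d = 2"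
  using chain_loops[OF assms(1)] assms(2) by (auto simp: loops_ok_def split: if_splits)

lemma msg_0: "i < n \<Longrightarrow> msg (i, 0) = (nxt i, 1)"
  using msg_simps(1)[of i 0] start(1)[of "nxt i"] by simp

lemma msg_other: "i < n \<Longrightarrow> d < chain_size i \<Longrightarrow> d \<noteq> 0 \<Longrightarrow> msg (i, d) = (i, csg i d)"
  using msg_simps(2)[of i d] by simp

lemma inv_msg_other: "i < n \<Longrightarrow> e < chain_size i \<Longrightarrow> e \<noteq> 0 \<Longrightarrow> inv msg (i, csg i e) = (i, e)"
  using inv_msg[of i e] msg_other[of i e] by simp

lemma in_E: "(i, d) \<in> E \<longleftrightarrow> i < n \<and> d < chain_size i"
  by (simp add: E_def)

lemma size_pos: "0 < chain_size i" "1 < chain_size i"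
  by (simp_all add: chain_size_def)

lemma csg_less: "i < n \<Longrightarrow> csg i d < chain_size i \<longleftrightarrow> d < chain_size i"
  using base_simps(1)[of i d] by simp

lemma cal_less: "i < n \<Longrightarrow> d < chain_size i \<Longrightarrow> cal i d < chain_size i"
  using base_simps(6)[of i d] by simp

text \<open>The rotation changes only at dart 0, and \<open>start_ok\<close> keeps loops away from
  there, so loops can be read off the tables of the single copies.\<close>

lemma looped_iff:
  assumes i: "i < n" and d: "d < chain_size i"
  shows "B.looped (i, d) \<longleftrightarrow> lp i d"
proof (cases "d = 0")
  case True
  have al: "cal i 0 \<noteq> 0" using M.al_neq[of "(i, 0)"] i size_pos(1)[of i] by (simp add: in_E mal_def)
  have "msg (i, cal i 0) \<noteq> (i, 0)"
    using msg_other[OF i cal_less[OF i size_pos(1)] al] start(3)[of i] by (simp add: looped_at_def)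
  then show ?thesis using True start(2,3)[of i] by (simp add: B.looped_def msg_0[OF i] mal_def)
next
  case False
  note m = msg_other[OF i d False]
  show ?thesis
  proof (cases "cal i d = 0")
    case True
    then have "cal i 0 = d" using base_simps(7)[of i d] i d by auto
    then have "d \<noteq> 1" using start(2)[of i] by blast
    then show ?thesis using True m msg_0[OF i] start(1)[of i] by (auto simp: B.looped_def looped_at_def mal_def)
  next
    case False
    then show ?thesis using msg_other[OF i cal_less[OF i d] False] m by (simp add: B.looped_def looped_at_def mal_def)
  qed
qed

text \<open>The predecessor of a flanked dart is looped, hence not dart 0, and is not followed by
  dart 0 either. So the whole pattern lies in one copy, where the tables leave only dart 2 of the
  marker as predecessor.\<close>

lemma flanked_only:
  assumes x: "x \<in> E" and fl: "B.flanked x"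
  shows "x = (0, 3)"
proof -
  obtain j e where y: "inv msg x = (j, e)" by fastforce
  then have "(j, e) \<in> E" using x M.sg_simps(2)[of x] by simp
  then have j: "j < n" "e < chain_size j" by (simp_all add: in_E)
  have mx: "msg (j, e) = x" using y M.sg_simps(3)[of x] by simp
  have "lp j e" using fl y looped_iff[OF j] by (simp add: B.flanked_def)
  then have "e \<noteq> 0" using start(3)[of j] by metis
  then have x: "x = (j, csg j e)" using mx msg_other[OF j] by simp
  have d: "csg j e < chain_size j" using csg_less j by simp
  have "msg x = (j, csg j (csg j e))" unfolding x by (rule msg_other[OF j(1) d loops_okD(1)[OF j(2) \<open>lp j e\<close>]])
  moreover have "csg j (csg j e) < chain_size j" using csg_less j d by simp
  ultimately have "\<not> lp j (csg j e)" "lp j (csg j (csg j e))"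
    using fl looped_iff[OF j(1) d] looped_iff[of j "csg j (csg j e)"] j x by (auto simp: B.flanked_def)
  then have "j = 0" "e = 2" using loops_okD(3)[OF j(2) \<open>lp j e\<close>] by simp_all
  then show ?thesis using x marker_facts(1) by simp
qed

lemma neighbours:
  assumes "i < n" "d < chain_size i" "d \<noteq> 0" "e < chain_size i" "e \<noteq> 0" "csg i e = d"
  shows "B.flanked (i, d) \<longleftrightarrow> \<not> lp i d \<and> lp i (csg i d) \<and> lp i e"
    "B.asym (i, d) \<longleftrightarrow> \<not> lp i d \<and> lp i (csg i d) \<noteq> lp i e"
proof -
  have m: "msg (i, d) = (i, csg i d)" "inv msg (i, d) = (i, e)"
    using msg_other[OF assms(1-3)] inv_msg_other[OF assms(1,4,5)] assms(6) by simp_all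
  have "csg i d < chain_size i" using csg_less[OF assms(1)] assms(2) by simp
  note l = looped_iff[OF assms(1,2)] looped_iff[OF assms(1) this] looped_iff[OF assms(1,4)]
  show "B.flanked (i, d) \<longleftrightarrow> \<not> lp i d \<and> lp i (csg i d) \<and> lp i e"
    "B.asym (i, d) \<longleftrightarrow> \<not> lp i d \<and> lp i (csg i d) \<noteq> lp i e"
    unfolding B.flanked_def B.asym_def m l by simp_all
qed

text \<open>The marked vertex of \<open>heawood\<close> has degree three only, but it is merged with
  the marked vertex of the marker, of degree seven. All unmarked vertices have degree at least
  five.\<close>

lemma orbit_large:
  assumes "i < n" "d < chain_size i"
  shows "card (orbit msg (i, d)) > 3"
proof -
  have "d \<in> set (concat (chain_rot i))" using assms(2) chain_cycles(2)[of i] by blast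
  then obtain c where c: "c \<in> set (chain_rot i)" "d \<in> set c" by auto
  have oc: "orbit (csg i) d = set c" by (rule chain_cycles(6)[OF c])
  have fin: "finite (orbit msg (i, d))"
    using finite_subset[OF M.sg_orbit_sub M.fin] assms by (simp add: in_E)
  show ?thesis
  proof (cases "0 \<in> set c")
    case True
    then have "orbit msg (i, d) = V.merged 0" using V.orbit_marked[of i d 0] assms oc by simp
    moreover have "Pair 0 ` set (chain_rot 0 ! 0) \<subseteq> V.merged 0"
      using mark_cycle[OF n_pos, of 0] n_pos by (auto simp: V.merged_def)
    moreover have "card (Pair 0 ` set (chain_rot 0 ! 0)) = length (chain_rot 0 ! 0)"
    proof -
      have "chain_rot 0 ! 0 \<in> set (chain_rot 0)" using marks(1)[OF n_pos, of 0] by simp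
      then have "distinct (chain_rot 0 ! 0)" using chain_cycles(1)[of 0] by (meson distinct_concat_iff)
      then show ?thesis by (simp add: card_image inj_on_def distinct_card)
    qed
    ultimately have "length (chain_rot 0 ! 0) \<le> card (orbit msg (i, d))" using card_mono[OF fin] by metis
    then show ?thesis using chain_lengths(2) by linarith
  next
    case False
    then have "orbit msg (i, d) = Pair i ` set c" using V.orbit_unmarked[of i d] assms oc by simp
    moreover have "distinct c" using chain_cycles(1)[of i] c(1) by (meson distinct_concat_iff)
    ultimately have "card (orbit msg (i, d)) = length c" by (simp add: card_image inj_on_def distinct_card)
    then show ?thesis using chain_lengths(1)[OF c(1) False] by simp
  qed
qed

lemma msg_cubed:
  assumes x: "x \<in> E"
  shows "msg (msg (msg x)) \<noteq> x"
proof
  assume eq: "msg (msg (msg x)) = x"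
  have "orbit msg x \<subseteq> set [x, msg x, msg (msg x)]"
  proof
    fix y assume "y \<in> orbit msg x"
    then show "y \<in> set [x, msg x, msg (msg x)]" by induct (use eq in auto)
  qed
  then have "card (orbit msg x) \<le> card (set [x, msg x, msg (msg x)])" by (intro card_mono) simp_all
  also have "\<dots> \<le> length [x, msg x, msg (msg x)]" by (rule card_length)
  finally show False using orbit_large[of "fst x" "snd x"] x by (cases x) (simp add: in_E)
qed

context
  fixes S assumes sub: "S \<subseteq> E" and closed: "\<And>x. x \<in> S \<Longrightarrow> msg x \<in> S"
    and reached: "\<And>x. x \<in> E \<Longrightarrow> mal x \<in> S \<Longrightarrow> B.asym x \<Longrightarrow> x \<in> S"
begin

lemma orbit_closed: "x \<in> S \<Longrightarrow> orbit msg x \<subseteq> S"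
proof
  fix y assume "x \<in> S" "y \<in> orbit msg x"
  from this(2) show "y \<in> S" by induct (use \<open>x \<in> S\<close> closed in auto)
qed

lemma cycle_closed:
  assumes "i < n" "c \<in> set (chain_rot i)" "d \<in> set c" "0 \<notin> set c" "(i, d) \<in> S"
  shows "Pair i ` set c \<subseteq> S"
proof -
  have "orbit msg (i, d) = Pair i ` set c"
    using V.orbit_unmarked[of i d] assms chain_cycles(6)[OF assms(2,3)] sub in_E by auto
  then show ?thesis using orbit_closed[OF assms(5)] by simp
qed

lemma hub_closed:
  assumes "(i, d) \<in> S" "d \<in> set (chain_rot i ! 0)"
  shows "V.merged 0 \<subseteq> S"
proof -
  have i: "i < n" "d < chain_size i" using sub assms(1) in_E by blast+
  have "chain_rot i ! 0 \<in> set (chain_rot i)" using marks(1)[OF i(1), of 0] by simp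
  then have "0 \<in> orbit (csg i) d" using chain_cycles(6)[OF _ assms(2)] marks(2)[OF i(1), of 0] by simp
  then show ?thesis using V.orbit_marked[of i d 0] i orbit_closed[OF assms(1)] by simp
qed

lemma cycles_reached:
  assumes i: "i < n" and lk: "asym_linked (lp i) (cal i) (hd (chain_rot i)) (tl (chain_rot i))"
    and hub: "V.merged 0 \<subseteq> S"
  shows "Pair i ` {..<chain_size i} \<subseteq> S"
proof -
  have ne: "chain_rot i = hd (chain_rot i) # tl (chain_rot i)"
    using marks(1)[OF i, of 0] by (cases "chain_rot i") simp_all
  have hd: "hd (chain_rot i) = chain_rot i ! 0" by (subst ne) simp
  have 0: "set (hd (chain_rot i)) \<subseteq> {d. (i, d) \<in> S}"
    using hub mark_cycle[OF i, of 0] i hd by (auto simp: V.merged_def)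
  have "set (concat (tl (chain_rot i))) \<subseteq> {d. (i, d) \<in> S}"
  proof (rule asym_linked_closed[OF lk 0])
    fix c assume c: "c \<in> set (tl (chain_rot i))" "2 \<le> length c" "0 \<notin> set c" "cal i (hd c) \<in> {d. (i, d) \<in> S}"
      "\<not> lp i (hd c)" "lp i (c ! 1)" "\<not> lp i (last c)"
    have cr: "c \<in> set (chain_rot i)" using c(1) ne list.set_intros(2) by metis
    have cne: "c \<noteq> []" using c(2) by auto
    have less: "d < chain_size i" if "d \<in> set c" for d
    proof -
      have "d \<in> set (concat (chain_rot i))" using cr that by auto
      then show ?thesis using chain_cycles(2)[of i] by blast
    qed
    have "csg i (last c) = hd c" "csg i (hd c) = c ! 1"
      using perm_of_nth[OF chain_cycles(1) cr, of "length c - 1"] perm_of_nth[OF chain_cycles(1) cr, of 0] c(2) cne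
      by (simp_all add: last_conv_nth hd_conv_nth)
    then have "B.asym (i, hd c)"
      using neighbours(2)[OF i less _ less, of "hd c" "last c"] c cne by (metis hd_in_set last_in_set)
    moreover have "(i, hd c) \<in> E" using less cne i by (simp add: in_E)
    ultimately have "(i, hd c) \<in> S" using reached c(4) by (simp add: mal_def)
    then show "set c \<subseteq> {d. (i, d) \<in> S}" using cycle_closed[OF i cr hd_in_set[OF cne] c(3)] by blast
  qed
  moreover have "set (concat (chain_rot i)) = set (hd (chain_rot i)) \<union> set (concat (tl (chain_rot i)))"
    by (subst ne) simp
  ultimately have "{..<chain_size i} \<subseteq> {d. (i, d) \<in> S}" using 0 chain_cycles(2)[of i] by blast
  then show ?thesis by blast
qed

text \<open>From dart 7 the propagation covers the second vertex of the marker, crosses the edge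
  \<open>{11, 6}\<close> into the merged vertex, and enters every Heawood copy from there along its
  list of cycles.\<close>

lemma all_reached:
  assumes "(0, 7) \<in> S"
  shows "S = E"
proof -
  have rot: "chain_rot 0 = [[0,1,2,3,4,5,6],[7,8,9,10,11]]" by (simp add: chain_rot_def marker_rot_def)
  have cluster: "Pair 0 ` set [7,8,9,10,11] \<subseteq> S"
    by (rule cycle_closed[OF n_pos _ _ _ assms]) (simp_all add: rot)
  have "chain_size 0 = 12" by (simp add: chain_size_def)
  then have "B.asym (0, 6)" using neighbours(2)[of 0 6 5] n_pos start(3)[of 0] marker_facts by simp
  moreover have "mal (0, 6) \<in> S" using cluster marker_facts(8) by (simp add: mal_def)
  moreover have "(0, 6) \<in> E" unfolding in_E using n_pos by (simp add: chain_size_def)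
  ultimately have "(0, 6) \<in> S" using reached by blast
  then have hub: "V.merged 0 \<subseteq> S" by (rule hub_closed) (simp add: rot)
  have "(i, d) \<in> S" if "(i, d) \<in> E" for i d
  proof (cases "i = 0")
    case True
    have "d \<in> set (concat (chain_rot 0))" using that True chain_cycles(2)[of 0] in_E by blast
    then have "d \<in> set (chain_rot 0 ! 0) \<or> d \<in> set [7,8,9,10,11]" by (simp add: rot)
    moreover have "set (chain_rot 0 ! 0) \<subseteq> {d. (0, d) \<in> S}"
      using hub mark_cycle[OF n_pos, of 0] n_pos by (auto simp: V.merged_def)
    ultimately show ?thesis using cluster True by blast
  next
    case False
    have i: "i < n" "d < chain_size i" using that by (simp_all add: in_E)
    have "asym_linked (lp i) (cal i) (hd (chain_rot i)) (tl (chain_rot i))"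
      using heawood_table(3)[of "csg i" "cal i"] chain_table[of i] False
      unfolding chain_rot_def chain_edges_def by (simp only: if_False simp_thms)
    then show ?thesis using cycles_reached[OF i(1) _ hub] i(2) by blast
  qed
  then show ?thesis using sub by auto
qed

end

sublocale R: rigid_blowup E msg mal "code 0" "code (Suc 0)" "code 2" "(0, 3)"
proof (intro rigid_blowup.intro rigid_blowup_axioms.intro B.blowup_axioms)
  have c: "(0 :: nat) < n" "chain_size 0 = 12" using n_pos by (simp_all add: chain_size_def)
  show "msg (msg (msg x)) \<noteq> x" if "x \<in> E" for x by (rule msg_cubed[OF that])
  show "mal x = msg x" if x: "x \<in> E" and l: "B.looped x" "B.looped (msg x)" for x
  proof -
    obtain i d where id: "x = (i, d)" "i < n" "d < chain_size i" using x in_E by (cases x) auto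
    have "lp i d" using l(1) looped_iff[OF id(2,3)] id(1) by simp
    then have "d \<noteq> 0" using start(3)[of i] by metis
    then have m: "msg x = (i, csg i d)" using msg_other[OF id(2,3)] id(1) by simp
    then have "lp i (csg i d)" using l(2) looped_iff[of i "csg i d"] csg_less[OF id(2)] id(2,3) by simp
    then have "cal i d = csg i d" by (rule loops_okD(2)[OF id(3) \<open>lp i d\<close>])
    then show ?thesis using m id(1) by (simp add: mal_def)
  qed
  show "(0, 3) \<in> E" using c by (simp add: in_E)
  show "B.flanked (0, 3)" using neighbours(1)[of 0 3 2] c marker_facts by simp
  show "x = (0, 3)" if "x \<in> E" "B.flanked x" for x by (rule flanked_only[OF that])
  have al: "mal (0, 3) = (0, 7)" using marker_facts by (simp add: mal_def)
  show "B.asym (mal (0, 3))" unfolding al using neighbours(2)[of 0 7 11] c marker_facts by simp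
  show "S = E" if "S \<subseteq> E" "\<And>x. x \<in> S \<Longrightarrow> msg x \<in> S" "mal (0, 3) \<in> S"
    "\<And>x. x \<in> E \<Longrightarrow> mal x \<in> S \<Longrightarrow> B.asym x \<Longrightarrow> x \<in> S" for S
    by (rule all_reached[OF that(1,2,4)]) (use that(3) al in simp_all)
qed

end

section \<open>Families of pairwise non-isomorphic embeddings\<close>

lemma heawood_bits_facts:
  "length heawood_bits = 8" "distinct heawood_bits" "b < 8 \<Longrightarrow> length (heawood_bits ! b) = 14" "b < 8 \<Longrightarrow> heawood_bits ! b ! 0"
proof -
  show "length heawood_bits = 8" "distinct heawood_bits" by (simp_all add: heawood_bits_def)
  show "b < 8 \<Longrightarrow> length (heawood_bits ! b) = 14" "b < 8 \<Longrightarrow> heawood_bits ! b ! 0"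
    by (drule below_8, elim insertE emptyE; simp add: heawood_bits_def)+
qed

theorem many_non_isomorphic:
  obtains G :: "nat pair_pre_digraph" and S where "cubic_graph G" "S \<subseteq> polyhedral_embeddings G g"
    "pairwise_non_isomorphic G S" "finite S" "card S = 8 ^ g"
proof -
  interpret A: chain "Suc g" by unfold_locales simp
  \<comment> \<open>One of eight toroidal flips for each of the copies 1 to \<open>g\<close>. Copy 0
    is the planar marker, so the genus is \<open>g\<close>; for \<open>g = 0\<close> the marker is
    alone.\<close>
  define C where "C = ({1..<Suc g} \<rightarrow>\<^sub>E {..<8 :: nat})"
  define bits where "bits b i = (if i = 0 then [True, True] else heawood_bits ! (b i))" for b :: "nat \<Rightarrow> nat" and i
  define fs where "fs b i = (if i = 0 then marker_faces else heawood_faces ! (b i))" for b :: "nat \<Rightarrow> nat" and i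
  define rot where "rot b = A.B.frot (flips chain_rot (bits b))" for b
  have C: "b i < 8" if "b \<in> C" "i < Suc g" "i \<noteq> 0" for b i
    using PiE_mem[of b "{1..<Suc g}" "\<lambda>_. {..<8}" i] that unfolding C_def by simp
  have fok: "faces_ok (chain_size i) (chain_rot i) (chain_edges i) (bits b i) (fs b i)" if "b \<in> C" "i < Suc g" for b i
    using marker_faces_ok heawood_faces_ok C[OF that]
    by (simp add: chain_size_def chain_rot_def chain_edges_def bits_def fs_def)
  have hub: "bits b i ! 0" if "b \<in> C" "i < Suc g" for b i
    using heawood_bits_facts(4) C[OF that] by (simp add: bits_def)
  have agree: "bits b i ! k = bits b 0 ! k" if "b \<in> C" "i < Suc g" "k < Suc 0" for b i k
    using that hub[of b i] hub[of b 0] by simp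
  have inv: "A.M.invariant (flips chain_rot (bits b))" if "b \<in> C" for b
    by (rule A.invariant_flips[where fs = "fs b"]) (rule fok[OF that], assumption | rule agree[OF that], assumption+ | simp)+
  have emb: "rot b \<in> polyhedral_embeddings A.B.blow g" if b: "b \<in> C" for b
    unfolding rot_def
  proof (rule A.in_polyhedral_embeddings[where fs = "fs b" and h = "\<lambda>i. if i = 0 then 0 else 1"])
    fix i assume i: "i < Suc g"
    show "good_faces (chain_edges i) (fs b i)"
      using marker_good heawood_good C[OF b i] by (simp add: chain_edges_def fs_def)
    show "2 * int (length (chain_rot i)) + 2 * int (length (fs b i)) = int (chain_size i) + 4 - 4 * (if i = 0 then 0 else 1)"
      using number_of_faces C[OF b i] rot_facts by (simp add: chain_rot_def fs_def chain_size_def)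
  next
    have "(\<Sum>i<Suc g. if i = 0 then 0 else 1 :: int) = int g" by (subst sum.lessThan_Suc_shift) simp
    then show "int g = (\<Sum>i<Suc g. if i = 0 then 0 else 1) + (int (Suc 0) - 1) * (int (Suc g) - 1)" by simp
  qed (rule fok[OF b], assumption | rule agree[OF b], assumption+ | simp)+
  have eqD: "b = b'" if b: "b \<in> C" "b' \<in> C" and eq: "\<forall>e\<in>parcs A.B.blow. rot b e = rot b' e" for b b'
  proof -
    have "b i = b' i" if i: "i \<in> {1..<Suc g}" for i
    proof -
      have i': "i < Suc g" "i \<noteq> 0" using i by simp_all
      have "heawood_bits ! (b i) ! v = heawood_bits ! (b' i) ! v" if v: "v < 14" for v
      proof -
        have v': "v < length (chain_rot i)" using v i' rot_facts by (simp add: chain_rot_def)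
        have "chain_rot i ! v \<noteq> []" using nth_mem[OF v'] chain_cycles(5)[of i] by metis
        then have d: "hd (chain_rot i ! v) \<in> set (chain_rot i ! v)" by simp
        have "hd (chain_rot i ! v) \<in> set (concat (chain_rot i))" using d nth_mem[OF v'] by auto
        then have "hd (chain_rot i ! v) < chain_size i" using chain_cycles(2)[of i] by blast
        then have "(i, hd (chain_rot i ! v)) \<in> A.E" unfolding A.in_E using i' by simp
        then have "flips chain_rot (bits b) (i, hd (chain_rot i ! v)) = flips chain_rot (bits b') (i, hd (chain_rot i ! v))"
          by (rule A.B.frot_eqD[OF eq[unfolded rot_def]])
        moreover have "flips chain_rot (bits c) (i, hd (chain_rot i ! v)) = bits c i ! v" if "c \<in> C" for c
          by (rule A.flips_nth[where fs = "fs c"]) (rule fok[OF that], assumption | rule agree[OF that], assumption+ | rule i'(1) v' d | simp)+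
        ultimately show ?thesis using b i' by (simp add: bits_def)
      qed
      then have "heawood_bits ! (b i) = heawood_bits ! (b' i)"
        using heawood_bits_facts(3) C[OF b(1) i'] C[OF b(2) i'] by (intro nth_equalityI) simp_all
      then show ?thesis using heawood_bits_facts(1,2) C[OF b(1) i'] C[OF b(2) i'] by (simp add: nth_eq_iff_index_eq)
    qed
    then show ?thesis using b unfolding C_def by (rule PiE_ext[rotated 2])
  qed
  have "\<not> embedding_isomorphic A.B.blow (rot b) A.B.blow (rot b')" if b: "b \<in> C" "b' \<in> C" "rot b \<noteq> rot b'" for b b'
  proof
    assume "embedding_isomorphic A.B.blow (rot b) A.B.blow (rot b')"
    then obtain f where f: "graph_isomorphism f A.B.blow A.B.blow"
      and cases: "(\<forall>e\<in>parcs A.B.blow. map_prod f f (rot b e) = rot b' (map_prod f f e)) \<or>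
        (\<forall>e\<in>parcs A.B.blow. map_prod f f (rot b e) = mirror (rot b') (map_prod f f e))"
      by (auto simp: embedding_isomorphic_def)
    have triv: "map_prod f f e = e" if "e \<in> parcs A.B.blow" for e
      using A.R.automorphism_trivial[OF f] A.B.adj_verts[of "fst e" "snd e"] that by (cases e) simp
    have perm: "rot b permutes parcs A.B.blow"
      using emb[OF b(1)] by (auto simp: polyhedral_embeddings_def polyhedral_def embedding_def)
    have in': "rot b e \<in> parcs A.B.blow" if "e \<in> parcs A.B.blow" for e
      using permutes_in_image[OF perm] that by simp
    from cases show False
    proof
      assume "\<forall>e\<in>parcs A.B.blow. map_prod f f (rot b e) = rot b' (map_prod f f e)"
      then have "\<forall>e\<in>parcs A.B.blow. rot b e = rot b' e" using triv in' by metis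
      then show False using eqD[OF b(1,2)] b(3) by blast
    next
      assume "\<forall>e\<in>parcs A.B.blow. map_prod f f (rot b e) = mirror (rot b') (map_prod f f e)"
      then have m: "\<forall>e\<in>parcs A.B.blow. rot b e = mirror (rot b') e" using triv in' by metis
      \<comment> \<open>At the marked vertex all choices have the bit \<open>True\<close>, whereas a
        mirror image would require opposite bits.\<close>
      have z: "(0, 0) \<in> A.E" unfolding A.in_E using A.size_pos by simp
      have "flips chain_rot (bits b) (0, 0) \<noteq> flips chain_rot (bits b') (0, 0)"
        by (rule A.B.frot_mirror_eqD[OF inv[OF b(2)] m[unfolded rot_def] z])
      moreover have "flips chain_rot (bits c) (0, 0)" if "c \<in> C" for c
      proof -
        have "flips chain_rot (bits c) (0, 0) = bits c 0 ! 0"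
          by (rule A.flips_nth[where fs = "fs c"])
            (rule fok[OF that], assumption | rule agree[OF that], assumption+ | rule A.marks[of 0 0] | simp)+
        then show ?thesis using hub[OF that, of 0] by simp
      qed
      ultimately show False using b by blast
    qed
  qed
  then have "pairwise_non_isomorphic A.B.blow (rot ` C)"
    unfolding pairwise_non_isomorphic_def pairwise_def by blast
  moreover have "inj_on rot C" using eqD by (intro inj_onI) simp
  moreover have "finite C" "card C = 8 ^ g" unfolding C_def by (simp_all add: finite_PiE card_PiE)
  ultimately show ?thesis
    using that[OF A.B.cubic, of "rot ` C"] emb by (simp add: card_image image_subset_iff)
qed

text \<open>The identity is an isomorphism between an embedding and its mirror image, so pairwise
  non-isomorphic embeddings stay distinct when mirror images are identified.\<close>

lemma card_le_num_polyhedral: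
  assumes S: "S \<subseteq> polyhedral_embeddings G g" "pairwise_non_isomorphic G S"
  shows "card S \<le> num_polyhedral G g"
proof -
  have id: "graph_isomorphism id G G" by (simp add: graph_isomorphism_def map_prod.id)
  have "inj_on (\<lambda>nx. {nx, mirror nx}) S"
  proof (rule inj_onI, rule ccontr)
    fix nx nx' assume nx: "nx \<in> S" "nx' \<in> S" "{nx, mirror nx} = {nx', mirror nx'}" "nx \<noteq> nx'"
    then have "nx = mirror nx'" by (metis doubleton_eq_iff)
    then have "embedding_isomorphic G nx G nx'"
      unfolding embedding_isomorphic_def using id by (intro exI[of _ id]) (simp add: map_prod.id)
    then show False using S(2) nx unfolding pairwise_non_isomorphic_def pairwise_def by blast
  qed
  then have "card S = card ((\<lambda>nx. {nx, mirror nx}) ` S)" by (simp add: card_image)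
  also have "\<dots> \<le> num_polyhedral G g"
    unfolding num_polyhedral_def by (intro card_mono finite_imageI finite_polyhedral_embeddings image_mono S(1))
  finally show ?thesis .
qed

theorem theorem8:
  fixes k :: nat
  assumes "k > 0"
  shows
    "(\<exists>(G :: nat pair_pre_digraph) P P' g g'. cubic_graph G \<and>
        P \<in> polyhedral_embeddings G g \<and> P' \<in> polyhedral_embeddings G g' \<and>
        g + k \<le> g' \<and> polyhedral_genera G \<inter> {g<..<g'} = {})
     \<and>
     (\<exists>G :: nat pair_pre_digraph. cubic_graph G \<and> card (polyhedral_genera G) \<ge> k)
     \<and>
     ((\<exists>(G :: nat pair_pre_digraph) g. cubic_graph G \<and> num_polyhedral G g \<ge> k) \<and>
      (\<forall>g. \<exists>G :: nat pair_pre_digraph. cubic_graph G \<and> num_polyhedral G g \<ge> 8 ^ g) \<and>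
      (\<exists>(G :: nat pair_pre_digraph) g. cubic_graph G \<and>
         (\<exists>S \<subseteq> polyhedral_embeddings G g. pairwise_non_isomorphic G S \<and> finite S \<and> card S \<ge> k)) \<and>
      (\<forall>g. \<exists>G :: nat pair_pre_digraph. cubic_graph G \<and>
         (\<exists>S \<subseteq> polyhedral_embeddings G g. pairwise_non_isomorphic G S \<and> finite S \<and> card S \<ge> 8 ^ g)))
     \<and>
     (\<exists>G :: nat pair_pre_digraph. cubic_graph G \<and> polyhedral_genera G \<noteq> {} \<and>
        min_polyhedral_genus G \<ge> mingen G + k)"
proof -
  have many: "\<exists>G :: nat pair_pre_digraph. cubic_graph G \<and> num_polyhedral G g \<ge> m \<and>
    (\<exists>S \<subseteq> polyhedral_embeddings G g. pairwise_non_isomorphic G S \<and> finite S \<and> card S \<ge> m)" if "m \<le> 8 ^ g" for g m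
  proof -
    obtain G :: "nat pair_pre_digraph" and S where *: "cubic_graph G" "S \<subseteq> polyhedral_embeddings G g"
      "pairwise_non_isomorphic G S" "finite S" "card S = 8 ^ g"
      by (rule many_non_isomorphic)
    have "m \<le> num_polyhedral G g" using card_le_num_polyhedral[OF *(2,3)] *(5) that by simp
    moreover have "m \<le> card S" using *(5) that by simp
    ultimately show ?thesis using * by blast
  qed
  have "k \<le> 8 ^ k" using less_exp[of k] power_mono[of 2 "8 :: nat" k] by linarith
  note k = many[OF this]
  obtain G :: "nat pair_pre_digraph" and P P' g g' where "cubic_graph G" "P \<in> polyhedral_embeddings G g"
    "P' \<in> polyhedral_embeddings G g'" "g + k \<le> g'" "polyhedral_genera G \<inter> {g<..<g'} = {}"
    by (rule genus_gap[OF assms])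
  then have a: "\<exists>(G :: nat pair_pre_digraph) P P' g g'. cubic_graph G \<and>
        P \<in> polyhedral_embeddings G g \<and> P' \<in> polyhedral_embeddings G g' \<and>
        g + k \<le> g' \<and> polyhedral_genera G \<inter> {g<..<g'} = {}" by blast
  obtain G :: "nat pair_pre_digraph" where "cubic_graph G" "card (polyhedral_genera G) \<ge> k"
    by (rule many_genera[OF assms])
  then have b: "\<exists>G :: nat pair_pre_digraph. cubic_graph G \<and> card (polyhedral_genera G) \<ge> k" by blast
  obtain G :: "nat pair_pre_digraph" where "cubic_graph G" "polyhedral_genera G \<noteq> {}"
    "min_polyhedral_genus G \<ge> mingen G + k"
    by (rule polyhedral_above_mingen)
  then have d: "\<exists>G :: nat pair_pre_digraph. cubic_graph G \<and> polyhedral_genera G \<noteq> {} \<and>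
        min_polyhedral_genus G \<ge> mingen G + k" by blast
  show ?thesis
    by (intro conjI a b d allI) (use k many[OF order_refl] in blast)+
qed

end
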